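(* Let $t\not\equiv 0\pmod 4$ be a fixed positive integer and let $n$ and $k<n$ be positive integers such that $t\mid 2nk$ and such that one of the following holds: (1) $nk$ is odd, $n\geq k\geq 3$, and $\gcd(n,k-1)=1$; (2) $nk$ is odd, $n\geq k$, and $3<k<200$; (3) $nk$ is odd, $n\geq k\geq 3$, and $n\geq (k-2)(k-1)$. Set $v=2nk+t$. Then there is a family of pairwise non-isomorphic biembeddings $\Pi$ of $K_{\frac{v}{t}\times t}$ such that (a) $\mathrm{Aut}(\Pi)=\mathbb{Z}_{v}$, (b) the faces determined by $\Pi$ have lengths multiples of $k$ strictly greater than $k$, whose cardinality is at least $$\left(1-\frac{2n}{nk-(k-1)}\right)\left(1-O\left(\tfrac{1}{nk}\right)\right)\frac{(nk)!}{2\phi(2nk+t)}=\left(1-O\left(\tfrac1k\right)\right)(1-o(1))\frac{\left(\frac{v-t}{2}\right)!}{2\phi(v)},$$ where the term $\left(1-O\left(\frac1k\right)\right)=1-\frac{2n}{nk-(k-1)}$ is strictly positive for any $k\geq 3$. Moreover, if $v$ is a prime (that can occur only if $t=1$), all the biembeddings of $K_v$ in this family are $kv$-gonal.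
   Context: $\phi(\cdot)$ is Euler's totient function. Asymptotic convention: $t$ is fixed, the constant implied in $O(\frac{1}{nk})$ depends only on $t$, and $o(1)$ is for $nk\to\infty$. $K_{\frac{v}{t}\times t}$ is the complete multipartite graph with $v/t$ parts of size $t$ (so it is $K_v$ when $t=1$); its vertex set is identified with $\mathbb{Z}_v$, two vertices being adjacent iff their difference is not in the subgroup $J=\frac{v}{t}\mathbb{Z}_v$ of order $t$. A (combinatorial, orientable) embedding of a connected graph $\Gamma$ is a pair $\Pi=(\Gamma,\rho)$ where $\rho$ is a permutation of the oriented edges with $\rho(x,y)=(x,\rho_x(y))$, each $\rho_x$ being a cyclic permutation of all neighbours of $x$; this is equivalent to a cellular embedding into an orientable surface. Face boundaries are traced by the orbits of $(x,y)\mapsto\rho(y,x)$; the length of a face is the length of the orbit. A biembedding is an embedding whose faces can be coloured with two colours so that each edge lies on one face of each colour. An embedding is $\ell$-gonal if all its faces have length $\ell$. Two embeddings $(\Gamma,\rho)$ and $(\Gamma',\rho')$ are isomorphic if there is a graph isomorphism $\sigma:\Gamma\to\Gamma'$ (acting on oriented edges by $\sigma(x,y)=(\sigma(x),\sigma(y))$) such that either $\sigma\circ\rho=\rho'\circ\sigma$ or $\sigma\circ\rho=(\rho')^{-1}\circ\sigma$. $\mathrm{Aut}(\Pi)$ is the group of isomorphisms from $\Pi$ to itself; $\mathrm{Aut}(\Pi)=\mathbb{Z}_v$ means that it consists exactly of the translations $\tau_g(x)=x+g$, $g\in\mathbb{Z}_v$. *)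

theory Defs
  imports
    "HOL-Analysis.Analysis"
    "HOL-Library.Landau_Symbols"
    "HOL-Library.FuncSet"
    "HOL-Number_Theory.Totient"
    "HOL-Combinatorics.Orbits"
    "Graph_Theory.Digraph_Component"
begin

text \<open>
  A finite simple graph is a symmetric loop-free digraph (\<open>pair_graph\<close>); its arcs are the
  oriented edges. An embedding is given by a graph together with a rotation
  \<open>r\<close>. It is the identity outside the arcs, because \<open>permutes\<close> demands this,
  so that a combinatorial rotation is represented by exactly one function.
\<close>

type_synonym 'a rotation = "'a \<times> 'a \<Rightarrow> 'a \<times> 'a"

definition neighbours :: "'a pair_pre_digraph \<Rightarrow> 'a \<Rightarrow> 'a set" where
  "neighbours G x = {y. (x, y) \<in> parcs G}"

text \<open>The last clause ranges over arcs, not vertices, because \<open>cyclic_on\<close> fails on the empty set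
  (relevant only for the graph with one vertex).\<close>

definition embedding :: "'a pair_pre_digraph \<Rightarrow> 'a rotation \<Rightarrow> bool" where
  "embedding G r \<longleftrightarrow>
     pair_graph G \<and> Digraph_Component.connected (with_proj G) \<and>
     r permutes parcs G \<and>
     (\<forall>(x, y) \<in> parcs G. fst (r (x, y)) = x \<and>
        cyclic_on (\<lambda>z. snd (r (x, z))) (neighbours G x))"

text \<open>A face is the set of oriented edges in one orbit of \<open>(x, y) \<mapsto> r (y, x)\<close>;
  its length is the cardinality of this set.\<close>

definition faces :: "'a pair_pre_digraph \<Rightarrow> 'a rotation \<Rightarrow> ('a \<times> 'a) set set" where
  "faces G r = orbit (\<lambda>(x, y). r (y, x)) ` parcs G"

definition face_length :: "('a \<times> 'a) set \<Rightarrow> nat" where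
  "face_length f = card f"

definition edges :: "'a pair_pre_digraph \<Rightarrow> 'a set set" where
  "edges G = (\<lambda>(x, y). {x, y}) ` parcs G"

definition edge_on_face :: "'a set \<Rightarrow> ('a \<times> 'a) set \<Rightarrow> bool" where
  "edge_on_face e f \<longleftrightarrow> (\<exists>(x, y) \<in> f. e = {x, y})"

definition biembedding :: "'a pair_pre_digraph \<Rightarrow> 'a rotation \<Rightarrow> bool" where
  "biembedding G r \<longleftrightarrow> embedding G r \<and>
     (\<exists>colour :: ('a \<times> 'a) set \<Rightarrow> bool.
        \<forall>e \<in> edges G. \<forall>b. \<exists>!f. f \<in> faces G r \<and> colour f = b \<and> edge_on_face e f)"

definition gonal :: "nat \<Rightarrow> 'a pair_pre_digraph \<Rightarrow> 'a rotation \<Rightarrow> bool" where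
  "gonal l G r \<longleftrightarrow> (\<forall>f \<in> faces G r. face_length f = l)"

definition graph_isomorphism ::
    "('a \<Rightarrow> 'b) \<Rightarrow> 'a pair_pre_digraph \<Rightarrow> 'b pair_pre_digraph \<Rightarrow> bool" where
  "graph_isomorphism s G H \<longleftrightarrow> bij_betw s (pverts G) (pverts H) \<and>
     (\<forall>x \<in> pverts G. \<forall>y \<in> pverts G. (x, y) \<in> parcs G \<longleftrightarrow> (s x, s y) \<in> parcs H)"

definition embedding_isomorphism ::
    "('a \<Rightarrow> 'b) \<Rightarrow> 'a pair_pre_digraph \<Rightarrow> 'a rotation \<Rightarrow> 'b pair_pre_digraph \<Rightarrow> 'b rotation \<Rightarrow> bool" where
  "embedding_isomorphism s G r H q \<longleftrightarrow> graph_isomorphism s G H \<and>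
     ((\<forall>a \<in> parcs G. map_prod s s (r a) = q (map_prod s s a)) \<or>
      (\<forall>a \<in> parcs G. map_prod s s (r a) = inv q (map_prod s s a)))"

definition isomorphic_embeddings ::
    "'a pair_pre_digraph \<Rightarrow> 'a rotation \<Rightarrow> 'b pair_pre_digraph \<Rightarrow> 'b rotation \<Rightarrow> bool" where
  "isomorphic_embeddings G r H q \<longleftrightarrow> (\<exists>s. embedding_isomorphism s G r H q)"

text \<open>Automorphisms are taken as extensional functions on the vertex set, so that they can be
  compared as functions.\<close>

definition Aut :: "'a pair_pre_digraph \<Rightarrow> 'a rotation \<Rightarrow> ('a \<Rightarrow> 'a) set" where
  "Aut G r = {s \<in> extensional (pverts G). embedding_isomorphism s G r G r}"

text \<open>\<open>\<int>\<^sub>v\<close> is represented by \<open>{0, \<dots>, v - 1}\<close> with arithmetic modulo \<open>v\<close>.\<close>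

definition Zmod :: "nat \<Rightarrow> int set" where
  "Zmod v = {0..<int v}"

definition translation :: "nat \<Rightarrow> int \<Rightarrow> int \<Rightarrow> int" where
  "translation v g = (\<lambda>x \<in> Zmod v. (x + g) mod int v)"

definition subgroup_J :: "nat \<Rightarrow> nat \<Rightarrow> int set" where
  "subgroup_J v t = (\<lambda>a. (int (v div t) * a) mod int v) ` Zmod v"

text \<open>The complete multipartite graph with \<open>v / t\<close> parts of size \<open>t\<close>, for \<open>t\<close> dividing \<open>v\<close>.\<close>

definition multipartite :: "nat \<Rightarrow> nat \<Rightarrow> int pair_pre_digraph" where
  "multipartite v t =
     \<lparr> pverts = Zmod v,
       parcs = {(x, y). x \<in> Zmod v \<and> y \<in> Zmod v \<and> (x - y) mod int v \<notin> subgroup_J v t} \<rparr>"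

definition admissible :: "nat \<Rightarrow> nat \<Rightarrow> nat \<Rightarrow> bool" where
  "admissible t n k \<longleftrightarrow> 0 < n \<and> 0 < k \<and> k < n \<and> t dvd 2 * n * k \<and>
     ((odd (n * k) \<and> n \<ge> k \<and> k \<ge> 3 \<and> gcd n (k - 1) = 1) \<or>
      (odd (n * k) \<and> n \<ge> k \<and> 3 < k \<and> k < 200) \<or>
      (odd (n * k) \<and> n \<ge> k \<and> k \<ge> 3 \<and> n \<ge> (k - 2) * (k - 1)))"

definition admissible_pairs :: "nat \<Rightarrow> (nat \<times> nat) set" where
  "admissible_pairs t = {(n, k). admissible t n k}"

definition main_factor :: "nat \<Rightarrow> nat \<Rightarrow> real" where
  "main_factor n k = 1 - 2 * real n / (real n * real k - (real k - 1))"

end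

theory Submission
  imports Defs
begin

text \<open>
  Write \<open>N = nk\<close>. Call the \<open>2N\<close> edge ends at a vertex darts; on them let \<open>\<nu>\<close> be an involution without
  fixed points and \<open>\<theta>\<close> a full cycle such that all cycles of \<open>\<theta> \<circ> \<nu>\<close> have length \<open>k\<close>. Labelling the
  darts bijectively by the elements of \<open>\<int>\<^sub>v\<close> outside the subgroup of order \<open>t\<close>, with \<open>\<nu>\<close> acting as
  negation, gives a translation-invariant biembedding; its faces have length \<open>k\<close> times the order of the
  sum of the labels along a \<open>\<theta> \<circ> \<nu>\<close>-cycle. Such \<open>\<theta>\<close> and \<open>\<nu>\<close> come from two permutations of an
  \<open>n \<times> k\<close> grid with all cycles of length \<open>k\<close> whose product is a full cycle.

  There are \<open>2\<^sup>N N!\<close> labellings. A bounded fraction of them has a vanishing face sum. An automorphism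
  fixing \<open>0\<close> is determined by one of about \<open>4N\<close> permutations of the darts, and each nontrivial one forces
  several independent linear relations between labels, which hold with probability \<open>O(1/N\<^sup>2)\<close>. Hence a
  positive fraction of the labellings is good. An isomorphism between good embeddings normalises the
  translations, so it is affine, and isomorphism classes have size at most \<open>4vN\<close>. Since \<open>2\<^sup>N\<close> outgrows
  every polynomial, at least \<open>N!\<close> classes remain once \<open>N \<ge> 300\<close>.
\<close>

section \<open>Labellings of a system of darts\<close>

text \<open>The number of relations is dictated by a union bound. A dart permutation that commutes
  with \<open>\<theta>\<close>, or reverses it, is known from one value, so about 4N candidates
  compete and a single relation of probability O(1/N) would leave nothing. Two relations suffice
  when the permutation changes from a vertex to its neighbours. When it does not, the automorphism
  is multiplication by an unknown u in Z_v, and the O(N) choices of u are paid for by a third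
  relation. Independence is obtained by counting: each relation involves a dart whose edge is
  untouched by the earlier ones, and exchanging that dart with other darts redistributes its label.

  The factor 2^N comes from a free choice of sign for each pair d, \<open>\<nu> d\<close>; it allows
  crude bounds for the proportion of good labellings and for the size of an isomorphism class. The
  error term O(1/N) absorbs the small cases: for N < 300 it may equal 1, so that the empty family is
  enough, and for N \<ge> 300 it is 0.\<close>

lemma finite_Zmod [simp]: "finite (Zmod v)" and card_Zmod [simp]: "card (Zmod v) = v"
  by (simp_all add: Zmod_def)

text \<open>The residue of c * z modulo v is prescribed, so z is determined by the quotient of c * z
  by v, and 0 \<le> z < v leaves only c quotients.\<close>

lemma card_linear_congruence_le:
  fixes v :: nat and c w :: int
  assumes "0 < v" "0 < c"
  shows "finite {z \<in> Zmod v. [c * z + w = 0] (mod int v)}"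
    and "card {z \<in> Zmod v. [c * z + w = 0] (mod int v)} \<le> nat c"
proof -
  let ?X = "{z \<in> Zmod v. [c * z + w = 0] (mod int v)}"
  show fin: "finite ?X" by simp
  have inj: "inj_on (\<lambda>z. c * z div int v) ?X"
  proof (rule inj_onI)
    fix x y assume "x \<in> ?X" "y \<in> ?X" and eq: "c * x div int v = c * y div int v"
    then have "[c * x + w = c * y + w] (mod int v)"
      by (metis (mono_tags, lifting) cong_sym cong_trans mem_Collect_eq)
    then have "c * x mod int v = c * y mod int v"
      using cong_add_rcancel unfolding cong_def by blast
    then have "c * x = c * y" using eq by (metis mult_div_mod_eq)
    then show "x = y" using assms by simp
  qed
  have "(\<lambda>z. c * z div int v) ` ?X \<subseteq> {0..<c}"
  proof (rule image_subsetI)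
    fix z assume "z \<in> ?X"
    then have "0 \<le> z" "z < int v" by (auto simp: Zmod_def)
    then have "0 \<le> c * z" "c * z < c * int v" using assms by auto
    moreover have "c * z div int v * int v \<le> c * z"
      using assms by (metis minus_mod_eq_div_mult le_add_same_cancel1 diff_ge_0_iff_ge pos_mod_sign of_nat_0_less_iff minus_div_mult_eq_mod)
    ultimately have "c * z div int v * int v < c * int v" by linarith
    then have "c * z div int v < c" using assms by simp
    moreover have "0 \<le> c * z div int v"
      using \<open>0 \<le> c * z\<close> assms by (simp add: pos_imp_zdiv_nonneg_iff)
    ultimately show "c * z div int v \<in> {0..<c}" by simp
  qed
  then have "card ?X \<le> card {0..<c}" using inj by (intro card_inj_on_le) auto
  then show "card ?X \<le> nat c" by simp
qed

lemma Zmod_cong_eq: "x \<in> Zmod v \<Longrightarrow> y \<in> Zmod v \<Longrightarrow> [x = y] (mod int v) \<Longrightarrow> x = y"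
  by (auto simp: Zmod_def cong_def)

lemma mod_in_Zmod [simp]: "0 < v \<Longrightarrow> x mod int v \<in> Zmod v"
  by (simp add: Zmod_def)

lemma Zmod_mod [simp]: "x \<in> Zmod v \<Longrightarrow> x mod int v = x"
  by (simp add: Zmod_def)

locale dart_system =
  fixes D :: "'d set" and \<theta> \<nu> :: "'d \<Rightarrow> 'd"
  assumes finite_D: "finite D"
    and nu_in: "d \<in> D \<Longrightarrow> \<nu> d \<in> D"
    and nu_nu: "d \<in> D \<Longrightarrow> \<nu> (\<nu> d) = d"
    and nu_neq: "d \<in> D \<Longrightarrow> \<nu> d \<noteq> d"
    and cyclic_theta: "cyclic_on \<theta> D"
begin

lemma D_nonempty: "D \<noteq> {}"
  using cyclic_theta by (auto simp: cyclic_on_def)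

lemma theta_in: "d \<in> D \<Longrightarrow> \<theta> d \<in> D"
  using cyclic_on_inI[OF cyclic_theta] .

lemma orbit_theta: "d \<in> D \<Longrightarrow> orbit \<theta> d = D"
  using orbit_cyclic_eq3[OF cyclic_theta] .

lemma theta_surj: "\<theta> ` D = D"
proof
  show "D \<subseteq> \<theta> ` D"
  proof
    fix x assume "x \<in> D"
    then have "x \<in> orbit \<theta> x" using orbit_theta by blast
    then show "x \<in> \<theta> ` D"
    proof cases
      case (step y)
      then show ?thesis using orbit_theta[OF \<open>x \<in> D\<close>] by blast
    qed (use \<open>x \<in> D\<close> in blast)
  qed
qed (use theta_in in blast)

lemma theta_inj: "inj_on \<theta> D"
  using theta_surj finite_D by (simp add: finite_surj_inj eq_card_imp_inj_on)

lemma nu_inj: "inj_on \<nu> D"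
  using nu_nu by (metis inj_onI)

text \<open>An exchange of two darts also exchanges their \<open>\<nu>\<close>-images, so a set of
  darts whose labels have to survive exchanges must be closed under \<open>\<nu>\<close>.\<close>

definition nu_closure :: "'d set \<Rightarrow> 'd set" where
  "nu_closure A = A \<union> \<nu> ` A"

lemma nu_closure:
  assumes "A \<subseteq> D"
  shows "A \<subseteq> nu_closure A" "nu_closure A \<subseteq> D" "\<nu> ` nu_closure A \<subseteq> nu_closure A"
  using assms nu_in nu_nu by (auto simp: nu_closure_def)

lemma card_nu_closure_le: "finite A \<Longrightarrow> card (nu_closure A) \<le> 2 * card A"
  unfolding nu_closure_def by (metis add_mono card_Un_le card_image_le le_refl le_trans mult_2)

text \<open>The elements of \<open>commutant False\<close> conjugate \<open>\<theta>\<close> to its inverse, since \<open>\<theta>\<close> is injective on \<open>D\<close>.\<close>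

definition commutant :: "bool \<Rightarrow> ('d \<Rightarrow> 'd) set" where
  "commutant \<epsilon> = {\<psi> \<in> extensional D. bij_betw \<psi> D D \<and>
     (\<forall>d \<in> D. if \<epsilon> then \<psi> (\<theta> d) = \<theta> (\<psi> d) else \<theta> (\<psi> (\<theta> d)) = \<psi> d)}"

lemma commutant_in: "\<psi> \<in> commutant \<epsilon> \<Longrightarrow> d \<in> D \<Longrightarrow> \<psi> d \<in> D"
  by (auto simp: commutant_def bij_betw_def)

lemma commutant_eqD: "\<psi> \<in> commutant \<epsilon> \<Longrightarrow> d \<in> D \<Longrightarrow> e \<in> D \<Longrightarrow> \<psi> d = \<psi> e \<Longrightarrow> d = e"
  by (auto simp: commutant_def bij_betw_def inj_on_def)

text \<open>Agreement at one dart propagates along \<open>\<theta>\<close>, whose single cycle is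
  all of \<open>D\<close>; in the reversing case \<open>\<theta>\<close> is cancelled by
  injectivity.\<close>

lemma commutant_unique:
  assumes "\<psi> \<in> commutant \<epsilon>" "\<psi>' \<in> commutant \<epsilon>" "a \<in> D" "\<psi> a = \<psi>' a"
  shows "\<psi> = \<psi>'"
proof -
  have step: "\<psi> (\<theta> d) = \<psi>' (\<theta> d)" if "d \<in> D" "\<psi> d = \<psi>' d" for d
  proof (cases \<epsilon>)
    case True
    then show ?thesis using assms(1,2) that by (simp add: commutant_def)
  next
    case False
    then have "\<theta> (\<psi> (\<theta> d)) = \<theta> (\<psi>' (\<theta> d))" using assms(1,2) that by (simp add: commutant_def)
    then show ?thesis
      using theta_inj that assms(1,2) commutant_in theta_in by (meson inj_onD)
  qed
  have "\<psi> d = \<psi>' d" if "d \<in> orbit \<theta> a" for d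
    using that
  proof induction
    case base
    then show ?case using step assms(3,4) by blast
  next
    case (step y)
    then show ?case using \<open>\<And>d. d \<in> D \<Longrightarrow> \<psi> d = \<psi>' d \<Longrightarrow> \<psi> (\<theta> d) = \<psi>' (\<theta> d)\<close> orbit_theta[OF assms(3)] by blast
  qed
  then show ?thesis
    using assms orbit_theta by (intro extensionalityI[of _ D]) (auto simp: commutant_def)
qed

lemma finite_commutant: "finite (commutant \<epsilon>)"
  and card_commutant_le: "card (commutant \<epsilon>) \<le> card D"
proof -
  obtain a where a: "a \<in> D" using D_nonempty by blast
  have "inj_on (\<lambda>\<psi>. \<psi> a) (commutant \<epsilon>)" using commutant_unique a by (auto intro!: inj_onI)
  moreover have "(\<lambda>\<psi>. \<psi> a) ` commutant \<epsilon> \<subseteq> D" using a commutant_in by blast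
  ultimately show "finite (commutant \<epsilon>)" "card (commutant \<epsilon>) \<le> card D"
    using finite_D by (auto intro: inj_on_finite card_inj_on_le)
qed

end

text \<open>\<open>S_neg_neq\<close> rules out 0 and an element of order two: \<open>\<nu>\<close>
  has no fixed point, so under an injective labelling no label equals its own negative.\<close>

locale labelled_darts = dart_system D \<theta> \<nu> for D :: "'d set" and \<theta> \<nu> +
  fixes v :: nat and S :: "int set"
  assumes v_pos: "0 < v"
    and S_Zmod: "S \<subseteq> Zmod v"
    and S_neg: "x \<in> S \<Longrightarrow> (- x) mod int v \<in> S"
    and S_neg_neq: "x \<in> S \<Longrightarrow> (- x) mod int v \<noteq> x"
    and card_S: "card S = card D"
begin

definition labellings :: "('d \<Rightarrow> int) set" where
  "labellings = {s \<in> D \<rightarrow>\<^sub>E S. inj_on s D \<and> (\<forall>d \<in> D. s (\<nu> d) = (- s d) mod int v)}"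

lemma finite_S: "finite S"
  using S_Zmod finite_subset finite_Zmod by blast

lemma finite_labellings: "finite labellings"
  unfolding labellings_def using finite_D finite_S by (simp add: finite_PiE)

lemma labellings_in: "s \<in> labellings \<Longrightarrow> d \<in> D \<Longrightarrow> s d \<in> S"
  by (auto simp: labellings_def)

lemma labellings_Zmod: "s \<in> labellings \<Longrightarrow> d \<in> D \<Longrightarrow> s d \<in> Zmod v"
  using labellings_in S_Zmod by blast

lemma labellings_inj: "s \<in> labellings \<Longrightarrow> inj_on s D"
  by (auto simp: labellings_def)

lemma labellings_eqD: "s \<in> labellings \<Longrightarrow> d \<in> D \<Longrightarrow> e \<in> D \<Longrightarrow> s d = s e \<Longrightarrow> d = e"
  using labellings_inj by (meson inj_onD)

lemma labellings_image: "s \<in> labellings \<Longrightarrow> s ` D = S"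
  using labellings_in labellings_inj card_S finite_S
  by (metis card_image card_subset_eq image_subsetI)

lemma labellings_neg: "s \<in> labellings \<Longrightarrow> d \<in> D \<Longrightarrow> s (\<nu> d) = (- s d) mod int v"
  by (auto simp: labellings_def)

lemma labellings_neg_cong: "s \<in> labellings \<Longrightarrow> d \<in> D \<Longrightarrow> [s (\<nu> d) = - s d] (mod int v)"
  by (simp add: labellings_neg cong_def)

text \<open>The order of the tests also covers b = a and b = \<open>\<nu> a\<close>, where the map
  is the identity and the exchange of a with \<open>\<nu> a\<close>, respectively. For darts a and b
  it is always an involution commuting with \<open>\<nu>\<close>, so it acts on labellings.\<close>

definition swap_darts :: "'d \<Rightarrow> 'd \<Rightarrow> 'd \<Rightarrow> 'd" where
  "swap_darts a b x = (if x = a then b else if x = \<nu> a then \<nu> b else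
     if x = b then a else if x = \<nu> b then \<nu> a else x)"

lemma swap_darts_props:
  assumes "a \<in> D" "b \<in> D"
  shows "swap_darts a b (swap_darts a b x) = x"
    and "x \<in> D \<Longrightarrow> swap_darts a b x \<in> D"
    and "x \<notin> D \<Longrightarrow> swap_darts a b x = x"
    and "x \<in> D \<Longrightarrow> swap_darts a b (\<nu> x) = \<nu> (swap_darts a b x)"
    and "swap_darts a b b = a"
proof -
  note F = nu_in[OF assms(1)] nu_in[OF assms(2)] nu_nu[OF assms(1)] nu_nu[OF assms(2)]
    nu_neq[OF assms(1)] nu_neq[OF assms(2)]
  show "swap_darts a b (swap_darts a b x) = x"
    using F unfolding swap_darts_def by (smt (verit))
  show "x \<in> D \<Longrightarrow> swap_darts a b x \<in> D"
    using F assms unfolding swap_darts_def by (smt (verit))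
  show "x \<notin> D \<Longrightarrow> swap_darts a b x = x"
    using F assms unfolding swap_darts_def by (smt (verit))
  show "x \<in> D \<Longrightarrow> swap_darts a b (\<nu> x) = \<nu> (swap_darts a b x)"
    using F assms nu_nu[of x] unfolding swap_darts_def by (smt (verit))
  show "swap_darts a b b = a"
    using F assms unfolding swap_darts_def by (smt (verit))
qed

lemma swap_darts_labellings:
  assumes "s \<in> labellings" "a \<in> D" "b \<in> D"
  shows "s \<circ> swap_darts a b \<in> labellings"
proof -
  note F = swap_darts_props[OF assms(2,3)]
  have "s \<circ> swap_darts a b \<in> D \<rightarrow>\<^sub>E S"
    using F assms by (auto simp: labellings_def PiE_iff extensional_def)
  moreover have "inj_on (s \<circ> swap_darts a b) D"
  proof (rule inj_onI)
    fix x y assume "x \<in> D" "y \<in> D" "(s \<circ> swap_darts a b) x = (s \<circ> swap_darts a b) y"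
    then have "swap_darts a b x = swap_darts a b y"
      using F(2) labellings_eqD[OF assms(1)] by simp
    then show "x = y" using F(1) by metis
  qed
  moreover have "(s \<circ> swap_darts a b) (\<nu> d) = (- (s \<circ> swap_darts a b) d) mod int v" if "d \<in> D" for d
    using F(2,4) that labellings_neg[OF assms(1)] by simp
  ultimately show ?thesis by (simp add: labellings_def)
qed

text \<open>Swapping \<open>a\<close> with any dart outside \<open>K\<close> leaves \<open>P\<close> and \<open>B\<close> unchanged and spreads the
  label of \<open>a\<close> over \<open>card D - card K\<close> darts, so that it rarely lies in \<open>B s\<close>.\<close>

lemma card_label_in_le:
  assumes K: "K \<subseteq> D" "\<nu> ` K \<subseteq> K" and a: "a \<in> D" "a \<notin> K"
    and P: "\<And>s s'. s \<in> labellings \<Longrightarrow> s' \<in> labellings \<Longrightarrow> (\<And>d. d \<in> K \<Longrightarrow> s d = s' d) \<Longrightarrow> P s \<Longrightarrow> P s'"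
    and B: "\<And>s s'. s \<in> labellings \<Longrightarrow> s' \<in> labellings \<Longrightarrow> (\<And>d. d \<in> K \<Longrightarrow> s d = s' d) \<Longrightarrow> B s = B s'"
    and finB: "\<And>s. finite (B s)" and card_B: "\<And>s. card (B s) \<le> b"
  shows "card {s \<in> labellings. P s \<and> s a \<in> B s} * (card D - card K) \<le> b * card {s \<in> labellings. P s}"
proof -
  let ?X = "{s \<in> labellings. P s \<and> s a \<in> B s}"
  let ?Y = "SIGMA s : {s \<in> labellings. P s}. B s"
  let ?F = "\<lambda>(s, d). (s \<circ> swap_darts a d, s a)"
  have agree: "s (swap_darts a d x) = s x" if "d \<in> D - K" "x \<in> K" for s :: "'d \<Rightarrow> int" and d x
  proof -
    have "x \<noteq> a" "x \<noteq> d" using that a by auto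
    moreover have "x \<noteq> \<nu> a" "x \<noteq> \<nu> d" using that a K nu_nu by (metis DiffE image_subset_iff)+
    ultimately show ?thesis by (simp add: swap_darts_def)
  qed
  \<comment> \<open>The second component of \<open>?F\<close> is the label that the exchanged
    labelling gives to d. Since that labelling is injective, d can be read off, and undoing the
    exchange recovers s.\<close>
  have inj: "inj_on ?F (?X \<times> (D - K))"
  proof (rule inj_onI, clarsimp)
    fix s d s' d'
    assume *: "s \<in> labellings" "s' \<in> labellings" "d \<in> D" "d' \<in> D" "s a = s' a"
      and eq: "s \<circ> swap_darts a d = s' \<circ> swap_darts a d'"
    have "(s \<circ> swap_darts a d) d = (s \<circ> swap_darts a d) d'"
      using swap_darts_props(5)[OF a(1) *(3)] swap_darts_props(5)[OF a(1) *(4)] * fun_cong[OF eq, of d']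
      by simp
    then have dd: "d = d'"
      using labellings_eqD[OF swap_darts_labellings[OF *(1) a(1) *(3)]] * by blast
    have "s x = s' x" for x
      using fun_cong[OF eq, of "swap_darts a d x"] swap_darts_props(1)[OF a(1) *(3)] dd by simp
    then show "s = s' \<and> d = d'" using dd by auto
  qed
  have sub: "?F ` (?X \<times> (D - K)) \<subseteq> ?Y"
  proof clarsimp
    fix s d assume *: "s \<in> labellings" "P s" "s a \<in> B s" "d \<in> D" "d \<notin> K"
    have s': "s \<circ> swap_darts a d \<in> labellings" using swap_darts_labellings * a by blast
    have ag: "s x = (s \<circ> swap_darts a d) x" if "x \<in> K" for x using agree[of d x s] that * by simp
    show "s \<circ> swap_darts a d \<in> labellings \<and> P (s \<circ> swap_darts a d) \<and> s a \<in> B (s \<circ> swap_darts a d)"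
      using s' P[OF *(1) s' ag] B[OF *(1) s' ag] * by metis
  qed
  have finY: "finite ?Y" using finite_labellings finB by auto
  have "card (?X \<times> (D - K)) \<le> card ?Y" by (rule card_inj_on_le[OF inj sub finY])
  also have "\<dots> = (\<Sum>s \<in> {s \<in> labellings. P s}. card (B s))"
    using finite_labellings finB by (subst card_SigmaI) auto
  also have "\<dots> \<le> b * card {s \<in> labellings. P s}"
    using sum_bounded_above[of "{s \<in> labellings. P s}" "\<lambda>s. card (B s)" b] card_B by (simp add: mult.commute)
  finally show ?thesis
    using K finite_D by (simp add: card_cartesian_product card_Diff_subset finite_subset)
qed

text \<open>Each of b, c, d may coincide with a or \<open>\<nu> a\<close>, so the label of a is
  collected first: \<open>m x\<close> is its coefficient in the label of x, and \<open>r s x\<close>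
  is the rest, which for these darts depends on \<open>K\<close> only. The three disequalities say
  that no term cancels the label of a, whence the total coefficient \<open>C\<close> lies between 1
  and 4 and the congruence has at most 4 solutions.\<close>

lemma card_equation_le:
  assumes K: "K \<subseteq> D" "\<nu> ` K \<subseteq> K" and a: "a \<in> D" "a \<notin> K"
    and bcd: "b \<in> D" "c \<in> D" "d \<in> D" "a \<noteq> \<nu> b" "a \<noteq> c" "a \<noteq> d"
    and sub: "{b, c, d} \<subseteq> K \<union> {a, \<nu> a}"
    and P: "\<And>s s'. s \<in> labellings \<Longrightarrow> s' \<in> labellings \<Longrightarrow> (\<And>d. d \<in> K \<Longrightarrow> s d = s' d) \<Longrightarrow> P s \<Longrightarrow> P s'"
  shows "card {s \<in> labellings. P s \<and> [s a + s b = s c + s d] (mod int v)} * (card D - card K)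
    \<le> 4 * card {s \<in> labellings. P s}"
proof -
  define m :: "'d \<Rightarrow> int" where "m x = (if x = a then 1 else if x = \<nu> a then -1 else 0)" for x
  define r where "r s x = (if x \<in> {a, \<nu> a} then 0 else s x)" for s :: "'d \<Rightarrow> int" and x
  define C where "C = 1 + m b - m c - m d"
  define B where "B s = {z \<in> Zmod v. [C * z + (r s b - r s c - r s d) = 0] (mod int v)}" for s
  have "b \<noteq> \<nu> a" using bcd a nu_nu by metis
  then have C: "0 < C" "C \<le> 4" using bcd by (auto simp: C_def m_def)
  have dec: "[s x = m x * s a + r s x] (mod int v)" if "s \<in> labellings" for s x
    using labellings_neg_cong[OF that a(1)] by (auto simp: m_def r_def)
  have eqB: "[s a + s b = s c + s d] (mod int v) \<longleftrightarrow> s a \<in> B s" if s: "s \<in> labellings" for s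
  proof -
    have "[s a + s b - (s c + s d) = s a + (m b * s a + r s b) - ((m c * s a + r s c) + (m d * s a + r s d))] (mod int v)"
      by (intro cong_add cong_diff cong_refl dec s)
    also have "s a + (m b * s a + r s b) - ((m c * s a + r s c) + (m d * s a + r s d))
        = C * s a + (r s b - r s c - r s d)" by (simp add: C_def algebra_simps)
    finally have "[s a + s b - (s c + s d) = 0] (mod int v) \<longleftrightarrow> [C * s a + (r s b - r s c - r s d) = 0] (mod int v)"
      using cong_sym cong_trans by blast
    moreover have "[s a + s b = s c + s d] (mod int v) \<longleftrightarrow> [s a + s b - (s c + s d) = 0] (mod int v)"
      using cong_diff_iff_cong_0 by blast
    ultimately show ?thesis using labellings_Zmod[OF s a(1)] by (simp add: B_def)
  qed
  have "card {s \<in> labellings. P s \<and> s a \<in> B s} * (card D - card K) \<le> 4 * card {s \<in> labellings. P s}"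
  proof (rule card_label_in_le[OF K a P])
    fix s s' assume "s \<in> labellings" "s' \<in> labellings" and eq: "\<And>d. d \<in> K \<Longrightarrow> s d = s' d"
    have "r s x = r s' x" if "x \<in> {b, c, d}" for x using that sub eq by (auto simp: r_def)
    then show "B s = B s'" by (simp add: B_def)
  next
    fix s show "finite (B s)" using card_linear_congruence_le(1)[OF v_pos C(1)] by (simp add: B_def)
    have "card (B s) \<le> nat C" using card_linear_congruence_le(2)[OF v_pos C(1)] by (simp add: B_def)
    then show "card (B s) \<le> 4" using C by linarith
  qed
  moreover have "{s \<in> labellings. P s \<and> s a \<in> B s} = {s \<in> labellings. P s \<and> [s a + s b = s c + s d] (mod int v)}"
    using eqB by blast
  ultimately show ?thesis by simp
qed

end

section \<open>Faces and hypothetical automorphisms\<close>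

text \<open>\<open>\<kappa>\<close> is the future face colour: \<open>\<nu>\<close> and
  \<open>\<theta>\<close> both reverse it, so it is constant along the cycles of
  \<open>\<theta> \<circ> \<nu>\<close>. By \<open>S_sum\<close> every vertex is at most two arcs
  away from any other; this gives connectedness and lets a map be recovered from its behaviour near
  0.\<close>

locale face_darts = labelled_darts D \<theta> \<nu> v S for D :: "'d set" and \<theta> \<nu> v S +
  fixes \<kappa> :: "'d \<Rightarrow> bool" and n k :: nat
  assumes n_ge: "5 \<le> n" and k_ge: "3 \<le> k" and odd_k: "odd k"
    and card_D: "card D = 2 * n * k"
    and v_le: "v \<le> 2 * card D"
    and nu_colour: "d \<in> D \<Longrightarrow> \<kappa> (\<nu> d) \<longleftrightarrow> \<not> \<kappa> d"
    and theta_colour: "d \<in> D \<Longrightarrow> \<kappa> (\<theta> d) \<longleftrightarrow> \<not> \<kappa> d"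
    and face_period: "d \<in> D \<Longrightarrow> ((\<theta> \<circ> \<nu>) ^^ k) d = d"
    and face_minimal: "d \<in> D \<Longrightarrow> 0 < j \<Longrightarrow> j < k \<Longrightarrow> ((\<theta> \<circ> \<nu>) ^^ j) d \<noteq> d"
    and S_sum: "x \<in> Zmod v \<Longrightarrow> x \<in> S \<or> (\<exists>a \<in> S. \<exists>b \<in> S. x = (a + b) mod int v)"
begin

definition \<phi> :: "'d \<Rightarrow> 'd" where
  "\<phi> = \<theta> \<circ> \<nu>"

lemmas phi_period = face_period[folded \<phi>_def]
lemmas phi_minimal = face_minimal[folded \<phi>_def]

lemma phi_in: "d \<in> D \<Longrightarrow> \<phi> d \<in> D"
  by (simp add: \<phi>_def nu_in theta_in)

lemma phi_funpow_in: "d \<in> D \<Longrightarrow> (\<phi> ^^ j) d \<in> D"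
  by (induction j) (auto intro: phi_in)

lemma phi_colour: "d \<in> D \<Longrightarrow> \<kappa> (\<phi> d) \<longleftrightarrow> \<kappa> d"
  by (simp add: \<phi>_def nu_in nu_colour theta_colour)

lemma phi_funpow_colour: "d \<in> D \<Longrightarrow> \<kappa> ((\<phi> ^^ j) d) \<longleftrightarrow> \<kappa> d"
  by (induction j) (auto simp: phi_colour phi_funpow_in)

lemma card_D_ge: "30 \<le> card D"
proof -
  have "5 * 3 \<le> n * k" using n_ge k_ge by (rule mult_le_mono)
  then show ?thesis unfolding card_D by linarith
qed

lemma theta_funpow_neq:
  assumes "d \<in> D" "0 < m" "m < card D"
  shows "(\<theta> ^^ m) d \<noteq> d"
proof
  assume "(\<theta> ^^ m) d = d"
  then have "D = (\<lambda>j. (\<theta> ^^ j) d) ` {..<m}"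
    using orbit_altdef_bounded[of m \<theta> d] assms orbit_theta by auto
  then show False using assms(3) by (metis card_image_le card_lessThan finite_lessThan not_le)
qed

section \<open>Edges moved by a dart permutation\<close>

lemma id_commutant: "restrict id D \<in> commutant True"
  using theta_in by (auto simp: commutant_def bij_betw_def inj_on_def)

lemma commutant_True_fixed:
  assumes "\<psi> \<in> commutant True" "d \<in> D" "\<psi> d = d"
  shows "\<psi> = restrict id D"
  using commutant_unique[OF assms(1) id_commutant assms(2)] assms by simp

lemma commutant_True_step: "\<psi> \<in> commutant True \<Longrightarrow> d \<in> D \<Longrightarrow> \<psi> (\<theta> d) = \<theta> (\<psi> d)"
  by (simp add: commutant_def)

lemma commutant_False_step: "\<psi> \<in> commutant False \<Longrightarrow> d \<in> D \<Longrightarrow> \<theta> (\<psi> (\<theta> d)) = \<psi> d"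
  by (simp add: commutant_def)

text \<open>Suppose that every dart of the face is fixed or sent to its \<open>\<nu>\<close>-image.
  If \<open>\<psi>\<close> commutes with \<open>\<theta>\<close> and is not the identity, it fixes
  no dart, hence acts as \<open>\<nu>\<close> on the face; then two face steps equal two steps of
  \<open>\<theta>\<close>, and \<open>\<theta>\<close> would close up after 2k < 2nk steps. If
  \<open>\<psi>\<close> reverses \<open>\<theta>\<close>, fixed and flipped darts must alternate
  around the face, which is impossible because k is odd.\<close>

lemma face_has_moved_edge:
  assumes \<psi>: "\<psi> \<in> commutant \<epsilon>" and comm: "\<And>d. d \<in> D \<Longrightarrow> \<psi> (\<nu> d) = \<nu> (\<psi> d)"
    and nontriv: "\<not> (\<epsilon> \<and> \<psi> = restrict id D)" and d: "d \<in> D"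
  shows "\<exists>j. \<psi> ((\<phi> ^^ j) d) \<noteq> (\<phi> ^^ j) d \<and> \<psi> ((\<phi> ^^ j) d) \<noteq> \<nu> ((\<phi> ^^ j) d)"
proof (rule ccontr)
  define x where "x j = (\<phi> ^^ j) d" for j
  assume "\<not> ?thesis"
  then have W: "\<psi> (x j) = x j \<or> \<psi> (x j) = \<nu> (x j)" for j by (auto simp: x_def)
  have xD: "x j \<in> D" for j using phi_funpow_in[OF d] by (simp add: x_def)
  have xSuc: "x (Suc j) = \<theta> (\<nu> (x j))" for j by (simp add: x_def \<phi>_def)
  show False
  proof (cases \<epsilon>)
    case True
    then have \<psi>T: "\<psi> \<in> commutant True" using \<psi> by simp
    have flip: "\<psi> (x j) = \<nu> (x j)" for j
      using W[of j] commutant_True_fixed[OF \<psi>T xD] nontriv True by blast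
    have "x (Suc (Suc j)) = \<theta> (\<theta> (x j))" for j
    proof -
      have "x (Suc (Suc j)) = \<theta> (\<psi> (\<theta> (\<nu> (x j))))" using flip[of "Suc j"] by (simp add: xSuc)
      also have "\<dots> = \<theta> (\<theta> (\<psi> (\<nu> (x j))))" using commutant_True_step[OF \<psi>T] xD nu_in by simp
      also have "\<psi> (\<nu> (x j)) = x j" using comm[OF xD] flip[of j] nu_nu[OF xD] by simp
      finally show ?thesis .
    qed
    moreover have "x 0 = d" by (simp add: x_def)
    ultimately have "x (2 * j) = (\<theta> ^^ (2 * j)) d" for j
      by (induction j) simp_all
    moreover have "x (2 * k) = d"
      using phi_period[OF d] by (simp add: x_def mult_2 funpow_add)
    ultimately have "(\<theta> ^^ (2 * k)) d = d" by metis
    moreover have "2 * k < card D" using n_ge k_ge by (simp add: card_D)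
    ultimately show False using theta_funpow_neq[OF d, of "2 * k"] k_ge by simp
  next
    case False
    then have \<psi>F: "\<psi> \<in> commutant False" using \<psi> by simp
    have th: "\<theta> (\<psi> (x (Suc j))) = \<nu> (\<psi> (x j))" for j
      using commutant_False_step[OF \<psi>F nu_in[OF xD]] comm[OF xD] by (simp add: xSuc)
    have alt: "(\<psi> (x (Suc j)) = x (Suc j)) \<longleftrightarrow> \<not> (\<psi> (x j) = x j)" for j
    proof (cases "\<psi> (x j) = x j")
      case True
      have "\<psi> (x (Suc j)) \<noteq> x (Suc j)"
      proof
        assume "\<psi> (x (Suc j)) = x (Suc j)"
        then have "(\<theta> ^^ 2) (\<nu> (x j)) = \<nu> (x j)"
          using th[of j] True by (simp add: xSuc numeral_2_eq_2)
        then show False using theta_funpow_neq[OF nu_in[OF xD], of 2] card_D_ge by simp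
      qed
      then show ?thesis using True by simp
    next
      case nf: False
      have "\<psi> (x (Suc j)) \<noteq> \<nu> (x (Suc j))"
      proof
        assume "\<psi> (x (Suc j)) = \<nu> (x (Suc j))"
        then have "x (Suc (Suc j)) = x j"
          using th[of j] nf W[of j] nu_nu[OF xD] by (simp add: xSuc)
        then have "(\<phi> ^^ 2) (x j) = x j" by (simp add: x_def numeral_2_eq_2)
        then show False using phi_minimal[OF xD, of 2] k_ge by simp
      qed
      then show ?thesis using nf W[of "Suc j"] by blast
    qed
    have "(\<psi> (x j) = x j) \<longleftrightarrow> ((\<psi> (x 0) = x 0) = even j)" for j
      by (induction j) (use alt in auto)
    moreover have "x k = x 0" using phi_period[OF d] by (simp add: x_def)
    ultimately show False using odd_k by metis
  qed
qed

text \<open>Every dart is reached from a moved dart of its own face by fewer than k steps, so there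
  are at least 2n \<ge> 10 moved darts, enough to pick one whose image avoids any given set of
  8.\<close>

lemma card_moved_edges:
  assumes "\<psi> \<in> commutant \<epsilon>" and "\<And>d. d \<in> D \<Longrightarrow> \<psi> (\<nu> d) = \<nu> (\<psi> d)"
    and "\<not> (\<epsilon> \<and> \<psi> = restrict id D)"
  shows "10 \<le> card {d \<in> D. \<psi> d \<noteq> d \<and> \<psi> d \<noteq> \<nu> d}"
proof -
  let ?V = "{d \<in> D. \<psi> d \<noteq> d \<and> \<psi> d \<noteq> \<nu> d}"
  have period: "(\<phi> ^^ (m * k)) d = d" if "d \<in> D" for m d
    by (induction m) (simp_all add: funpow_add phi_period that)
  have mod_k: "(\<phi> ^^ (j mod k)) d = (\<phi> ^^ j) d" if "d \<in> D" for j d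
  proof -
    have "(\<phi> ^^ j) d = (\<phi> ^^ (j mod k + j div k * k)) d" by simp
    also have "\<dots> = (\<phi> ^^ (j mod k)) ((\<phi> ^^ (j div k * k)) d)"
      unfolding funpow_add by simp
    finally show ?thesis using period[OF that] by simp
  qed
  have "D \<subseteq> (\<lambda>(w, j). (\<phi> ^^ j) w) ` (?V \<times> {..<k})"
  proof
    fix d assume d: "d \<in> D"
    obtain j where j: "(\<phi> ^^ j) d \<in> ?V"
      using face_has_moved_edge[OF assms d] phi_funpow_in[OF d] by blast
    define i where "i = (k - j mod k) mod k"
    have "(\<phi> ^^ i) ((\<phi> ^^ j) d) = (\<phi> ^^ ((i + j) mod k)) d"
      using mod_k[OF d] by (simp add: funpow_add)
    also have "(i + j) mod k = 0"
    proof -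
      have "(i + j) mod k = ((k - j mod k) + j mod k) mod k" unfolding i_def by (simp add: mod_simps)
      also have "(k - j mod k) + j mod k = k" using k_ge by (simp add: less_imp_le)
      finally show ?thesis by simp
    qed
    finally have "(\<phi> ^^ i) ((\<phi> ^^ j) d) = d" by simp
    moreover have "i < k" using k_ge by (simp add: i_def)
    ultimately show "d \<in> (\<lambda>(w, j). (\<phi> ^^ j) w) ` (?V \<times> {..<k})"
      using j by (intro image_eqI[of _ _ "((\<phi> ^^ j) d, i)"]) auto
  qed
  then have "card D \<le> card (?V \<times> {..<k})"
    using finite_D by (intro surj_card_le) auto
  then have "2 * n * k \<le> card ?V * k" by (simp add: card_cartesian_product card_D)
  then show ?thesis using k_ge n_ge by simp
qed

text \<open>Encodes an automorphism \<open>\<sigma>\<close> fixing \<open>0\<close>: the differences seen at a vertex \<open>x\<close> are permuted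
  by \<open>\<Psi> x\<close>, and \<open>\<epsilon>\<close> is the orientation behaviour.\<close>

definition realises :: "('d \<Rightarrow> int) \<Rightarrow> bool \<Rightarrow> ('d \<Rightarrow> 'd) \<Rightarrow> bool" where
  "realises s \<epsilon> \<psi> \<longleftrightarrow> (\<exists>\<sigma> \<Psi>. (\<forall>x \<in> Zmod v. \<Psi> x \<in> commutant \<epsilon>) \<and> \<sigma> 0 = 0 \<and> \<Psi> 0 = \<psi> \<and>
     (\<forall>x \<in> Zmod v. \<forall>d \<in> D. \<sigma> ((x + s d) mod int v) = (\<sigma> x + s (\<Psi> x d)) mod int v \<and>
        \<Psi> ((x + s d) mod int v) (\<nu> d) = \<nu> (\<Psi> x d)))"

lemma zero_Zmod: "0 \<in> Zmod v"
  using v_pos by (simp add: Zmod_def)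

text \<open>\<open>h p\<close> is the dart permutation at the neighbour of 0 reached along p. The
  arc leading back to 0 prescribes one of its values, which by \<open>commutant_unique\<close>
  determines it. Hence \<open>h\<close> depends on \<open>\<psi>\<close> and
  \<open>\<epsilon>\<close> only, and one choice of \<open>h\<close> serves all labellings at
  once.\<close>

lemma realises_transition:
  assumes "s \<in> labellings" "realises s \<epsilon> \<psi>"
  shows "\<exists>h. \<forall>p \<in> D. h p \<in> commutant \<epsilon> \<and> h p (\<nu> p) = \<nu> (\<psi> p)"
proof -
  obtain \<sigma> \<Psi> where "\<And>x. x \<in> Zmod v \<Longrightarrow> \<Psi> x \<in> commutant \<epsilon>" "\<Psi> 0 = \<psi>"
    "\<And>x d. x \<in> Zmod v \<Longrightarrow> d \<in> D \<Longrightarrow> \<Psi> ((x + s d) mod int v) (\<nu> d) = \<nu> (\<Psi> x d)"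
    using assms(2) unfolding realises_def by blast
  then have "\<Psi> (s p) \<in> commutant \<epsilon> \<and> \<Psi> (s p) (\<nu> p) = \<nu> (\<psi> p)" if "p \<in> D" for p
    using that labellings_Zmod[OF assms(1) that] zero_Zmod by (metis Zmod_mod add_0)
  then show ?thesis by (intro exI[of _ "\<lambda>p. \<Psi> (s p)"]) blast
qed

text \<open>The same vertex is reached from 0 along p and then q, or along q and then p; its image
  is computed in both ways.\<close>

lemma realises_equation:
  assumes s: "s \<in> labellings" "realises s \<epsilon> \<psi>"
    and h: "\<And>p. p \<in> D \<Longrightarrow> h p \<in> commutant \<epsilon> \<and> h p (\<nu> p) = \<nu> (\<psi> p)"
    and p: "p \<in> D" and q: "q \<in> D"
  shows "[s (\<psi> p) + s (h p q) = s (\<psi> q) + s (h q p)] (mod int v)"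
proof -
  obtain \<sigma> \<Psi> where \<Psi>: "\<And>x. x \<in> Zmod v \<Longrightarrow> \<Psi> x \<in> commutant \<epsilon>" "\<sigma> 0 = 0" "\<Psi> 0 = \<psi>"
    "\<And>x d. x \<in> Zmod v \<Longrightarrow> d \<in> D \<Longrightarrow> \<sigma> ((x + s d) mod int v) = (\<sigma> x + s (\<Psi> x d)) mod int v"
    "\<And>x d. x \<in> Zmod v \<Longrightarrow> d \<in> D \<Longrightarrow> \<Psi> ((x + s d) mod int v) (\<nu> d) = \<nu> (\<Psi> x d)"
    using s(2) unfolding realises_def by blast
  have first: "\<sigma> (s a) = s (\<psi> a) mod int v" "\<Psi> (s a) = h a" if a: "a \<in> D" for a
  proof -
    have sa: "s a \<in> Zmod v" using labellings_Zmod[OF s(1) a] .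
    show "\<sigma> (s a) = s (\<psi> a) mod int v" using \<Psi>(4)[OF zero_Zmod a] \<Psi>(2,3) sa by simp
    have "\<Psi> (s a) (\<nu> a) = h a (\<nu> a)" using \<Psi>(5)[OF zero_Zmod a] \<Psi>(3) sa h[OF a] by simp
    then show "\<Psi> (s a) = h a" using commutant_unique[OF \<Psi>(1)[OF sa]] h[OF a] nu_in[OF a] by blast
  qed
  have "\<sigma> ((s a + s b) mod int v) = (s (\<psi> a) + s (h a b)) mod int v" if "a \<in> D" "b \<in> D" for a b
    using \<Psi>(4)[OF labellings_Zmod[OF s(1) that(1)] that(2)] first[OF that(1)] by (simp add: mod_simps)
  from this[OF p q] this[OF q p] show ?thesis by (simp add: cong_def add.commute)
qed

text \<open>If \<open>\<psi>\<close> commutes with \<open>\<nu>\<close>, the transition rule hands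
  \<open>\<psi>\<close> on unchanged to every neighbour, and \<open>S_sum\<close> spreads it to all
  vertices. So \<open>\<sigma>\<close> is additive on Z_v, that is, multiplication by its value at
  1.\<close>

lemma realises_linear:
  assumes s: "s \<in> labellings" "realises s \<epsilon> \<psi>"
    and \<psi>: "\<And>p. p \<in> D \<Longrightarrow> \<psi> (\<nu> p) = \<nu> (\<psi> p)"
  shows "\<exists>u \<in> Zmod v. \<forall>d \<in> D. s (\<psi> d) = (u * s d) mod int v"
proof -
  obtain \<sigma> \<Psi> where \<Psi>: "\<And>x. x \<in> Zmod v \<Longrightarrow> \<Psi> x \<in> commutant \<epsilon>" "\<sigma> 0 = 0" "\<Psi> 0 = \<psi>"
    "\<And>x d. x \<in> Zmod v \<Longrightarrow> d \<in> D \<Longrightarrow> \<sigma> ((x + s d) mod int v) = (\<sigma> x + s (\<Psi> x d)) mod int v"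
    "\<And>x d. x \<in> Zmod v \<Longrightarrow> d \<in> D \<Longrightarrow> \<Psi> ((x + s d) mod int v) (\<nu> d) = \<nu> (\<Psi> x d)"
    using s(2) unfolding realises_def by blast
  have \<psi>c: "\<psi> \<in> commutant \<epsilon>" using \<Psi>(1)[OF zero_Zmod] \<Psi>(3) by simp
  have step: "\<Psi> ((x + s d) mod int v) = \<psi>" if "x \<in> Zmod v" "\<Psi> x = \<psi>" "d \<in> D" for x d
    using \<Psi>(5)[OF that(1,3)] that \<psi>[OF that(3)] v_pos
      commutant_unique[OF \<Psi>(1) \<psi>c nu_in[OF that(3)]] by simp
  have sstep: "\<Psi> a = \<psi>" if a: "a \<in> S" for a
  proof -
    obtain d where "d \<in> D" "a = s d" using a labellings_image[OF s(1)] by blast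
    then show ?thesis using step[OF zero_Zmod \<Psi>(3)] a S_Zmod by (metis Zmod_mod add_0 subsetD)
  qed
  have const: "\<Psi> x = \<psi>" if "x \<in> Zmod v" for x
    using S_sum[OF that]
  proof
    assume "\<exists>a \<in> S. \<exists>b \<in> S. x = (a + b) mod int v"
    then obtain a d where "a \<in> S" "d \<in> D" "x = (a + s d) mod int v"
      using labellings_image[OF s(1)] by blast
    then show ?thesis using step[OF _ sstep] S_Zmod by blast
  qed (rule sstep)
  have add1: "\<sigma> ((x + s d) mod int v) = (\<sigma> x + s (\<psi> d)) mod int v" if "x \<in> Zmod v" "d \<in> D" for x d
    using \<Psi>(4)[OF that] const[OF that(1)] by simp
  have sig_s: "\<sigma> (s d) = s (\<psi> d)" if "d \<in> D" for d
    using add1[OF zero_Zmod that] \<Psi>(2) labellings_Zmod[OF s(1)] that commutant_in[OF \<psi>c] by simp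
  have add: "\<sigma> ((x + y) mod int v) = (\<sigma> x + \<sigma> y) mod int v" if x: "x \<in> Zmod v" and y: "y \<in> Zmod v" for x y
    using S_sum[OF y]
  proof
    assume "y \<in> S"
    then obtain d where "d \<in> D" "y = s d" using labellings_image[OF s(1)] by blast
    then show ?thesis using add1[OF x] sig_s by simp
  next
    assume "\<exists>a \<in> S. \<exists>b \<in> S. y = (a + b) mod int v"
    then obtain d e where de: "d \<in> D" "e \<in> D" "y = (s d + s e) mod int v"
      using labellings_image[OF s(1)] by blast
    have "\<sigma> ((x + y) mod int v) = \<sigma> (((x + s d) mod int v + s e) mod int v)"
      by (simp add: de(3) mod_simps add.assoc)
    also have "\<dots> = (\<sigma> x + s (\<psi> d) + s (\<psi> e)) mod int v"
      unfolding add1[OF mod_in_Zmod[OF v_pos] de(2)] add1[OF x de(1)] by (rule mod_add_left_eq)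
    also have "\<dots> = (\<sigma> x + \<sigma> y) mod int v"
      using add1[OF labellings_Zmod[OF s(1) de(1)] de(2)] de sig_s by (simp add: mod_simps add.assoc)
    finally show ?thesis .
  qed
  define u where "u = \<sigma> (1 mod int v)"
  have lin: "\<sigma> (int m mod int v) mod int v = (u * int m) mod int v" for m
  proof (induction m)
    case 0
    then show ?case using \<Psi>(2) by simp
  next
    case (Suc m)
    have "\<sigma> (int (Suc m) mod int v) = \<sigma> ((int m mod int v + 1 mod int v) mod int v)"
      by (simp add: mod_simps add.commute)
    also have "\<dots> = (\<sigma> (int m mod int v) mod int v + u) mod int v"
      using add[of "int m mod int v" "1 mod int v"] v_pos by (simp add: u_def mod_simps)
    finally show ?case using Suc by (simp add: mod_simps algebra_simps)
  qed
  have "s (\<psi> d) = (u mod int v * s d) mod int v" if d: "d \<in> D" for d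
  proof -
    have sd: "s d \<in> Zmod v" "s (\<psi> d) \<in> Zmod v"
      using labellings_Zmod[OF s(1)] d commutant_in[OF \<psi>c] by auto
    then have "int (nat (s d)) = s d" by (simp add: Zmod_def)
    then show ?thesis using lin[of "nat (s d)"] sd sig_s[OF d] by (simp add: mod_simps)
  qed
  then show ?thesis using v_pos by (intro bexI[of _ "u mod int v"]) auto
qed

end

section \<open>Counting exceptional labellings\<close>

context face_darts
begin

text \<open>The assumption on \<open>h\<close> makes the equation of
  \<open>realises_equation\<close> a genuine condition on the label of \<open>\<psi> p\<close>:
  equality of \<open>\<psi> p\<close> with \<open>h q p\<close> would force \<open>h q\<close> to be
  \<open>\<psi>\<close>, and the other two coincidences would force q to be \<open>\<nu> p\<close>
  or p. Two such equations are imposed, the second for a dart p whose image avoids the darts of the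
  first.\<close>

lemma card_realises_nonlinear:
  assumes \<psi>: "\<psi> \<in> commutant \<epsilon>"
    and h: "\<And>p. p \<in> D \<Longrightarrow> h p \<in> commutant \<epsilon> \<and> h p (\<nu> p) = \<nu> (\<psi> p)"
    and hn: "\<And>p. p \<in> D \<Longrightarrow> h p \<noteq> \<psi>"
  shows "card {s \<in> labellings. realises s \<epsilon> \<psi>} * (card D - 14)^2 \<le> 16 * card labellings"
proof -
  define E where "E p q = nu_closure {\<psi> p, h p q, \<psi> q, h q p}" for p q
  define eq where "eq p q s \<longleftrightarrow> [s (\<psi> p) + s (h p q) = s (\<psi> q) + s (h q p)] (mod int v)"
    for p q and s :: "'d \<Rightarrow> int"
  have inD: "{\<psi> p, h p q, \<psi> q, h q p} \<subseteq> D" if "p \<in> D" "q \<in> D" for p q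
    using that h commutant_in \<psi> by blast
  have cE: "card (E p q) \<le> 8" for p q
  proof -
    have "card {\<psi> p, h p q, \<psi> q, h q p} \<le> 4"
      using card_length[of "[\<psi> p, h p q, \<psi> q, h q p]"] by simp
    then show ?thesis
      using card_nu_closure_le[of "{\<psi> p, h p q, \<psi> q, h q p}"] by (simp add: E_def)
  qed
  have ED: "E p q \<subseteq> D" "\<nu> ` E p q \<subseteq> E p q" "{\<psi> p, h p q, \<psi> q, h q p} \<subseteq> E p q"
    if "p \<in> D" "q \<in> D" for p q
    using nu_closure[OF inD[OF that]] by (simp_all add: E_def)
  have neq: "\<psi> p \<noteq> \<nu> (h p q)" "\<psi> p \<noteq> \<psi> q" "\<psi> p \<noteq> h q p"
    if "p \<in> D" "q \<in> D" "q \<noteq> p" "q \<noteq> \<nu> p" for p q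
  proof -
    show "\<psi> p \<noteq> \<nu> (h p q)"
      using h[OF that(1)] commutant_eqD[of "h p" \<epsilon> "\<nu> p" q] that nu_in nu_nu commutant_in
      by metis
    show "\<psi> p \<noteq> \<psi> q" using commutant_eqD[OF \<psi>] that by metis
    show "\<psi> p \<noteq> h q p" using commutant_unique[OF \<psi>, of "h q" p] h hn that by metis
  qed
  have step: "card {s \<in> labellings. P s \<and> eq p q s} * (card D - 14) \<le> 4 * card {s \<in> labellings. P s}"
    if pq: "p \<in> D" "q \<in> D" "q \<noteq> p" "q \<noteq> \<nu> p"
      and A: "A \<subseteq> D" "\<nu> ` A \<subseteq> A" "card A \<le> 8" "\<psi> p \<notin> A"
      and P: "\<And>s s'. s \<in> labellings \<Longrightarrow> s' \<in> labellings \<Longrightarrow> (\<And>d. d \<in> A \<Longrightarrow> s d = s' d) \<Longrightarrow> P s \<Longrightarrow> P s'"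
    for A P p q
  proof -
    define a where "a = \<psi> p"
    \<comment> \<open>At most 8 darts belong to the earlier equation and at most 8 - 2 further ones
      to the present equation once a and \<open>\<nu> a\<close> are removed; this is the origin of
      14.\<close>
    define K where "K = A \<union> (E p q - {a, \<nu> a})"
    have aD: "a \<in> D" using commutant_in[OF \<psi>] pq by (simp add: a_def)
    have aE: "a \<in> E p q" "\<nu> a \<in> E p q" using ED[OF pq(1,2)] by (auto simp: a_def)
    have K: "K \<subseteq> D" "\<nu> ` K \<subseteq> K" "a \<notin> K"
    proof -
      show "K \<subseteq> D" using A ED[OF pq(1,2)] by (auto simp: K_def)
      show "a \<notin> K" using A by (simp add: K_def a_def)
      have "\<nu> x \<in> E p q - {a, \<nu> a}" if "x \<in> E p q - {a, \<nu> a}" for x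
        using that ED[OF pq(1,2)] nu_nu aD by (smt (verit) Diff_iff image_subset_iff insert_iff singletonD subsetD)
      then show "\<nu> ` K \<subseteq> K" using A by (auto simp: K_def)
    qed
    have "card (E p q - {a, \<nu> a}) = card (E p q) - 2"
      using aE nu_neq[OF aD] by (subst card_Diff_subset) auto
    then have "card K \<le> 14"
      using cE[of p q] A(3) card_Un_le[of A "E p q - {a, \<nu> a}"] by (simp add: K_def)
    moreover have "card {s \<in> labellings. P s \<and> [s a + s (h p q) = s (\<psi> q) + s (h q p)] (mod int v)}
        * (card D - card K) \<le> 4 * card {s \<in> labellings. P s}"
    proof (rule card_equation_le[OF K(1,2) aD K(3)])
      show "h p q \<in> D" "\<psi> q \<in> D" "h q p \<in> D" using inD[OF pq(1,2)] by auto
      show "a \<noteq> \<nu> (h p q)" "a \<noteq> \<psi> q" "a \<noteq> h q p" using neq[OF pq] by (simp_all add: a_def)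
      show "{h p q, \<psi> q, h q p} \<subseteq> K \<union> {a, \<nu> a}" using ED(3)[OF pq(1,2)] by (auto simp: K_def)
      show "P s'" if "s \<in> labellings" "s' \<in> labellings" "\<And>d. d \<in> K \<Longrightarrow> s d = s' d" "P s" for s s'
        using P[OF that(1,2) _ that(4)] that(3) by (simp add: K_def)
    qed
    ultimately show ?thesis unfolding eq_def a_def[symmetric]
      by (elim order.trans[rotated]) (intro mult_le_mono2 diff_le_mono2)
  qed
  have ex: "\<exists>q \<in> D. q \<noteq> p \<and> q \<noteq> \<nu> p" for p
  proof (rule ccontr)
    assume "\<not> ?thesis"
    then have "D \<subseteq> {p, \<nu> p}" by auto
    then have "card D \<le> card {p, \<nu> p}" by (intro card_mono) auto
    moreover have "card {p, \<nu> p} \<le> 2" by (simp add: card_insert_if)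
    ultimately show False using card_D_ge by linarith
  qed
  obtain p1 where p1: "p1 \<in> D" using D_nonempty by blast
  obtain q1 where q1: "q1 \<in> D" "q1 \<noteq> p1" "q1 \<noteq> \<nu> p1" using ex by blast
  have "\<exists>p \<in> D. \<psi> p \<notin> E p1 q1"
  proof (rule ccontr)
    assume "\<not> ?thesis"
    then have "\<psi> ` D \<subseteq> E p1 q1" by auto
    then have "card (\<psi> ` D) \<le> 8"
      using cE[of p1 q1] card_mono finite_subset[OF ED(1)[OF p1 q1(1)] finite_D] le_trans by blast
    moreover have "card (\<psi> ` D) = card D" using \<psi> by (auto simp: commutant_def bij_betw_def card_image)
    ultimately show False using card_D_ge by simp
  qed
  then obtain p2 where p2: "p2 \<in> D" "\<psi> p2 \<notin> E p1 q1" by blast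
  obtain q2 where q2: "q2 \<in> D" "q2 \<noteq> p2" "q2 \<noteq> \<nu> p2" using ex by blast
  let ?X0 = "card labellings"
  let ?X1 = "card {s \<in> labellings. eq p1 q1 s}"
  let ?X2 = "card {s \<in> labellings. eq p1 q1 s \<and> eq p2 q2 s}"
  have 1: "?X1 * (card D - 14) \<le> 4 * ?X0"
    using step[OF p1 q1, of "{}" "\<lambda>_. True"] by simp
  have 2: "?X2 * (card D - 14) \<le> 4 * ?X1"
  proof (rule step[OF p2(1) q2 ED(1,2)[OF p1 q1(1)] cE p2(2)])
    fix s s' assume "eq p1 q1 s" and *: "\<And>d. d \<in> E p1 q1 \<Longrightarrow> s d = s' d"
    then show "eq p1 q1 s'" using ED(3)[OF p1 q1(1)] by (simp add: eq_def)
  qed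
  have "{s \<in> labellings. realises s \<epsilon> \<psi>} \<subseteq> {s \<in> labellings. eq p1 q1 s \<and> eq p2 q2 s}"
    using realises_equation[OF _ _ h] p1 q1 p2 q2 by (auto simp: eq_def)
  then have "card {s \<in> labellings. realises s \<epsilon> \<psi>} * (card D - 14)^2 \<le> ?X2 * (card D - 14)^2"
    using finite_labellings by (intro mult_le_mono1 card_mono) auto
  also have "\<dots> = (?X2 * (card D - 14)) * (card D - 14)" by (simp add: power2_eq_square)
  also have "\<dots> \<le> (4 * ?X1) * (card D - 14)" using 2 by (rule mult_le_mono1)
  also have "\<dots> \<le> 16 * ?X0" using 1 by linarith
  finally show ?thesis .
qed

text \<open>For a fixed multiplier u, the label of a moved dart d dictates that of
  \<open>\<psi> d\<close>, which lies on a different edge. Three moved darts are chosen so that each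
  image avoids the at most 8 darts used before; together with d and \<open>\<nu> d\<close> this
  gives 10 frozen darts. The union over u costs the factor v.\<close>

lemma card_realises_linear:
  assumes \<psi>: "\<psi> \<in> commutant \<epsilon>"
    and comm: "\<And>p. p \<in> D \<Longrightarrow> \<psi> (\<nu> p) = \<nu> (\<psi> p)"
    and nontriv: "\<not> (\<epsilon> \<and> \<psi> = restrict id D)"
  shows "card {s \<in> labellings. realises s \<epsilon> \<psi>} * (card D - 10)^3 \<le> v * card labellings"
proof -
  define V where "V = {d \<in> D. \<psi> d \<noteq> d \<and> \<psi> d \<noteq> \<nu> d}"
  define E where "E d = nu_closure {d, \<psi> d}" for d
  define eq where "eq u d s \<longleftrightarrow> s (\<psi> d) = (u * s d) mod int v" for u d and s :: "'d \<Rightarrow> int"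
  have ED: "E d \<subseteq> D" "\<nu> ` E d \<subseteq> E d" "{d, \<psi> d} \<subseteq> E d" "card (E d) \<le> 4" if "d \<in> D" for d
  proof -
    have *: "{d, \<psi> d} \<subseteq> D" using that commutant_in[OF \<psi>] by blast
    show "E d \<subseteq> D" "\<nu> ` E d \<subseteq> E d" "{d, \<psi> d} \<subseteq> E d"
      using nu_closure[OF *] by (simp_all add: E_def)
    show "card (E d) \<le> 4"
      using card_nu_closure_le[of "{d, \<psi> d}"] card_length[of "[d, \<psi> d]"] by (simp add: E_def)
  qed
  have step: "card {s \<in> labellings. P s \<and> eq u d s} * (card D - 10) \<le> card {s \<in> labellings. P s}"
    if d: "d \<in> V" and A: "A \<subseteq> D" "\<nu> ` A \<subseteq> A" "card A \<le> 8" "\<psi> d \<notin> A"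
      and P: "\<And>s s'. s \<in> labellings \<Longrightarrow> s' \<in> labellings \<Longrightarrow> (\<And>d. d \<in> A \<Longrightarrow> s d = s' d) \<Longrightarrow> P s \<Longrightarrow> P s'"
    for A P u d
  proof -
    define K where "K = A \<union> {d, \<nu> d}"
    have dD: "d \<in> D" and ne: "\<psi> d \<noteq> d" "\<psi> d \<noteq> \<nu> d" using d by (auto simp: V_def)
    have K: "K \<subseteq> D" "\<nu> ` K \<subseteq> K" "\<psi> d \<notin> K"
      using A dD ne nu_in nu_nu by (auto simp: K_def)
    have "card K \<le> 10"
      using A(3) card_Un_le[of A "{d, \<nu> d}"] nu_neq[OF dD] by (simp add: K_def)
    moreover have "card {s \<in> labellings. P s \<and> s (\<psi> d) \<in> {(u * s d) mod int v}} * (card D - card K)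
        \<le> 1 * card {s \<in> labellings. P s}"
    proof (rule card_label_in_le[OF K(1,2) commutant_in[OF \<psi> dD] K(3)])
      show "P s'" if "s \<in> labellings" "s' \<in> labellings" "\<And>d. d \<in> K \<Longrightarrow> s d = s' d" "P s" for s s'
        using P[OF that(1,2) _ that(4)] that(3) by (simp add: K_def)
    qed (auto simp: K_def)
    ultimately show ?thesis unfolding eq_def singleton_iff mult_1
      by (elim order.trans[rotated]) (intro mult_le_mono2 diff_le_mono2)
  qed
  have ex: "\<exists>d \<in> V. \<psi> d \<notin> A" if "card A \<le> 8" "finite A" for A
  proof (rule ccontr)
    assume "\<not> ?thesis"
    then have "\<psi> ` V \<subseteq> A" by auto
    then have "card (\<psi> ` V) \<le> 8" using that card_mono le_trans by blast
    moreover have "card (\<psi> ` V) = card V"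
      using commutant_eqD[OF \<psi>] by (intro card_image inj_onI) (auto simp: V_def)
    ultimately show False using card_moved_edges[OF \<psi> comm nontriv] by (simp add: V_def)
  qed
  obtain d1 where d1: "d1 \<in> V" using ex[of "{}"] by auto
  then have d1D: "d1 \<in> D" by (simp add: V_def)
  have fin: "finite (E d)" if "d \<in> D" for d using ED(1)[OF that] finite_D finite_subset by blast
  obtain d2 where d2: "d2 \<in> V" "\<psi> d2 \<notin> E d1" using ex[of "E d1"] ED(4)[OF d1D] fin[OF d1D] by auto
  then have d2D: "d2 \<in> D" by (simp add: V_def)
  have c12: "card (E d1 \<union> E d2) \<le> 8"
    using card_Un_le[of "E d1" "E d2"] ED(4)[OF d1D] ED(4)[OF d2D] by linarith
  obtain d3 where d3: "d3 \<in> V" "\<psi> d3 \<notin> E d1 \<union> E d2"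
    using ex[OF c12] fin[OF d1D] fin[OF d2D] by auto
  let ?M = "card D - 10"
  have each: "card {s \<in> labellings. eq u d1 s \<and> eq u d2 s \<and> eq u d3 s} * ?M ^ 3 \<le> card labellings" for u
  proof -
    have 1: "card {s \<in> labellings. eq u d1 s} * ?M \<le> card labellings"
      using step[OF d1, of "{}" "\<lambda>_. True"] by simp
    have 2: "card {s \<in> labellings. eq u d1 s \<and> eq u d2 s} * ?M \<le> card {s \<in> labellings. eq u d1 s}"
    proof (rule step[OF d2(1) ED(1,2)[OF d1D] _ d2(2)])
      show "card (E d1) \<le> 8" using ED(4)[OF d1D] by simp
      show "eq u d1 s'" if "\<And>d. d \<in> E d1 \<Longrightarrow> s d = s' d" "eq u d1 s" for s s' :: "'d \<Rightarrow> int"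
        using that ED(3)[OF d1D] by (simp add: eq_def)
    qed
    have 3: "card {s \<in> labellings. (eq u d1 s \<and> eq u d2 s) \<and> eq u d3 s} * ?M
        \<le> card {s \<in> labellings. eq u d1 s \<and> eq u d2 s}"
    proof (rule step[OF d3(1) _ _ c12 d3(2)])
      show "E d1 \<union> E d2 \<subseteq> D" "\<nu> ` (E d1 \<union> E d2) \<subseteq> E d1 \<union> E d2"
        using ED(1,2)[OF d1D] ED(1,2)[OF d2D] by auto
      show "eq u d1 s' \<and> eq u d2 s'" if "\<And>d. d \<in> E d1 \<union> E d2 \<Longrightarrow> s d = s' d" "eq u d1 s \<and> eq u d2 s"
        for s s' :: "'d \<Rightarrow> int"
        using that ED(3)[OF d1D] ED(3)[OF d2D] by (simp add: eq_def)
    qed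
    have "card {s \<in> labellings. eq u d1 s \<and> eq u d2 s \<and> eq u d3 s} * ?M ^ 3
        = (card {s \<in> labellings. (eq u d1 s \<and> eq u d2 s) \<and> eq u d3 s} * ?M) * ?M ^ 2"
      by (simp add: power3_eq_cube power2_eq_square conj_assoc)
    also have "\<dots> \<le> card {s \<in> labellings. eq u d1 s \<and> eq u d2 s} * ?M ^ 2"
      using 3 by (rule mult_le_mono1)
    also have "\<dots> = (card {s \<in> labellings. eq u d1 s \<and> eq u d2 s} * ?M) * ?M"
      by (simp add: power2_eq_square)
    also have "\<dots> \<le> card {s \<in> labellings. eq u d1 s} * ?M" using 2 by (rule mult_le_mono1)
    finally show ?thesis using 1 by simp
  qed
  let ?U = "\<Union>u \<in> Zmod v. {s \<in> labellings. eq u d1 s \<and> eq u d2 s \<and> eq u d3 s}"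
  have d3D: "d3 \<in> D" using d3 by (simp add: V_def)
  have "{s \<in> labellings. realises s \<epsilon> \<psi>} \<subseteq> ?U"
  proof
    fix s assume "s \<in> {s \<in> labellings. realises s \<epsilon> \<psi>}"
    then have s: "s \<in> labellings" "realises s \<epsilon> \<psi>" by auto
    obtain u where "u \<in> Zmod v" "\<And>d. d \<in> D \<Longrightarrow> s (\<psi> d) = (u * s d) mod int v"
      using realises_linear[OF s comm] by blast
    then show "s \<in> ?U" using s d1D d2D d3D unfolding eq_def by blast
  qed
  then have "card {s \<in> labellings. realises s \<epsilon> \<psi>} \<le> card ?U"
    using finite_labellings by (intro card_mono) auto
  also have "\<dots> \<le> (\<Sum>u \<in> Zmod v. card {s \<in> labellings. eq u d1 s \<and> eq u d2 s \<and> eq u d3 s})"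
    by (rule card_UN_le) simp
  finally have "card {s \<in> labellings. realises s \<epsilon> \<psi>} * ?M ^ 3
      \<le> (\<Sum>u \<in> Zmod v. card {s \<in> labellings. eq u d1 s \<and> eq u d2 s \<and> eq u d3 s} * ?M ^ 3)"
    by (simp add: sum_distrib_right[symmetric])
  also have "\<dots> \<le> (\<Sum>u \<in> Zmod v. card labellings)" by (intro sum_mono each)
  finally show ?thesis by simp
qed

text \<open>One realising labelling \<open>s0\<close> is enough to settle which case
  \<open>\<psi>\<close> belongs to. If \<open>h p\<close> is \<open>\<psi>\<close> for some dart p,
  two terms of the equation for p and q cancel and injectivity of \<open>s0\<close> forces
  \<open>h q\<close> to be \<open>\<psi>\<close> as well. So either no \<open>h p\<close> is
  \<open>\<psi>\<close>, or all are, and in the latter case \<open>\<psi>\<close> commutes with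
  \<open>\<nu>\<close>.\<close>

lemma card_realises_le:
  assumes \<psi>: "\<psi> \<in> commutant \<epsilon>" and nontriv: "\<not> (\<epsilon> \<and> \<psi> = restrict id D)"
  shows "card {s \<in> labellings. realises s \<epsilon> \<psi>} * (card D - 14)^2 \<le> 16 * card labellings"
proof (cases "\<exists>s \<in> labellings. realises s \<epsilon> \<psi>")
  case False
  then have none: "{s \<in> labellings. realises s \<epsilon> \<psi>} = {}" by blast
  show ?thesis unfolding none by simp
next
  case True
  then obtain s0 where s0: "s0 \<in> labellings" "realises s0 \<epsilon> \<psi>" by blast
  then obtain h where h: "\<And>p. p \<in> D \<Longrightarrow> h p \<in> commutant \<epsilon> \<and> h p (\<nu> p) = \<nu> (\<psi> p)"
    using realises_transition by blast
  show ?thesis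
  proof (cases "\<exists>p \<in> D. h p = \<psi>")
    case False
    then show ?thesis using card_realises_nonlinear[OF \<psi> h] by blast
  next
    case True
    then obtain p where p: "p \<in> D" "h p = \<psi>" by blast
    have "h q = \<psi>" if q: "q \<in> D" for q
    proof -
      have "[s0 (\<psi> p) + s0 (\<psi> q) = s0 (\<psi> q) + s0 (h q p)] (mod int v)"
        using realises_equation[OF s0 h p(1) q] p(2) by simp
      then have "[s0 (\<psi> p) = s0 (h q p)] (mod int v)"
        by (metis add.commute cong_add_rcancel)
      then have "s0 (\<psi> p) = s0 (h q p)"
        using labellings_Zmod[OF s0(1)] h[OF q] commutant_in \<psi> p by (metis Zmod_cong_eq)
      then have "\<psi> p = h q p"
        using labellings_eqD[OF s0(1)] h[OF q] commutant_in \<psi> p by metis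
      then show ?thesis using commutant_unique[OF \<psi>] h[OF q] p by metis
    qed
    then have comm: "\<psi> (\<nu> p) = \<nu> (\<psi> p)" if "p \<in> D" for p using h[OF that] that by metis
    let ?x = "card {s \<in> labellings. realises s \<epsilon> \<psi>}"
    let ?M = "card D - 10"
    \<comment> \<open>The third power of the linear case is traded for a square: one factor
      \<open>?M\<close> absorbs v, because v \<le> 2 * \<open>card D\<close> \<le> 16 *
      \<open>?M\<close> when \<open>card D\<close> is at least 30.\<close>
    have "?x * (card D - 14)^2 * ?M \<le> ?x * ?M^2 * ?M"
      by (intro mult_le_mono1 mult_le_mono2 power_mono) auto
    also have "\<dots> = ?x * ?M^3" by (simp add: power3_eq_cube power2_eq_square)
    also have "\<dots> \<le> v * card labellings"
      by (rule card_realises_linear[OF \<psi> comm nontriv])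
    also have "\<dots> \<le> (16 * ?M) * card labellings"
      using v_le card_D_ge by (intro mult_le_mono1) linarith
    finally have "(?x * (card D - 14)^2) * ?M \<le> (16 * card labellings) * ?M"
      by (simp add: ac_simps)
    then show ?thesis using card_D_ge by simp
  qed
qed

text \<open>Only a necessary condition for symmetry: an automorphism that fixes 0 but moves some
  vertex makes the labelling flexible. It refers to the dart permutation at 0, so that the union
  bound runs over the two small sets \<open>commutant \<epsilon>\<close>.\<close>

definition flexible :: "('d \<Rightarrow> int) \<Rightarrow> bool" where
  "flexible s \<longleftrightarrow> (\<exists>\<epsilon> \<psi>. \<psi> \<in> commutant \<epsilon> \<and> \<not> (\<epsilon> \<and> \<psi> = restrict id D) \<and> realises s \<epsilon> \<psi>)"

lemma card_flexible_le:
  "card {s \<in> labellings. flexible s} * (card D - 14)^2 \<le> 32 * card D * card labellings"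
proof -
  define I where "I = {(\<epsilon>, \<psi>). \<psi> \<in> commutant \<epsilon> \<and> \<not> (\<epsilon> \<and> \<psi> = restrict id D)}"
  define B where "B i = {s \<in> labellings. realises s (fst i) (snd i)}" for i
  have I_sub: "I \<subseteq> (SIGMA \<epsilon> : UNIV. commutant \<epsilon>)" by (auto simp: I_def)
  have finSig: "finite (SIGMA \<epsilon> : (UNIV :: bool set). commutant \<epsilon>)" using finite_commutant by auto
  then have finI: "finite I" using I_sub finite_subset by blast
  have "card I \<le> card (SIGMA \<epsilon> : (UNIV :: bool set). commutant \<epsilon>)"
    using card_mono[OF finSig I_sub] .
  also have "\<dots> = card (commutant True) + card (commutant False)"
    using finite_commutant by (subst card_SigmaI) (auto simp: UNIV_bool)
  also have "\<dots> \<le> 2 * card D" using card_commutant_le[of True] card_commutant_le[of False] by simp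
  finally have cI: "card I \<le> 2 * card D" .
  have "{s \<in> labellings. flexible s} = (\<Union>i \<in> I. B i)"
    by (force simp: flexible_def I_def B_def)
  then have "card {s \<in> labellings. flexible s} \<le> (\<Sum>i \<in> I. card (B i))"
    using card_UN_le[OF finI] by metis
  then have "card {s \<in> labellings. flexible s} * (card D - 14)^2 \<le> (\<Sum>i \<in> I. card (B i)) * (card D - 14)^2"
    by (rule mult_le_mono1)
  also have "\<dots> = (\<Sum>i \<in> I. card (B i) * (card D - 14)^2)" by (simp add: sum_distrib_right)
  also have "\<dots> \<le> (\<Sum>i \<in> I. 16 * card labellings)"
    using card_realises_le by (intro sum_mono) (auto simp: I_def B_def)
  also have "\<dots> \<le> 2 * card D * (16 * card labellings)"
    using cI by (simp add: mult_le_mono1)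
  finally show ?thesis by simp
qed

section \<open>Labellings with a vanishing face sum\<close>

definition face_sum :: "('d \<Rightarrow> int) \<Rightarrow> 'd \<Rightarrow> int" where
  "face_sum s d = (\<Sum>j<k. s ((\<phi> ^^ j) d))"

lemma face_sum_phi:
  assumes "d \<in> D"
  shows "face_sum s (\<phi> d) = face_sum s d"
proof -
  have "face_sum s (\<phi> d) = (\<Sum>j<k. s ((\<phi> ^^ Suc j) d))"
    by (simp add: face_sum_def funpow_swap1)
  also have "\<dots> = (\<Sum>j<Suc k. s ((\<phi> ^^ j) d)) - s d"
    by (subst sum.lessThan_Suc_shift) simp
  also have "\<dots> = face_sum s d"
    using phi_period[OF assms] by (simp add: face_sum_def)
  finally show ?thesis .
qed

lemma face_sum_funpow: "d \<in> D \<Longrightarrow> face_sum s ((\<phi> ^^ j) d) = face_sum s d"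
proof (induction j)
  case (Suc j)
  then show ?case using face_sum_phi[OF phi_funpow_in[OF Suc.prems]] by simp
qed simp

lemma phi_funpow_inj: 
  assumes "d \<in> D"
  shows "inj_on (\<lambda>j. (\<phi> ^^ j) d) {..<k}"
proof -
  have "(\<phi> ^^ i) d \<noteq> (\<phi> ^^ j) d" if "i < j" "j < k" for i j
  proof
    assume eq: "(\<phi> ^^ i) d = (\<phi> ^^ j) d"
    have "(\<phi> ^^ (k - j + i)) d = (\<phi> ^^ (k - j)) ((\<phi> ^^ j) d)"
      unfolding funpow_add using eq by simp
    also have "\<dots> = (\<phi> ^^ (k - j + j)) d" unfolding funpow_add by simp
    finally have "(\<phi> ^^ (k - j + i)) d = d" using that(2) phi_period[OF assms] by simp
    then show False using phi_minimal[OF assms, of "k - j + i"] that(1,2) by linarith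
  qed
  then show ?thesis by (intro linorder_inj_onI) auto
qed

text \<open>The label of d is determined by the labels of the other k - 1 darts of its cycle. It is
  independent of them: d occurs only once in the cycle, and \<open>\<nu> d\<close> does not occur
  because it has the other colour.\<close>

lemma card_face_sum_zero_at_le:
  assumes d: "d \<in> D"
  shows "card {s \<in> labellings. [face_sum s d = 0] (mod int v)} * (card D - 2 * (k - 1)) \<le> card labellings"
proof -
  define F where "F = (\<lambda>j. (\<phi> ^^ j) d) ` {1..<k}"
  define K where "K = nu_closure F"
  define B where "B s = {z \<in> Zmod v. [1 * z + (\<Sum>j = 1..<k. s ((\<phi> ^^ j) d)) = 0] (mod int v)}" for s
  have FD: "F \<subseteq> D" using phi_funpow_in[OF d] by (auto simp: F_def)
  have dK: "d \<notin> K"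
  proof
    assume "d \<in> K"
    then consider "d \<in> F" | x where "x \<in> F" "d = \<nu> x" by (auto simp: K_def nu_closure_def)
    then show False
    proof cases
      case 1
      then obtain j where "j \<in> {1..<k}" "d = (\<phi> ^^ j) d" unfolding F_def by (rule imageE)
      then show ?thesis using phi_minimal[OF d, of j] by simp
    next
      case 2
      then have "\<kappa> d \<noteq> \<kappa> x" using FD nu_colour by blast
      moreover obtain j where "x = (\<phi> ^^ j) d" using 2(1) unfolding F_def by (rule imageE)
      ultimately show ?thesis using phi_funpow_colour[OF d] by simp
    qed
  qed
  have "card F \<le> k - 1" using card_image_le[of "{1..<k}"] by (simp add: F_def)
  then have cK: "card K \<le> 2 * (k - 1)"
    using card_nu_closure_le[of F] by (simp add: K_def F_def)
  have split: "face_sum s d = s d + (\<Sum>j = 1..<k. s ((\<phi> ^^ j) d))" for s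
  proof -
    have "{..<k} = insert 0 {1..<k}" using k_ge by auto
    then show ?thesis by (simp add: face_sum_def)
  qed
  have eqB: "{s \<in> labellings. [face_sum s d = 0] (mod int v)} = {s \<in> labellings. True \<and> s d \<in> B s}"
    using labellings_Zmod[OF _ d] by (auto simp: B_def split)
  have "card {s \<in> labellings. True \<and> s d \<in> B s} * (card D - card K) \<le> 1 * card {s \<in> labellings. True}"
  proof (rule card_label_in_le[OF nu_closure(2,3)[OF FD, folded K_def] d dK])
    fix s s' :: "'d \<Rightarrow> int" assume agree: "\<And>d. d \<in> K \<Longrightarrow> s d = s' d"
    have "s ((\<phi> ^^ j) d) = s' ((\<phi> ^^ j) d)" if "j \<in> {1..<k}" for j
    proof -
      have "(\<phi> ^^ j) d \<in> F" unfolding F_def using that by (rule imageI)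
      then show ?thesis using agree nu_closure(1)[OF FD] unfolding K_def by blast
    qed
    then have "(\<Sum>j = 1..<k. s ((\<phi> ^^ j) d)) = (\<Sum>j = 1..<k. s' ((\<phi> ^^ j) d))"
      by (intro sum.cong) auto
    then show "B s = B s'" by (simp add: B_def)
  next
    fix s :: "'d \<Rightarrow> int"
    show "finite (B s)" "card (B s) \<le> 1"
      using card_linear_congruence_le[OF v_pos, of 1] unfolding B_def by simp_all
  qed simp
  then have "card {s \<in> labellings. [face_sum s d = 0] (mod int v)} * (card D - card K) \<le> card labellings"
    unfolding eqB by simp
  then show ?thesis
    by (elim order.trans[rotated]) (intro mult_le_mono2 diff_le_mono2 cK)
qed

definition zero_sum :: "('d \<Rightarrow> int) \<Rightarrow> bool" where
  "zero_sum s \<longleftrightarrow> (\<exists>d \<in> D. [face_sum s d = 0] (mod int v))"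

text \<open>Double counting of pairs of a labelling and a dart with vanishing face sum. One such
  dart brings its whole cycle of k darts along, which improves the union bound over 2nk darts to one
  over 2n faces.\<close>

lemma card_zero_sum_le:
  "card {s \<in> labellings. zero_sum s} * (2 * n * k - 2 * (k - 1)) \<le> 2 * n * card labellings"
proof -
  let ?Z = "{s \<in> labellings. zero_sum s}"
  let ?R = "SIGMA s : ?Z. {d \<in> D. [face_sum s d = 0] (mod int v)}"
  let ?T = "SIGMA d : D. {s \<in> labellings. [face_sum s d = 0] (mod int v)}"
  have many: "k \<le> card {d \<in> D. [face_sum s d = 0] (mod int v)}" if s: "s \<in> ?Z" for s
  proof -
    obtain d where d: "d \<in> D" "[face_sum s d = 0] (mod int v)" using s by (auto simp: zero_sum_def)
    have "(\<lambda>j. (\<phi> ^^ j) d) ` {..<k} \<subseteq> {d \<in> D. [face_sum s d = 0] (mod int v)}"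
      using d phi_funpow_in face_sum_funpow by auto
    then have "card ((\<lambda>j. (\<phi> ^^ j) d) ` {..<k}) \<le> card {d \<in> D. [face_sum s d = 0] (mod int v)}"
      using finite_D by (intro card_mono) auto
    then show ?thesis using card_image[OF phi_funpow_inj[OF d(1)]] by simp
  qed
  have "k * card ?Z \<le> (\<Sum>s \<in> ?Z. card {d \<in> D. [face_sum s d = 0] (mod int v)})"
    using sum_bounded_below[of ?Z k "\<lambda>s. card {d \<in> D. [face_sum s d = 0] (mod int v)}"] many
    by (simp add: mult.commute)
  also have "\<dots> = card ?R" using finite_labellings finite_D by (subst card_SigmaI) auto
  also have "\<dots> = card ?T"
    by (rule bij_betw_same_card[of prod.swap])
      (auto simp: bij_betw_def inj_on_def image_iff zero_sum_def)
  also have "\<dots> = (\<Sum>d \<in> D. card {s \<in> labellings. [face_sum s d = 0] (mod int v)})"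
    using finite_labellings finite_D by (subst card_SigmaI) auto
  finally have "k * card ?Z * (card D - 2 * (k - 1))
      \<le> (\<Sum>d \<in> D. card {s \<in> labellings. [face_sum s d = 0] (mod int v)} * (card D - 2 * (k - 1)))"
    by (simp add: sum_distrib_right[symmetric])
  also have "\<dots> \<le> (\<Sum>d \<in> D. card labellings)" by (intro sum_mono card_face_sum_zero_at_le)
  finally have "k * (card ?Z * (card D - 2 * (k - 1))) \<le> k * (2 * n * card labellings)"
    by (simp add: card_D ac_simps)
  then show ?thesis using k_ge by (simp add: card_D)
qed

end

section \<open>Isomorphisms of embeddings\<close>

lemma embedding_arcs:
  assumes "embedding G r"
  shows "pair_wf_digraph G" "r permutes parcs G"
proof -
  have "pair_graph G" using assms by (simp add: embedding_def)
  then show "pair_wf_digraph G"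
    by (intro pair_fin_digraph.axioms(1) pair_digraph.axioms(1) pair_graph.axioms(1))
  show "r permutes parcs G" using assms by (simp add: embedding_def)
qed

lemma graph_isomorphism_arcs:
  assumes "graph_isomorphism \<sigma> G H" "pair_wf_digraph G" "a \<in> parcs G"
  shows "map_prod \<sigma> \<sigma> a \<in> parcs H"
proof -
  obtain x y where a: "a = (x, y)" by (cases a)
  then have "x \<in> pverts G" "y \<in> pverts G"
    using assms(3) pair_wf_digraph.in_arcsD1[OF assms(2)] pair_wf_digraph.in_arcsD2[OF assms(2)] by auto
  then have "(\<sigma> x, \<sigma> y) \<in> parcs H"
    using assms(1,3) unfolding a graph_isomorphism_def by blast
  then show ?thesis by (simp add: a)
qed

lemma permutes_inv_in:
  assumes "r permutes A" "a \<in> A"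
  shows "r a \<in> A" "inv r a \<in> A" "r (inv r a) = a" "inv r (r a) = a"
  using assms permutes_in_image permutes_inv permutes_inverses by metis+

lemma isomorphism_commutes_inv:
  assumes r: "r permutes A" and q: "q permutes B"
  shows "(\<forall>a \<in> A. f (r a) = q (f a)) \<Longrightarrow> (\<forall>a \<in> A. f (inv r a) = inv q (f a))"
    and "(\<forall>a \<in> A. f (r a) = inv q (f a)) \<Longrightarrow> (\<forall>a \<in> A. f (inv r a) = q (f a))"
proof -
  assume *: "\<forall>a \<in> A. f (r a) = q (f a)"
  show "\<forall>a \<in> A. f (inv r a) = inv q (f a)"
  proof
    fix a assume a: "a \<in> A"
    have "f a = q (f (inv r a))" using * permutes_inv_in(2,3)[OF r a] by metis
    then show "f (inv r a) = inv q (f a)" using permutes_inverses(2)[OF q] by simp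
  qed
next
  assume *: "\<forall>a \<in> A. f (r a) = inv q (f a)"
  show "\<forall>a \<in> A. f (inv r a) = q (f a)"
  proof
    fix a assume a: "a \<in> A"
    have "f a = inv q (f (inv r a))" using * permutes_inv_in(2,3)[OF r a] by metis
    then show "f (inv r a) = q (f a)" using permutes_inverses(1)[OF q] by simp
  qed
qed

lemma embedding_isomorphism_comp:
  assumes G: "embedding G r" and H: "embedding H q" and K: "embedding K p"
    and \<sigma>: "embedding_isomorphism \<sigma> G r H q" and \<tau>: "embedding_isomorphism \<tau> H q K p"
  shows "embedding_isomorphism (\<tau> \<circ> \<sigma>) G r K p"
proof -
  note wf = embedding_arcs[OF G] embedding_arcs[OF H] embedding_arcs[OF K]
  have gi: "graph_isomorphism \<sigma> G H" "graph_isomorphism \<tau> H K"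
    using \<sigma> \<tau> by (auto simp: embedding_isomorphism_def)
  have arcs: "a \<in> parcs G \<Longrightarrow> map_prod \<sigma> \<sigma> a \<in> parcs H" "b \<in> parcs H \<Longrightarrow> map_prod \<tau> \<tau> b \<in> parcs K" for a b
    using graph_isomorphism_arcs gi wf by blast+
  have "bij_betw (\<tau> \<circ> \<sigma>) (pverts G) (pverts K)"
    using gi by (auto simp: graph_isomorphism_def intro: bij_betw_trans)
  moreover have "\<sigma> x \<in> pverts H" if "x \<in> pverts G" for x
    using gi(1) that by (auto simp: graph_isomorphism_def bij_betw_def)
  ultimately have gc: "graph_isomorphism (\<tau> \<circ> \<sigma>) G K"
    using gi by (auto simp: graph_isomorphism_def)
  have mp: "map_prod (\<tau> \<circ> \<sigma>) (\<tau> \<circ> \<sigma>) a = map_prod \<tau> \<tau> (map_prod \<sigma> \<sigma> a)" for a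
    by (cases a) simp
  have 1: "(\<forall>a \<in> parcs G. map_prod \<sigma> \<sigma> (r a) = q (map_prod \<sigma> \<sigma> a)) \<or>
      (\<forall>a \<in> parcs G. map_prod \<sigma> \<sigma> (r a) = inv q (map_prod \<sigma> \<sigma> a))"
    using \<sigma> by (simp add: embedding_isomorphism_def)
  have 2: "(\<forall>a \<in> parcs H. map_prod \<tau> \<tau> (q a) = p (map_prod \<tau> \<tau> a) \<and> map_prod \<tau> \<tau> (inv q a) = inv p (map_prod \<tau> \<tau> a)) \<or>
      (\<forall>a \<in> parcs H. map_prod \<tau> \<tau> (q a) = inv p (map_prod \<tau> \<tau> a) \<and> map_prod \<tau> \<tau> (inv q a) = p (map_prod \<tau> \<tau> a))"
    using \<tau> isomorphism_commutes_inv[OF wf(4,6), of "map_prod \<tau> \<tau>"]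
    unfolding embedding_isomorphism_def by blast
  have "(\<forall>a \<in> parcs G. map_prod \<tau> \<tau> (map_prod \<sigma> \<sigma> (r a)) = p (map_prod \<tau> \<tau> (map_prod \<sigma> \<sigma> a))) \<or>
      (\<forall>a \<in> parcs G. map_prod \<tau> \<tau> (map_prod \<sigma> \<sigma> (r a)) = inv p (map_prod \<tau> \<tau> (map_prod \<sigma> \<sigma> a)))"
    using 1 2 arcs(1) by (elim disjE) simp_all
  then show ?thesis using gc unfolding embedding_isomorphism_def mp by blast
qed

lemma embedding_isomorphism_inv:
  assumes G: "embedding G r" and H: "embedding H q" and \<sigma>: "embedding_isomorphism \<sigma> G r H q"
  shows "embedding_isomorphism (inv_into (pverts G) \<sigma>) H q G r"
proof -
  note wf = embedding_arcs[OF G] embedding_arcs[OF H]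
  let ?\<sigma>' = "inv_into (pverts G) \<sigma>"
  have gi: "graph_isomorphism \<sigma> G H" using \<sigma> by (auto simp: embedding_isomorphism_def)
  then have bij: "bij_betw \<sigma> (pverts G) (pverts H)" by (simp add: graph_isomorphism_def)
  have left: "?\<sigma>' (\<sigma> x) = x" if "x \<in> pverts G" for x
    using bij that by (simp add: bij_betw_inv_into_left)
  have right: "\<sigma> (?\<sigma>' y) = y" "?\<sigma>' y \<in> pverts G" if "y \<in> pverts H" for y
    using bij that by (simp_all add: bij_betw_inv_into_right bij_betw_apply[OF bij_betw_inv_into])
  have gi': "graph_isomorphism ?\<sigma>' H G"
    using bij_betw_inv_into[OF bij] gi right unfolding graph_isomorphism_def by metis
  have pull: "map_prod ?\<sigma>' ?\<sigma>' (map_prod \<sigma> \<sigma> a) = a" if "a \<in> parcs G" for a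
    using that left pair_wf_digraph.in_arcsD1[OF wf(1), of "fst a" "snd a"]
      pair_wf_digraph.in_arcsD2[OF wf(1), of "fst a" "snd a"]
    by (cases a) simp
  have forth: "\<exists>a \<in> parcs G. map_prod \<sigma> \<sigma> a = b" if "b \<in> parcs H" for b
  proof (intro bexI)
    show "map_prod ?\<sigma>' ?\<sigma>' b \<in> parcs G" using graph_isomorphism_arcs[OF gi' wf(3) that] .
    show "map_prod \<sigma> \<sigma> (map_prod ?\<sigma>' ?\<sigma>' b) = b"
      using that right(1) pair_wf_digraph.in_arcsD1[OF wf(3), of "fst b" "snd b"]
        pair_wf_digraph.in_arcsD2[OF wf(3), of "fst b" "snd b"]
      by (cases b) simp
  qed
  have rin: "r a \<in> parcs G" "inv r a \<in> parcs G" if "a \<in> parcs G" for a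
    using permutes_inv_in[OF wf(2) that] by auto
  have 1: "(\<forall>a \<in> parcs G. map_prod \<sigma> \<sigma> (r a) = q (map_prod \<sigma> \<sigma> a)) \<or>
      (\<forall>a \<in> parcs G. map_prod \<sigma> \<sigma> (inv r a) = q (map_prod \<sigma> \<sigma> a))"
    using \<sigma> isomorphism_commutes_inv(2)[OF wf(2,4), of "map_prod \<sigma> \<sigma>"]
    unfolding embedding_isomorphism_def by blast
  then have "(\<forall>b \<in> parcs H. map_prod ?\<sigma>' ?\<sigma>' (q b) = r (map_prod ?\<sigma>' ?\<sigma>' b)) \<or>
      (\<forall>b \<in> parcs H. map_prod ?\<sigma>' ?\<sigma>' (q b) = inv r (map_prod ?\<sigma>' ?\<sigma>' b))"
  proof (elim disjE)
    assume *: "\<forall>a \<in> parcs G. map_prod \<sigma> \<sigma> (r a) = q (map_prod \<sigma> \<sigma> a)"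
    have "map_prod ?\<sigma>' ?\<sigma>' (q b) = r (map_prod ?\<sigma>' ?\<sigma>' b)" if b: "b \<in> parcs H" for b
    proof -
      obtain a where a: "a \<in> parcs G" "map_prod \<sigma> \<sigma> a = b" using forth[OF b] by blast
      then have "q b = map_prod \<sigma> \<sigma> (r a)" using * by simp
      then show ?thesis using pull[OF rin(1)[OF a(1)]] pull[OF a(1)] a(2) by simp
    qed
    then show ?thesis by blast
  next
    assume *: "\<forall>a \<in> parcs G. map_prod \<sigma> \<sigma> (inv r a) = q (map_prod \<sigma> \<sigma> a)"
    have "map_prod ?\<sigma>' ?\<sigma>' (q b) = inv r (map_prod ?\<sigma>' ?\<sigma>' b)" if b: "b \<in> parcs H" for b
    proof -
      obtain a where a: "a \<in> parcs G" "map_prod \<sigma> \<sigma> a = b" using forth[OF b] by blast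
      then have "q b = map_prod \<sigma> \<sigma> (inv r a)" using * by simp
      then show ?thesis using pull[OF rin(2)[OF a(1)]] pull[OF a(1)] a(2) by simp
    qed
    then show ?thesis by blast
  qed
  then show ?thesis using gi' by (simp add: embedding_isomorphism_def)
qed

text \<open>\<open>Aut\<close> contains extensional functions only, so a composed isomorphism has to
  be replaced by its restriction to the vertices.\<close>

lemma embedding_isomorphism_cong:
  assumes "embedding G r" "embedding_isomorphism \<sigma> G r H q" "\<And>x. x \<in> pverts G \<Longrightarrow> \<sigma> x = \<tau> x"
  shows "embedding_isomorphism \<tau> G r H q"
proof -
  note wf = embedding_arcs[OF assms(1)]
  have "map_prod \<sigma> \<sigma> a = map_prod \<tau> \<tau> a" if "a \<in> parcs G" for a
    using that assms(3) pair_wf_digraph.in_arcsD1[OF wf(1), of "fst a" "snd a"]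
      pair_wf_digraph.in_arcsD2[OF wf(1), of "fst a" "snd a"]
    by (cases a) simp
  moreover have "graph_isomorphism \<tau> G H"
    using assms(2,3) bij_betw_cong[of "pverts G" \<sigma> \<tau>]
    by (auto simp: embedding_isomorphism_def graph_isomorphism_def)
  ultimately show ?thesis
    using assms(2) permutes_inv_in(1)[OF wf(2)] unfolding embedding_isomorphism_def by simp
qed

lemma isomorphic_embeddings_refl: "isomorphic_embeddings G r G r"
proof -
  have "embedding_isomorphism id G r G r"
    by (simp add: embedding_isomorphism_def graph_isomorphism_def prod.map_id0)
  then show ?thesis unfolding isomorphic_embeddings_def by (rule exI[of _ id])
qed

lemma isomorphic_embeddings_sym:
  assumes "embedding G r" "embedding H q" "isomorphic_embeddings G r H q"
  shows "isomorphic_embeddings H q G r"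
proof -
  obtain \<sigma> where "embedding_isomorphism \<sigma> G r H q"
    using assms(3) unfolding isomorphic_embeddings_def by (rule exE)
  then have "embedding_isomorphism (inv_into (pverts G) \<sigma>) H q G r"
    by (rule embedding_isomorphism_inv[OF assms(1,2)])
  then show ?thesis
    unfolding isomorphic_embeddings_def by (rule exI[of _ "inv_into (pverts G) \<sigma>"])
qed

text \<open>Take a maximal set \<open>B\<close> without related pairs. By maximality and symmetry
  each element of \<open>A\<close> is related to a member of \<open>B\<close>, so \<open>A\<close>
  is covered by \<open>card B\<close> sets of at most \<open>M\<close> elements.\<close>

lemma exists_independent_representatives:
  assumes "finite A" and "\<And>a. a \<in> A \<Longrightarrow> card {b \<in> A. R a b} \<le> M"
    and "\<And>a. a \<in> A \<Longrightarrow> R a a" and "\<And>a b. a \<in> A \<Longrightarrow> b \<in> A \<Longrightarrow> R a b \<Longrightarrow> R b a"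
  shows "\<exists>B \<subseteq> A. (\<forall>a \<in> B. \<forall>b \<in> B. a \<noteq> b \<longrightarrow> \<not> R a b) \<and> card A \<le> M * card B"
proof -
  define \<B> where "\<B> = {B. B \<subseteq> A \<and> (\<forall>a \<in> B. \<forall>b \<in> B. a \<noteq> b \<longrightarrow> \<not> R a b)}"
  have "finite \<B>" using assms(1) by (simp add: \<B>_def)
  moreover have "{} \<in> \<B>" by (simp add: \<B>_def)
  ultimately obtain B where B: "B \<in> \<B>" "\<And>B'. B' \<in> \<B> \<Longrightarrow> B \<subseteq> B' \<Longrightarrow> B' = B"
    using finite_has_maximal[of \<B>] by blast
  have BA: "B \<subseteq> A" using B(1) by (simp add: \<B>_def)
  have "A \<subseteq> (\<Union>b \<in> B. {a \<in> A. R b a})"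
  proof
    fix a assume a: "a \<in> A"
    show "a \<in> (\<Union>b \<in> B. {a \<in> A. R b a})"
    proof (rule ccontr)
      assume "\<not> ?thesis"
      then have no: "\<not> R b a" if "b \<in> B" for b using that a by blast
      then have "insert a B \<in> \<B>" using B(1) a assms(4) unfolding \<B>_def by blast
      then have "a \<in> B" using B(2)[of "insert a B"] by blast
      then show False using no assms(3)[OF a] by blast
    qed
  qed
  then have "card A \<le> card (\<Union>b \<in> B. {a \<in> A. R b a})" using assms(1) BA
    by (intro card_mono) (auto intro: finite_subset)
  also have "\<dots> \<le> (\<Sum>b \<in> B. card {a \<in> A. R b a})"
    using assms(1) BA by (intro card_UN_le) (auto intro: finite_subset)
  also have "\<dots> \<le> M * card B"
    using sum_bounded_above[of B "\<lambda>b. card {a \<in> A. R b a}" M] assms(2) BA by (auto simp: mult.commute)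
  finally have "card A \<le> M * card B" .
  moreover have "\<forall>a \<in> B. \<forall>b \<in> B. a \<noteq> b \<longrightarrow> \<not> R a b" using B(1) by (simp add: \<B>_def)
  ultimately show ?thesis using BA by (intro exI[of _ B] conjI)
qed

section \<open>The embedding of a labelling\<close>

lemma sum_lessThan_add:
  fixes f :: "nat \<Rightarrow> 'a::comm_monoid_add"
  shows "(\<Sum>j<a + b. f j) = (\<Sum>j<a. f j) + (\<Sum>j<b. f (a + j))"
  by (induction b) (simp_all add: add.assoc)

lemma card_orbit_eq_funpow_dist1:
  assumes "x \<in> orbit f x"
  shows "card (orbit f x) = funpow_dist1 f x x"
  unfolding orbit_conv_funpow_dist1[OF assms] using inj_on_funpow_dist1[OF assms]
  by (subst card_image) simp_all

context face_darts
begin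

lemma phi_funpow_mult: "d \<in> D \<Longrightarrow> (\<phi> ^^ (k * m)) d = d"
  by (induction m) (simp_all add: funpow_add phi_period)

lemma phi_period_dvd:
  assumes "d \<in> D" "(\<phi> ^^ m) d = d"
  shows "k dvd m"
proof -
  have "(\<phi> ^^ m) d = (\<phi> ^^ (m mod k + k * (m div k))) d" by simp
  also have "\<dots> = (\<phi> ^^ (m mod k)) d" unfolding funpow_add using phi_funpow_mult[OF assms(1)] by simp
  finally have "(\<phi> ^^ (m mod k)) d = d" using assms(2) by simp
  moreover have "m mod k < k" using k_ge by simp
  ultimately have "m mod k = 0" using phi_minimal[OF assms(1), of "m mod k"] by linarith
  then show ?thesis by blast
qed

lemma sum_phi_mult:
  assumes "d \<in> D"
  shows "(\<Sum>j<k * q. s ((\<phi> ^^ j) d)) = int q * face_sum s d"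
proof (induction q)
  case (Suc q)
  have "(\<Sum>j<k * Suc q. s ((\<phi> ^^ j) d)) = (\<Sum>j<k * q + k. s ((\<phi> ^^ j) d))"
    by (simp add: add.commute)
  also have "\<dots> = (\<Sum>j<k * q. s ((\<phi> ^^ j) d)) + (\<Sum>j<k. s ((\<phi> ^^ (k * q + j)) d))"
    by (rule sum_lessThan_add)
  also have "(\<Sum>j<k. s ((\<phi> ^^ (k * q + j)) d)) = face_sum s d"
  proof -
    have "(\<phi> ^^ (k * q + j)) d = (\<phi> ^^ j) d" for j
      unfolding add.commute[of "k * q" j] funpow_add using phi_funpow_mult[OF assms] by simp
    then show ?thesis by (simp add: face_sum_def)
  qed
  finally show ?case using Suc by (simp add: distrib_right)
qed simp

definition cayley :: "int pair_pre_digraph" where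
  "cayley = \<lparr>pverts = Zmod v, parcs = {(x, y). x \<in> Zmod v \<and> y \<in> Zmod v \<and> (x - y) mod int v \<in> S}\<rparr>"

lemma pverts_cayley [simp]: "pverts cayley = Zmod v"
  by (simp add: cayley_def)

definition shift :: "('d \<Rightarrow> int) \<Rightarrow> int \<Rightarrow> 'd \<Rightarrow> int" where
  "shift s x d = (x + s d) mod int v"

text \<open>Every arc has exactly one such pair of coordinates x and d. In them \<open>rot s\<close>
  applies \<open>\<theta>\<close> to d, reversal moves x by the label of d and applies
  \<open>\<nu>\<close> to d, and so a step of face tracing moves x by the label of d and applies
  \<open>\<phi>\<close> to d.\<close>

definition arc_at :: "('d \<Rightarrow> int) \<Rightarrow> int \<Rightarrow> 'd \<Rightarrow> int \<times> int" where
  "arc_at s x d = (x, shift s x d)"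

definition rot :: "('d \<Rightarrow> int) \<Rightarrow> int rotation" where
  "rot s = (\<lambda>(x, y). if (x, y) \<in> parcs cayley
     then arc_at s x (\<theta> (inv_into D s ((y - x) mod int v))) else (x, y))"

lemma shift_in [simp]: "shift s x d \<in> Zmod v"
  using v_pos by (simp add: shift_def)

lemma S_diff_swap: "(x - y) mod int v \<in> S \<Longrightarrow> (y - x) mod int v \<in> S"
  using S_neg[of "(x - y) mod int v"] by (simp add: mod_simps)

lemma arcs_sym: "(x, y) \<in> parcs cayley \<Longrightarrow> (y, x) \<in> parcs cayley"
  using S_diff_swap by (auto simp: cayley_def)

context
  fixes s assumes s: "s \<in> labellings"
begin

lemma arc_in: "x \<in> Zmod v \<Longrightarrow> d \<in> D \<Longrightarrow> arc_at s x d \<in> parcs cayley"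
  using labellings_in[OF s nu_in[of d]] labellings_neg[OF s, of d] v_pos
  by (simp add: arc_at_def shift_def cayley_def mod_simps)

lemma arc_cases:
  assumes "a \<in> parcs cayley"
  obtains x d where "x \<in> Zmod v" "d \<in> D" "a = arc_at s x d"
proof -
  obtain x y where a: "a = (x, y)" by (cases a)
  then have xy: "x \<in> Zmod v" "y \<in> Zmod v" "(y - x) mod int v \<in> S"
    using assms S_diff_swap by (auto simp: cayley_def)
  then obtain d where "d \<in> D" "(y - x) mod int v = s d" using labellings_image[OF s] by (metis imageE)
  moreover from this have "shift s x d = y" using xy(2) by (simp add: shift_def mod_simps flip: \<open>(y - x) mod int v = s d\<close>)
  ultimately show ?thesis using that xy(1) a by (simp add: arc_at_def)
qed

lemma shift_diff: "d \<in> D \<Longrightarrow> (shift s x d - x) mod int v = s d"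
  using labellings_Zmod[OF s] by (simp add: shift_def mod_simps)

lemma shift_eq_iff: "d \<in> D \<Longrightarrow> e \<in> D \<Longrightarrow> shift s x d = shift s x e \<longleftrightarrow> d = e"
  using shift_diff labellings_eqD[OF s] by metis

lemma arc_eq_iff: "d \<in> D \<Longrightarrow> e \<in> D \<Longrightarrow> arc_at s x d = arc_at s y e \<longleftrightarrow> x = y \<and> d = e"
  using shift_eq_iff by (auto simp: arc_at_def)

lemma shift_nu:
  assumes "x \<in> Zmod v" "d \<in> D"
  shows "shift s (shift s x d) (\<nu> d) = x"
  using labellings_neg[OF s assms(2)] assms(1) by (simp add: shift_def mod_simps)

lemma swap_arc: "x \<in> Zmod v \<Longrightarrow> d \<in> D \<Longrightarrow> prod.swap (arc_at s x d) = arc_at s (shift s x d) (\<nu> d)"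
  using shift_nu by (simp add: arc_at_def)

lemma rot_arc: "x \<in> Zmod v \<Longrightarrow> d \<in> D \<Longrightarrow> rot s (arc_at s x d) = arc_at s x (\<theta> d)"
  using arc_in[of x d] shift_diff[of d x] labellings_inj[OF s]
  by (simp add: rot_def arc_at_def inv_into_f_f)

lemma rot_permutes: "rot s permutes parcs cayley"
proof (rule bij_imp_permutes)
  have fin: "finite (parcs cayley)"
    by (rule finite_subset[of _ "Zmod v \<times> Zmod v"]) (auto simp: cayley_def)
  have "inj_on (rot s) (parcs cayley)"
  proof (rule inj_onI)
    fix a b assume a: "a \<in> parcs cayley" and b: "b \<in> parcs cayley" and eq: "rot s a = rot s b"
    from a b show "a = b"
    proof (elim arc_cases)
      fix x d y e
      assume *: "x \<in> Zmod v" "d \<in> D" "a = arc_at s x d" "y \<in> Zmod v" "e \<in> D" "b = arc_at s y e"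
      then have "arc_at s x (\<theta> d) = arc_at s y (\<theta> e)" using eq rot_arc by simp
      then show "a = b"
        using * arc_eq_iff[OF theta_in theta_in] inj_onD[OF theta_inj] by metis
    qed
  qed
  moreover have "rot s ` parcs cayley \<subseteq> parcs cayley"
  proof (rule image_subsetI)
    fix a assume "a \<in> parcs cayley"
    then show "rot s a \<in> parcs cayley"
      using rot_arc arc_in theta_in by (metis arc_cases)
  qed
  ultimately show "bij_betw (rot s) (parcs cayley) (parcs cayley)"
    using fin by (simp add: bij_betw_def endo_inj_surj)
  show "rot s a = a" if "a \<notin> parcs cayley" for a
    using that by (cases a) (simp add: rot_def)
qed

lemma reachable_shift:
  assumes "x \<in> Zmod v" "y \<in> Zmod v"
  shows "reachable (with_proj cayley) x y"
proof -
  interpret pair_wf_digraph cayley by unfold_locales (auto simp: cayley_def)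
  have step: "reachable (with_proj cayley) x ((x + a) mod int v)"
    if a: "a \<in> S" and x: "x \<in> Zmod v" for a x
  proof -
    obtain d where "d \<in> D" "a = s d" using a labellings_image[OF s] by blast
    then have "(x, (x + a) mod int v) \<in> parcs cayley"
      using arc_in[OF x] by (simp add: arc_at_def shift_def)
    then show ?thesis by simp
  qed
  have "(y - x) mod int v \<in> Zmod v" using v_pos by simp
  then show ?thesis
    using S_sum
  proof (elim disjE[OF S_sum])
    assume "(y - x) mod int v \<in> S"
    from step[OF this assms(1)] show ?thesis using assms(2) by (simp add: mod_simps)
  next
    assume "\<exists>a \<in> S. \<exists>b \<in> S. (y - x) mod int v = (a + b) mod int v"
    then obtain a b where ab: "a \<in> S" "b \<in> S" "(y - x) mod int v = (a + b) mod int v" by blast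
    have "((x + a) mod int v + b) mod int v = (x + (a + b) mod int v) mod int v"
      by (simp add: mod_simps add.assoc)
    also have "\<dots> = (x + (y - x) mod int v) mod int v" using ab(3) by simp
    also have "\<dots> = y" using assms(2) by (simp add: mod_simps)
    finally have eq: "((x + a) mod int v + b) mod int v = y" .
    show ?thesis
      using reachable_trans[OF step[OF ab(1) assms(1)] step[OF ab(2)]] v_pos eq by simp
  qed
qed

lemma zero_notin_S: "0 \<notin> S"
  using S_neg_neq[of 0] by auto

lemma embedding_rot: "embedding cayley (rot s)"
  unfolding embedding_def
proof (intro conjI ballI)
  show "pair_graph cayley"
  proof
    show "finite (parcs cayley)"
      by (rule finite_subset[of _ "Zmod v \<times> Zmod v"]) (auto simp: cayley_def)
    show "symmetric (with_proj cayley)"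
      using arcs_sym by (auto simp: symmetric_def intro: symI)
    show "fst e \<noteq> snd e" if "e \<in> parcs cayley" for e
      using that zero_notin_S by (auto simp: cayley_def)
  qed (auto simp: cayley_def)
  then have wf: "wf_digraph (with_proj cayley)"
    unfolding wf_digraph_wp_iff
    by (intro pair_fin_digraph.axioms(1) pair_digraph.axioms(1) pair_graph.axioms(1))
  show "Digraph_Component.connected (with_proj cayley)"
    unfolding Digraph_Component.connected_def
  proof (rule strongly_connectedI)
    show "verts (with_proj (mk_symmetric (with_proj cayley))) \<noteq> {}" using zero_Zmod by auto
    fix x y assume "x \<in> verts (with_proj (mk_symmetric (with_proj cayley)))"
      "y \<in> verts (with_proj (mk_symmetric (with_proj cayley)))"
    then show "reachable (with_proj (mk_symmetric (with_proj cayley))) x y"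
      using reachable_shift by (intro wf_digraph.reachable_mk_symmetricI[OF wf]) simp
  qed
  show "rot s permutes parcs cayley" by (rule rot_permutes)
  fix a assume "a \<in> parcs cayley"
  then obtain x d where a: "x \<in> Zmod v" "d \<in> D" "a = arc_at s x d" by (rule arc_cases)
  have nb: "neighbours cayley x = shift s x ` D"
  proof (intro set_eqI iffI)
    fix y assume "y \<in> neighbours cayley x"
    then have "(x, y) \<in> parcs cayley" by (simp add: neighbours_def)
    then obtain x' e where "e \<in> D" "(x, y) = arc_at s x' e" by (rule arc_cases)
    then show "y \<in> shift s x ` D" by (auto simp: arc_at_def)
  next
    fix y assume "y \<in> shift s x ` D"
    then show "y \<in> neighbours cayley x" using arc_in[OF a(1)] by (auto simp: neighbours_def arc_at_def)
  qed
  have "cyclic_on (\<lambda>z. snd (rot s (x, z))) (shift s x ` D)"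
    using rot_arc[OF a(1)] by (intro cyclic_on_image[OF cyclic_theta]) (simp add: arc_at_def)
  then show "case a of (x, y) \<Rightarrow> fst (rot s (x, y)) = x \<and>
      cyclic_on (\<lambda>z. snd (rot s (x, z))) (neighbours cayley x)"
    using a(3) rot_arc[OF a(1,2)] nb by (simp add: arc_at_def)
qed

section \<open>Tracing and colouring the faces\<close>

abbreviation face_map :: "int \<times> int \<Rightarrow> int \<times> int" where
  "face_map \<equiv> \<lambda>(x, y). rot s (y, x)"

lemma face_map_arc:
  assumes "x \<in> Zmod v" "d \<in> D"
  shows "face_map (arc_at s x d) = arc_at s (shift s x d) (\<phi> d)"
proof -
  have "face_map (arc_at s x d) = rot s (prod.swap (arc_at s x d))" by (simp add: arc_at_def)
  also have "\<dots> = arc_at s (shift s x d) (\<phi> d)"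
    using swap_arc[OF assms] rot_arc[OF _ nu_in[OF assms(2)]] by (simp add: \<phi>_def)
  finally show ?thesis .
qed

lemma face_map_funpow:
  assumes "x \<in> Zmod v" "d \<in> D"
  shows "(face_map ^^ m) (arc_at s x d) = arc_at s ((x + (\<Sum>j<m. s ((\<phi> ^^ j) d))) mod int v) ((\<phi> ^^ m) d)"
proof (induction m)
  case 0
  then show ?case using assms by simp
next
  case (Suc m)
  have "(face_map ^^ Suc m) (arc_at s x d) = face_map ((face_map ^^ m) (arc_at s x d))" by simp
  also have "\<dots> = arc_at s (shift s ((x + (\<Sum>j<m. s ((\<phi> ^^ j) d))) mod int v) ((\<phi> ^^ m) d)) ((\<phi> ^^ Suc m) d)"
    unfolding Suc using face_map_arc[OF _ phi_funpow_in[OF assms(2)]] v_pos by simp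
  finally show ?case by (simp add: shift_def mod_simps add.assoc)
qed

lemma face_map_return:
  assumes "x \<in> Zmod v" "d \<in> D"
  shows "(face_map ^^ (k * v)) (arc_at s x d) = arc_at s x d"
  unfolding face_map_funpow[OF assms] sum_phi_mult[OF assms(2)] phi_funpow_mult[OF assms(2)]
  using assms(1) by simp

lemma arc_in_face:
  assumes "x \<in> Zmod v" "d \<in> D"
  shows "arc_at s x d \<in> orbit face_map (arc_at s x d)"
  using face_map_return[OF assms] k_ge v_pos unfolding orbit_altdef
  by (auto intro!: exI[of _ "k * v"])

text \<open>After \<open>P\<close> steps the dart has returned, so \<open>P\<close> = k * q, and the
  vertex has returned, so v divides q times the face sum. A nonzero sum excludes q = 1. For prime v
  it forces v to divide q, while k * v steps always close the walk.\<close>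

lemma face_length_properties:
  assumes x: "x \<in> Zmod v" and d: "d \<in> D" and nz: "\<not> [face_sum s d = 0] (mod int v)"
  defines "P \<equiv> face_length (orbit face_map (arc_at s x d))"
  shows "k dvd P" "k < P" "prime v \<Longrightarrow> P = k * v"
proof -
  let ?a = "arc_at s x d"
  have self: "?a \<in> orbit face_map ?a" by (rule arc_in_face[OF x d])
  have P: "P = funpow_dist1 face_map ?a ?a"
    unfolding P_def face_length_def by (rule card_orbit_eq_funpow_dist1[OF self])
  have Ppos: "0 < P" unfolding P by simp
  have "(face_map ^^ P) ?a = ?a" unfolding P using self by (rule funpow_dist1_prop)
  then have ret: "(x + (\<Sum>j<P. s ((\<phi> ^^ j) d))) mod int v = x" "(\<phi> ^^ P) d = d"
    using face_map_funpow[OF x d] arc_eq_iff[OF phi_funpow_in[OF d] d] by metis+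
  show "k dvd P" using phi_period_dvd[OF d ret(2)] .
  then obtain q where q: "P = k * q" by blast
  have "[x + int q * face_sum s d = x + 0] (mod int v)"
    using ret(1) x unfolding q sum_phi_mult[OF d] by (simp add: cong_def)
  then have dv: "int v dvd int q * face_sum s d"
    unfolding cong_add_lcancel by (simp add: cong_0_iff)
  have "q \<noteq> 1" using dv nz by (auto simp: cong_0_iff)
  moreover have "q \<noteq> 0" using Ppos q by auto
  ultimately have "1 < q" by linarith
  then show "k < P" unfolding q using k_ge by simp
  assume "prime v"
  then have "int v dvd int q"
    using dv nz prime_dvd_mult_iff[of "int v"] by (auto simp: cong_0_iff)
  then have "v \<le> q" using \<open>q \<noteq> 0\<close> by (simp add: dvd_imp_le)
  moreover have "P \<le> k * v"
    unfolding P using face_map_return[OF x d] k_ge v_pos self by (intro funpow_dist1_le_self) auto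
  ultimately show "P = k * v" unfolding q using k_ge by simp
qed

lemma faces_cayley:
  assumes "f \<in> faces cayley (rot s)"
  obtains x d where "x \<in> Zmod v" "d \<in> D" "f = orbit face_map (arc_at s x d)"
proof -
  obtain a where "a \<in> parcs cayley" "f = orbit face_map a"
    using assms unfolding faces_def by (rule imageE)
  then show ?thesis using that by (elim arc_cases) simp
qed

lemma face_colour:
  assumes "x \<in> Zmod v" "d \<in> D" "y \<in> Zmod v" "e \<in> D" "arc_at s y e \<in> orbit face_map (arc_at s x d)"
  shows "\<kappa> e \<longleftrightarrow> \<kappa> d" "orbit face_map (arc_at s y e) = orbit face_map (arc_at s x d)"
proof -
  obtain m where "arc_at s y e = (face_map ^^ m) (arc_at s x d)" using assms(5) unfolding orbit_altdef by auto
  then have "e = (\<phi> ^^ m) d"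
    using arc_eq_iff[OF assms(4) phi_funpow_in[OF assms(2)]] unfolding face_map_funpow[OF assms(1,2)] by simp
  then show "\<kappa> e \<longleftrightarrow> \<kappa> d" using phi_funpow_colour[OF assms(2)] by simp
  have "arc_at s x d \<in> orbit face_map (arc_at s y e)"
    using orbit_swap[OF arc_in_face[OF assms(1,2)] assms(5)] .
  then show "orbit face_map (arc_at s y e) = orbit face_map (arc_at s x d)"
    using assms(5) by (auto intro: orbit_trans)
qed

text \<open>A face is coloured by the common value of \<open>\<kappa>\<close> on its darts. The two
  arcs of an edge carry d and \<open>\<nu> d\<close>, of opposite colours, so each colour selects
  one arc, and an arc lies on one face only.\<close>

lemma biembedding_rot: "biembedding cayley (rot s)"
proof -
  define colour where "colour f \<longleftrightarrow> (\<exists>x \<in> Zmod v. \<exists>d \<in> D. arc_at s x d \<in> f \<and> \<kappa> d)" for f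
  have col: "colour (orbit face_map (arc_at s x d)) \<longleftrightarrow> \<kappa> d" if "x \<in> Zmod v" "d \<in> D" for x d
  proof
    assume "colour (orbit face_map (arc_at s x d))"
    then obtain y e where "y \<in> Zmod v" "e \<in> D" "arc_at s y e \<in> orbit face_map (arc_at s x d)" "\<kappa> e"
      unfolding colour_def by blast
    then show "\<kappa> d" using face_colour(1)[OF that] by simp
  next
    assume "\<kappa> d"
    then show "colour (orbit face_map (arc_at s x d))"
      unfolding colour_def using arc_in_face[OF that] that by blast
  qed
  have "\<exists>!f. f \<in> faces cayley (rot s) \<and> colour f = b \<and> edge_on_face e f"
    if e: "e \<in> edges cayley" for e b
  proof -
    obtain x0 y0 where xy0: "(x0, y0) \<in> parcs cayley" "e = {x0, y0}" using e by (auto simp: edges_def)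
    from xy0(1) obtain x1 d1 where a1: "x1 \<in> Zmod v" "d1 \<in> D" "(x0, y0) = arc_at s x1 d1" by (rule arc_cases)
    obtain x d where a: "x \<in> Zmod v" "d \<in> D" "\<kappa> d = b" and e': "e = {x, shift s x d}"
    proof (cases "\<kappa> d1 = b")
      case True
      then show ?thesis using that[OF a1(1,2)] a1(3) xy0(2) by (simp add: arc_at_def)
    next
      case False
      then have "\<kappa> (\<nu> d1) = b" using nu_colour[OF a1(2)] by blast
      then show ?thesis
        using that[OF shift_in[of s x1 d1] nu_in[OF a1(2)]] shift_nu[OF a1(1,2)] a1(3) xy0(2)
        by (simp add: arc_at_def insert_commute)
    qed
    let ?f = "orbit face_map (arc_at s x d)"
    show ?thesis
    proof (rule ex1I[of _ ?f], intro conjI)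
      show "?f \<in> faces cayley (rot s)" unfolding faces_def using arc_in[OF a(1,2)] by (rule imageI)
      show "colour ?f = b" using col[OF a(1,2)] a(3) by simp
      show "edge_on_face e ?f"
        unfolding edge_on_face_def using arc_in_face[OF a(1,2)] e' by (intro bexI[of _ "arc_at s x d"]) (auto simp: arc_at_def)
    next
      fix f assume f: "f \<in> faces cayley (rot s) \<and> colour f = b \<and> edge_on_face e f"
      then have "f \<in> faces cayley (rot s)" by simp
      then obtain y c where y: "y \<in> Zmod v" "c \<in> D" "f = orbit face_map (arc_at s y c)"
        by (rule faces_cayley)
      have cb: "\<kappa> c = b" using col[OF y(1,2)] f y(3) by simp
      obtain p q where pq: "(p, q) \<in> f" "e = {p, q}" using f by (auto simp: edge_on_face_def)
      have "(p, q) = arc_at s x d \<or> (p, q) = prod.swap (arc_at s x d)"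
        using e' pq(2) by (auto simp: arc_at_def doubleton_eq_iff)
      then have "(p, q) = arc_at s x d"
      proof
        assume "(p, q) = prod.swap (arc_at s x d)"
        then have "arc_at s (shift s x d) (\<nu> d) \<in> orbit face_map (arc_at s y c)"
          using pq(1) y(3) swap_arc[OF a(1,2)] by simp
        then have "\<kappa> (\<nu> d) = \<kappa> c" using face_colour(1)[OF y(1,2) shift_in nu_in[OF a(2)]] by simp
        then show ?thesis using nu_colour[OF a(2)] a(3) cb by blast
      qed
      then show "f = ?f" using face_colour(2)[OF y(1,2) a(1,2)] pq(1) y(3) by simp
    qed
  qed
  then show ?thesis
    unfolding biembedding_def using embedding_rot by (intro conjI exI[of _ colour]) simp_all
qed

end

end

section \<open>Automorphisms and isomorphism classes\<close>

context face_darts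
begin

text \<open>In the coordinates of \<open>arc_at\<close> an isomorphism sends the dart d at x to the
  dart \<open>\<Psi> x d\<close> at \<open>\<sigma> x\<close>. Compatibility with the rotations puts
  \<open>\<Psi> x\<close> into a commutant, with \<open>\<epsilon>\<close> common to all x because
  the orientation behaviour is chosen globally; compatibility with reversal of arcs is the
  transition rule.\<close>

lemma isomorphism_on_darts:
  assumes s: "s \<in> labellings" and s': "s' \<in> labellings"
    and \<sigma>: "embedding_isomorphism \<sigma> cayley (rot s) cayley (rot s')"
  shows "\<exists>\<epsilon> \<Psi>. \<forall>x \<in> Zmod v. \<Psi> x \<in> commutant \<epsilon> \<and>
    (\<forall>d \<in> D. \<sigma> (shift s x d) = shift s' (\<sigma> x) (\<Psi> x d) \<and> \<Psi> (shift s x d) (\<nu> d) = \<nu> (\<Psi> x d))"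
proof -
  have bij: "bij_betw \<sigma> (Zmod v) (Zmod v)"
    using \<sigma> by (simp add: embedding_isomorphism_def graph_isomorphism_def)
  then have \<sigma>Z: "\<sigma> x \<in> Zmod v" if "x \<in> Zmod v" for x using that by (rule bij_betw_apply)
  have \<sigma>inj: "x = y" if "x \<in> Zmod v" "y \<in> Zmod v" "\<sigma> x = \<sigma> y" for x y
    using bij that by (auto simp: bij_betw_def inj_on_def)
  have wf: "pair_wf_digraph cayley" by (rule embedding_arcs(1)[OF embedding_rot[OF s]])
  have gi: "graph_isomorphism \<sigma> cayley cayley" using \<sigma> by (simp add: embedding_isomorphism_def)
  have "\<exists>e \<in> D. \<sigma> (shift s x d) = shift s' (\<sigma> x) e" if "x \<in> Zmod v" "d \<in> D" for x d
  proof -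
    have "map_prod \<sigma> \<sigma> (arc_at s x d) \<in> parcs cayley"
      using graph_isomorphism_arcs[OF gi wf arc_in[OF s that]] .
    then obtain y e where "e \<in> D" "map_prod \<sigma> \<sigma> (arc_at s x d) = arc_at s' y e"
      by (rule arc_cases[OF s'])
    then show ?thesis by (auto simp: arc_at_def)
  qed
  then obtain g where g: "\<And>x d. x \<in> Zmod v \<Longrightarrow> d \<in> D \<Longrightarrow> g x d \<in> D \<and> \<sigma> (shift s x d) = shift s' (\<sigma> x) (g x d)"
    by metis
  define \<Psi> where "\<Psi> x = restrict (g x) D" for x
  have \<Psi>: "\<Psi> x d \<in> D" "\<sigma> (shift s x d) = shift s' (\<sigma> x) (\<Psi> x d)" if "x \<in> Zmod v" "d \<in> D" for x d
    using g[OF that] that(2) by (simp_all add: \<Psi>_def)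
  have arcs: "map_prod \<sigma> \<sigma> (arc_at s x d) = arc_at s' (\<sigma> x) (\<Psi> x d)" if "x \<in> Zmod v" "d \<in> D" for x d
    using \<Psi>[OF that] by (simp add: arc_at_def)
  have rev: "\<Psi> (shift s x d) (\<nu> d) = \<nu> (\<Psi> x d)" if x: "x \<in> Zmod v" and d: "d \<in> D" for x d
  proof -
    have "shift s' (\<sigma> (shift s x d)) (\<Psi> (shift s x d) (\<nu> d)) = \<sigma> x"
      using \<Psi>(2)[OF shift_in nu_in[OF d]] shift_nu[OF s x d] by metis
    moreover have "shift s' (\<sigma> (shift s x d)) (\<nu> (\<Psi> x d)) = \<sigma> x"
      using \<Psi>[OF x d] shift_nu[OF s' \<sigma>Z[OF x]] by simp
    ultimately show ?thesis
      using shift_eq_iff[OF s' \<Psi>(1)[OF shift_in nu_in[OF d]] nu_in[OF \<Psi>(1)[OF x d]]] by metis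
  qed
  have \<Psi>bij: "bij_betw (\<Psi> x) D D" if x: "x \<in> Zmod v" for x
  proof -
    have "inj_on (\<Psi> x) D"
    proof (rule inj_onI)
      fix d e assume de: "d \<in> D" "e \<in> D" "\<Psi> x d = \<Psi> x e"
      then have "\<sigma> (shift s x d) = \<sigma> (shift s x e)" using \<Psi>(2)[OF x] by simp
      then have "shift s x d = shift s x e" using \<sigma>inj by simp
      then show "d = e" using shift_eq_iff[OF s] de by simp
    qed
    then show ?thesis
      using \<Psi>(1)[OF x] finite_D by (simp add: bij_betw_def endo_inj_surj image_subsetI)
  qed
  have ori: "(\<forall>a \<in> parcs cayley. map_prod \<sigma> \<sigma> (rot s a) = rot s' (map_prod \<sigma> \<sigma> a)) \<or>
      (\<forall>a \<in> parcs cayley. map_prod \<sigma> \<sigma> (rot s a) = inv (rot s') (map_prod \<sigma> \<sigma> a))"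
    using \<sigma> by (simp add: embedding_isomorphism_def)
  have "\<exists>\<epsilon>. \<forall>x \<in> Zmod v. \<Psi> x \<in> commutant \<epsilon>"
    using ori
  proof
    assume *: "\<forall>a \<in> parcs cayley. map_prod \<sigma> \<sigma> (rot s a) = rot s' (map_prod \<sigma> \<sigma> a)"
    have "\<Psi> x (\<theta> d) = \<theta> (\<Psi> x d)" if x: "x \<in> Zmod v" and d: "d \<in> D" for x d
    proof -
      have "arc_at s' (\<sigma> x) (\<Psi> x (\<theta> d)) = map_prod \<sigma> \<sigma> (rot s (arc_at s x d))"
        using arcs[OF x theta_in[OF d]] rot_arc[OF s x d] by simp
      also have "\<dots> = arc_at s' (\<sigma> x) (\<theta> (\<Psi> x d))"
        using * arc_in[OF s x d] arcs[OF x d] rot_arc[OF s' \<sigma>Z[OF x] \<Psi>(1)[OF x d]] by simp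
      finally show ?thesis
        using arc_eq_iff[OF s'] \<Psi>(1)[OF x theta_in[OF d]] theta_in[OF \<Psi>(1)[OF x d]] by blast
    qed
    then have "\<Psi> x \<in> commutant True" if "x \<in> Zmod v" for x
      using \<Psi>bij[OF that] that by (simp add: commutant_def \<Psi>_def)
    then show ?thesis by blast
  next
    assume *: "\<forall>a \<in> parcs cayley. map_prod \<sigma> \<sigma> (rot s a) = inv (rot s') (map_prod \<sigma> \<sigma> a)"
    have "\<theta> (\<Psi> x (\<theta> d)) = \<Psi> x d" if x: "x \<in> Zmod v" and d: "d \<in> D" for x d
    proof -
      have "arc_at s' (\<sigma> x) (\<Psi> x (\<theta> d)) = map_prod \<sigma> \<sigma> (rot s (arc_at s x d))"
        using arcs[OF x theta_in[OF d]] rot_arc[OF s x d] by simp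
      also have "\<dots> = inv (rot s') (arc_at s' (\<sigma> x) (\<Psi> x d))"
        using * arc_in[OF s x d] arcs[OF x d] by simp
      finally have "rot s' (arc_at s' (\<sigma> x) (\<Psi> x (\<theta> d))) = arc_at s' (\<sigma> x) (\<Psi> x d)"
        using permutes_inverses(1)[OF rot_permutes[OF s']] by simp
      then have "arc_at s' (\<sigma> x) (\<theta> (\<Psi> x (\<theta> d))) = arc_at s' (\<sigma> x) (\<Psi> x d)"
        using rot_arc[OF s' \<sigma>Z[OF x] \<Psi>(1)[OF x theta_in[OF d]]] by simp
      then show ?thesis
        using arc_eq_iff[OF s'] theta_in[OF \<Psi>(1)[OF x theta_in[OF d]]] \<Psi>(1)[OF x d] by blast
    qed
    then have "\<Psi> x \<in> commutant False" if "x \<in> Zmod v" for x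
      using \<Psi>bij[OF that] that by (simp add: commutant_def \<Psi>_def)
    then show ?thesis by blast
  qed
  then obtain \<epsilon> where "\<forall>x \<in> Zmod v. \<Psi> x \<in> commutant \<epsilon>" ..
  then show ?thesis using \<Psi>(2) rev by (intro exI[of _ \<epsilon>] exI[of _ \<Psi>]) simp
qed

lemma shift_zero: "s \<in> labellings \<Longrightarrow> d \<in> D \<Longrightarrow> shift s 0 d = s d"
  using labellings_Zmod by (simp add: shift_def)

text \<open>Rigidity makes the dart permutation at 0 trivial, so all neighbours of 0 are fixed. At a
  neighbour the dart leading back to 0 is fixed, hence the dart permutation is trivial there too,
  and two steps reach every vertex.\<close>

lemma rigid_isomorphism_fixed:
  assumes s: "s \<in> labellings" "\<not> flexible s"
    and \<tau>: "embedding_isomorphism \<tau> cayley (rot s) cayley (rot s)" "\<tau> 0 = 0"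
    and x: "x \<in> Zmod v"
  shows "\<tau> x = x"
proof -
  obtain \<epsilon> \<Psi> where \<Psi>: "\<And>x. x \<in> Zmod v \<Longrightarrow> \<Psi> x \<in> commutant \<epsilon>"
    "\<And>x d. x \<in> Zmod v \<Longrightarrow> d \<in> D \<Longrightarrow> \<tau> (shift s x d) = shift s (\<tau> x) (\<Psi> x d)"
    "\<And>x d. x \<in> Zmod v \<Longrightarrow> d \<in> D \<Longrightarrow> \<Psi> (shift s x d) (\<nu> d) = \<nu> (\<Psi> x d)"
    using isomorphism_on_darts[OF s(1) s(1) \<tau>(1)] by blast
  have "realises s \<epsilon> (\<Psi> 0)"
    unfolding realises_def using \<Psi> \<tau>(2)
    by (intro exI[of _ \<tau>] exI[of _ \<Psi>]) (simp add: shift_def)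
  then have triv: "\<epsilon>" "\<Psi> 0 = restrict id D"
    using s(2) \<Psi>(1)[OF zero_Zmod] unfolding flexible_def by blast+
  have \<tau>s: "\<tau> (s d) = s d" if "d \<in> D" for d
    using \<Psi>(2)[OF zero_Zmod that] shift_zero[OF s(1) that] \<tau>(2) triv(2) that by simp
  have \<Psi>s: "\<Psi> (s d) = restrict id D" if d: "d \<in> D" for d
  proof -
    have "\<Psi> (s d) (\<nu> d) = \<nu> d"
      using \<Psi>(3)[OF zero_Zmod d] shift_zero[OF s(1) d] triv(2) d by simp
    moreover have "\<Psi> (s d) \<in> commutant True" using \<Psi>(1) labellings_Zmod[OF s(1) d] triv(1) by simp
    ultimately show ?thesis using commutant_True_fixed nu_in[OF d] by blast
  qed
  show ?thesis
    using S_sum[OF x]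
  proof
    assume "x \<in> S"
    then show ?thesis using \<tau>s labellings_image[OF s(1)] by (metis imageE)
  next
    assume "\<exists>a \<in> S. \<exists>b \<in> S. x = (a + b) mod int v"
    then obtain d e where de: "d \<in> D" "e \<in> D" "x = shift s (s d) e"
      using labellings_image[OF s(1)] unfolding shift_def by blast
    then show ?thesis
      using \<Psi>(2)[OF labellings_Zmod[OF s(1) de(1)] de(2)] \<tau>s[OF de(1)] \<Psi>s[OF de(1)] by simp
  qed
qed

section \<open>The automorphism group and affine isomorphisms\<close>

lemma translation_apply: "x \<in> Zmod v \<Longrightarrow> translation v g x = (x + g) mod int v"
  by (simp add: translation_def)

lemma translation_isomorphism:
  assumes s: "s \<in> labellings"
  shows "embedding_isomorphism (translation v g) cayley (rot s) cayley (rot s)"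
proof -
  let ?t = "translation v g"
  have in_Z: "?t x \<in> Zmod v" if "x \<in> Zmod v" for x using that v_pos by (simp add: translation_apply)
  have "inj_on ?t (Zmod v)"
  proof (rule inj_onI)
    fix x y assume "x \<in> Zmod v" "y \<in> Zmod v" "?t x = ?t y"
    then have "[x + g = y + g] (mod int v)" by (simp add: translation_apply cong_def)
    then show "x = y"
      using \<open>x \<in> Zmod v\<close> \<open>y \<in> Zmod v\<close> by (simp add: cong_add_rcancel Zmod_cong_eq)
  qed
  then have "bij_betw ?t (Zmod v) (Zmod v)"
    using in_Z by (simp add: bij_betw_def endo_inj_surj image_subsetI)
  moreover have "(?t x - ?t y) mod int v = (x - y) mod int v" if "x \<in> Zmod v" "y \<in> Zmod v" for x y
    using that by (simp add: translation_apply mod_simps)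
  ultimately have "graph_isomorphism ?t cayley cayley"
    using in_Z by (simp add: graph_isomorphism_def cayley_def)
  moreover have "map_prod ?t ?t (rot s a) = rot s (map_prod ?t ?t a)" if arc: "a \<in> parcs cayley" for a
  proof -
    have t_arc: "map_prod ?t ?t (arc_at s x d) = arc_at s (?t x) d" if "x \<in> Zmod v" for x d
      using that shift_in[of s x d]
      by (simp add: arc_at_def translation_apply shift_def mod_simps ac_simps)
    obtain x d where a: "x \<in> Zmod v" "d \<in> D" "a = arc_at s x d" using arc by (rule arc_cases[OF s])
    show ?thesis
      using a t_arc rot_arc[OF s a(1,2)] rot_arc[OF s in_Z[OF a(1)] a(2)] by simp
  qed
  ultimately show ?thesis by (simp add: embedding_isomorphism_def)
qed

lemma isomorphism_Zmod:
  assumes "embedding_isomorphism \<sigma> cayley r cayley q" "x \<in> Zmod v"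
  shows "\<sigma> x \<in> Zmod v"
  using assms bij_betw_apply[of \<sigma> "Zmod v" "Zmod v" x]
  by (simp add: embedding_isomorphism_def graph_isomorphism_def)

text \<open>Translations are transitive on the vertices, so an automorphism can be composed with one
  of them to fix 0, where rigidity applies.\<close>

lemma Aut_rot:
  assumes s: "s \<in> labellings" "\<not> flexible s"
  shows "Aut cayley (rot s) = translation v ` Zmod v"
proof
  note emb = embedding_rot[OF s(1)]
  show "translation v ` Zmod v \<subseteq> Aut cayley (rot s)"
    using translation_isomorphism[OF s(1)] by (auto simp: Aut_def translation_def)
  show "Aut cayley (rot s) \<subseteq> translation v ` Zmod v"
  proof
    fix \<sigma> assume "\<sigma> \<in> Aut cayley (rot s)"
    then have ext: "\<sigma> \<in> extensional (Zmod v)" and \<sigma>: "embedding_isomorphism \<sigma> cayley (rot s) cayley (rot s)"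
      by (simp_all add: Aut_def)
    have \<sigma>Z: "\<sigma> x \<in> Zmod v" if "x \<in> Zmod v" for x using isomorphism_Zmod[OF \<sigma> that] .
    let ?\<tau> = "translation v (- \<sigma> 0) \<circ> \<sigma>"
    have iso: "embedding_isomorphism ?\<tau> cayley (rot s) cayley (rot s)"
      by (rule embedding_isomorphism_comp[OF emb emb emb \<sigma> translation_isomorphism[OF s(1)]])
    have "?\<tau> 0 = 0" using translation_apply[OF \<sigma>Z[OF zero_Zmod]] by simp
    then have fixed: "?\<tau> x = x" if "x \<in> Zmod v" for x using rigid_isomorphism_fixed[OF s iso _ that] by simp
    have "\<sigma> x = translation v (\<sigma> 0) x" if x: "x \<in> Zmod v" for x
    proof -
      have "x = (\<sigma> x - \<sigma> 0) mod int v" using fixed[OF x] translation_apply[OF \<sigma>Z[OF x]] by simp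
      then have "(x + \<sigma> 0) mod int v = ((\<sigma> x - \<sigma> 0) mod int v + \<sigma> 0) mod int v" by simp
      also have "\<dots> = \<sigma> x" using \<sigma>Z[OF x] by (simp add: mod_simps)
      finally show ?thesis using translation_apply[OF x] by simp
    qed
    then have "\<sigma> = translation v (\<sigma> 0)"
      using ext by (intro extensionalityI[of _ "Zmod v"]) (simp_all add: translation_def)
    then show "\<sigma> \<in> translation v ` Zmod v" using \<sigma>Z[OF zero_Zmod] by blast
  qed
qed

text \<open>Conjugating \<open>translation v 1\<close> by \<open>\<sigma>\<close> yields an
  automorphism of the target, which is the translation by some u because \<open>s'\<close> is rigid.
  So \<open>\<sigma>\<close> turns unit steps into steps of length u.\<close>

lemma isomorphism_affine:
  assumes s: "s \<in> labellings" and s': "s' \<in> labellings" "\<not> flexible s'"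
    and \<sigma>: "embedding_isomorphism \<sigma> cayley (rot s) cayley (rot s')"
  shows "\<exists>u \<in> Zmod v. \<forall>x \<in> Zmod v. \<sigma> x = (u * x + \<sigma> 0) mod int v"
proof -
  note emb = embedding_rot[OF s] embedding_rot[OF s'(1)]
  let ?\<sigma>' = "inv_into (Zmod v) \<sigma>"
  let ?\<alpha> = "\<sigma> \<circ> (translation v 1 \<circ> ?\<sigma>')"
  have "embedding_isomorphism ?\<sigma>' cayley (rot s') cayley (rot s)"
    using embedding_isomorphism_inv[OF emb \<sigma>] by simp
  then have "embedding_isomorphism (translation v 1 \<circ> ?\<sigma>') cayley (rot s') cayley (rot s)"
    by (rule embedding_isomorphism_comp[OF emb(2,1,1) _ translation_isomorphism[OF s]])
  then have "embedding_isomorphism ?\<alpha> cayley (rot s') cayley (rot s')"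
    by (rule embedding_isomorphism_comp[OF emb(2,1,2) _ \<sigma>])
  then have "embedding_isomorphism (restrict ?\<alpha> (Zmod v)) cayley (rot s') cayley (rot s')"
    by (rule embedding_isomorphism_cong[OF emb(2)]) simp
  then have "restrict ?\<alpha> (Zmod v) \<in> Aut cayley (rot s')" by (simp add: Aut_def)
  then obtain u where u: "u \<in> Zmod v" "restrict ?\<alpha> (Zmod v) = translation v u"
    unfolding Aut_rot[OF s'] by blast
  have \<sigma>Z: "\<sigma> x \<in> Zmod v" if "x \<in> Zmod v" for x using isomorphism_Zmod[OF \<sigma> that] .
  have inj: "inj_on \<sigma> (Zmod v)"
    using \<sigma> by (simp add: embedding_isomorphism_def graph_isomorphism_def bij_betw_def)
  have step: "\<sigma> ((x + 1) mod int v) = (\<sigma> x + u) mod int v" if x: "x \<in> Zmod v" for x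
  proof -
    have "restrict ?\<alpha> (Zmod v) (\<sigma> x) = \<sigma> ((x + 1) mod int v)"
      using \<sigma>Z[OF x] x inj by (simp add: translation_apply)
    then show ?thesis using u(2) translation_apply[OF \<sigma>Z[OF x]] by simp
  qed
  have lin: "\<sigma> (int m mod int v) = (u * int m + \<sigma> 0) mod int v" for m
  proof (induction m)
    case 0
    then show ?case using \<sigma>Z[OF zero_Zmod] by simp
  next
    case (Suc m)
    have "\<sigma> (int (Suc m) mod int v) = \<sigma> ((int m mod int v + 1) mod int v)" by (simp add: mod_simps add.commute)
    also have "\<dots> = (u * int (Suc m) + \<sigma> 0) mod int v"
      using step[of "int m mod int v"] v_pos Suc by (simp add: mod_simps algebra_simps)
    finally show ?case .
  qed
  have "\<sigma> x = (u * x + \<sigma> 0) mod int v" if x: "x \<in> Zmod v" for x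
  proof -
    have "int (nat x) = x" using x by (simp add: Zmod_def)
    then show ?thesis using lin[of "nat x"] x by simp
  qed
  then show ?thesis using u(1) by blast
qed

text \<open>Passing to differences at 0 removes the additive constant of the affine map:
  \<open>s'\<close> composed with the dart permutation \<open>\<psi>\<close> at 0 is u times
  \<open>s\<close>. As \<open>\<psi>\<close> is onto, \<open>s'\<close> is determined by u, the
  orientation and \<open>\<psi>\<close>.\<close>

lemma card_isomorphic_le:
  assumes s: "s \<in> labellings"
  shows "card {s' \<in> labellings. \<not> flexible s' \<and> isomorphic_embeddings cayley (rot s) cayley (rot s')}
    \<le> 2 * v * card D"
proof -
  let ?X = "{s' \<in> labellings. \<not> flexible s' \<and> isomorphic_embeddings cayley (rot s) cayley (rot s')}"
  let ?Y = "Zmod v \<times> (SIGMA \<epsilon> : (UNIV :: bool set). commutant \<epsilon>)"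
  define Q where "Q s' p \<longleftrightarrow> (\<forall>d \<in> D. s' (snd (snd p) d) = (fst p * s d) mod int v)"
    for s' :: "'d \<Rightarrow> int" and p :: "int \<times> bool \<times> ('d \<Rightarrow> 'd)"
  have ex: "\<exists>p \<in> ?Y. Q s' p" if s'X: "s' \<in> ?X" for s'
  proof -
    have s': "s' \<in> labellings" "\<not> flexible s'" using s'X by auto
    obtain \<sigma> where \<sigma>: "embedding_isomorphism \<sigma> cayley (rot s) cayley (rot s')"
      using s'X by (auto simp: isomorphic_embeddings_def)
    obtain \<epsilon> \<Psi> where "\<forall>x \<in> Zmod v. \<Psi> x \<in> commutant \<epsilon> \<and>
        (\<forall>d \<in> D. \<sigma> (shift s x d) = shift s' (\<sigma> x) (\<Psi> x d) \<and> \<Psi> (shift s x d) (\<nu> d) = \<nu> (\<Psi> x d))"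
      using isomorphism_on_darts[OF s s'(1) \<sigma>] by blast
    then have \<Psi>: "\<Psi> 0 \<in> commutant \<epsilon>"
      "\<And>d. d \<in> D \<Longrightarrow> \<sigma> (shift s 0 d) = shift s' (\<sigma> 0) (\<Psi> 0 d)"
      using zero_Zmod by auto
    obtain u where u: "u \<in> Zmod v" "\<And>x. x \<in> Zmod v \<Longrightarrow> \<sigma> x = (u * x + \<sigma> 0) mod int v"
      using isomorphism_affine[OF s s' \<sigma>] by blast
    have "s' (\<Psi> 0 d) = (u * s d) mod int v" if d: "d \<in> D" for d
    proof -
      have "s' (\<Psi> 0 d) = (shift s' (\<sigma> 0) (\<Psi> 0 d) - \<sigma> 0) mod int v"
        using shift_diff[OF s'(1) commutant_in[OF \<Psi>(1) d]] by simp
      also have "\<dots> = (\<sigma> (s d) - \<sigma> 0) mod int v" using \<Psi>(2)[OF d] shift_zero[OF s d] by simp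
      also have "\<dots> = (u * s d) mod int v" using u(2)[OF labellings_Zmod[OF s d]] by (simp add: mod_simps)
      finally show ?thesis .
    qed
    then show ?thesis using u(1) \<Psi>(1) by (intro bexI[of _ "(u, \<epsilon>, \<Psi> 0)"]) (auto simp: Q_def)
  qed
  define F where "F s' = (SOME p. p \<in> ?Y \<and> Q s' p)" for s'
  have F: "F s' \<in> ?Y" "Q s' (F s')" if "s' \<in> ?X" for s'
    using someI_ex[of "\<lambda>p. p \<in> ?Y \<and> Q s' p"] ex[OF that] unfolding F_def by blast+
  have "inj_on F ?X"
  proof (rule inj_onI)
    fix s1 s2 assume s1: "s1 \<in> ?X" and s2: "s2 \<in> ?X" and eq: "F s1 = F s2"
    obtain u \<epsilon> \<psi> where p: "F s1 = (u, \<epsilon>, \<psi>)" by (cases "F s1")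
    then have surj: "\<psi> ` D = D" using F(1)[OF s1] by (auto simp: commutant_def bij_betw_def)
    have "s1 e = s2 e" if e: "e \<in> D" for e
    proof -
      obtain d where "d \<in> D" "e = \<psi> d" using surj e by blast
      then show ?thesis using F(2)[OF s1] F(2)[OF s2] p eq by (simp add: Q_def)
    qed
    moreover have "s1 \<in> extensional D" "s2 \<in> extensional D"
      using s1 s2 by (auto simp: labellings_def PiE_def)
    ultimately show "s1 = s2" by (intro extensionalityI[of _ D])
  qed
  moreover have "F ` ?X \<subseteq> ?Y" using F(1) by blast
  moreover have "finite ?Y" using finite_commutant by (intro finite_cartesian_product) auto
  ultimately have "card ?X \<le> card ?Y" by (rule card_inj_on_le)
  also have "\<dots> = v * (card (commutant True) + card (commutant False))"
    using finite_commutant by (simp add: card_cartesian_product card_SigmaI UNIV_bool)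
  also have "\<dots> \<le> v * (2 * card D)"
    using card_commutant_le[of True] card_commutant_le[of False] by (intro mult_le_mono2) simp
  finally show ?thesis by (simp add: ac_simps)
qed

end

section \<open>Counting embeddings\<close>

text \<open>The quantity to be outgrown by the signs: an isomorphism class has at most 2 * v *
  \<open>card D\<close> \<le> 16 N^2 members, and a further factor 2 pays for the labellings that
  are not good.\<close>

lemma thirty_two_square_le_power:
  assumes "14 \<le> m"
  shows "32 * m^2 \<le> (2::nat)^m"
  using assms
proof (induction m rule: dec_induct)
  case (step m)
  have "32 * (Suc m)^2 \<le> 2 * (32 * m^2)"
  proof -
    have "2 * m + 1 \<le> 14 * m" using step by simp
    also have "\<dots> \<le> m * m" using step by simp
    finally show ?thesis by (simp add: power2_eq_square)
  qed
  then show ?case using step by simp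
qed simp

context face_darts
begin

lemma card_positive_darts: "card {d \<in> D. \<kappa> d} = n * k"
proof -
  let ?A = "{d \<in> D. \<kappa> d}"
  have "D = ?A \<union> \<nu> ` ?A"
  proof (intro set_eqI iffI)
    fix d assume d: "d \<in> D"
    show "d \<in> ?A \<union> \<nu> ` ?A"
    proof (cases "\<kappa> d")
      case False
      then have "\<nu> d \<in> ?A" "d = \<nu> (\<nu> d)" using d nu_in nu_colour nu_nu by auto
      then show ?thesis by blast
    qed (use d in simp)
  qed (use nu_in in auto)
  moreover have "?A \<inter> \<nu> ` ?A = {}" using nu_colour by auto
  moreover have "card (\<nu> ` ?A) = card ?A" by (rule card_image[OF inj_on_subset[OF nu_inj]]) auto
  ultimately have "card D = card ?A + card ?A"
    using finite_D card_Un_disjoint[of ?A "\<nu> ` ?A"] by simp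
  then show ?thesis by (simp add: card_D)
qed

lemma S_bounds:
  assumes "x \<in> S"
  shows "0 < x" "x < int v" "2 * x \<noteq> int v" "(- x) mod int v = int v - x"
proof -
  have x: "0 \<le> x" "x < int v" using assms S_Zmod by (auto simp: Zmod_def)
  have "x \<noteq> 0" using S_neg_neq[OF assms] by auto
  then show pos: "0 < x" and "x < int v" using x by auto
  have "(- x) mod int v = (int v - x) mod int v" by (simp add: mod_simps)
  also have "\<dots> = int v - x" using x pos by (intro mod_pos_pos_trivial) auto
  finally show neg: "(- x) mod int v = int v - x" .
  show "2 * x \<noteq> int v" using S_neg_neq[OF assms] neg by auto
qed

lemma card_half: "card {x \<in> S. 2 * x < int v} = n * k"
proof -
  let ?H = "{x \<in> S. 2 * x < int v}"
  let ?m = "\<lambda>x. (- x) mod int v"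
  have "S = ?H \<union> ?m ` ?H"
  proof (intro set_eqI iffI)
    fix x assume x: "x \<in> S"
    show "x \<in> ?H \<union> ?m ` ?H"
    proof (cases "2 * x < int v")
      case False
      have "?m x \<in> ?H" using S_neg[OF x] S_bounds[OF x] False by simp
      moreover have "x = ?m (?m x)" using x S_Zmod by (auto simp: mod_simps)
      ultimately show ?thesis by blast
    qed (use x in simp)
  qed (use S_neg in auto)
  moreover have "?H \<inter> ?m ` ?H = {}"
  proof (rule ccontr)
    assume "?H \<inter> ?m ` ?H \<noteq> {}"
    then obtain x where "x \<in> S" "2 * x < int v" "2 * ?m x < int v" by auto
    then show False using S_bounds(4)[of x] by simp
  qed
  moreover have "card (?m ` ?H) = card ?H"
  proof (rule card_image, rule inj_onI)
    fix x y assume "x \<in> ?H" "y \<in> ?H" "?m x = ?m y"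
    then show "x = y" using S_bounds(4)[of x] S_bounds(4)[of y] by simp
  qed
  ultimately have "card S = card ?H + card ?H"
    using finite_S card_Un_disjoint[of ?H "?m ` ?H"] by simp
  then show ?thesis by (simp add: card_S card_D)
qed

text \<open>A labelling is built from a bijection g of the N darts of positive colour onto the N
  elements of \<open>S\<close> below v / 2 and a set \<open>A\<close> of those positive darts whose
  label is not negated. The map \<open>h\<close> returns the smaller of a label and its negative and
  so recovers g; then \<open>A\<close> consists of the positive darts whose label is below v /
  2.\<close>

lemma card_labellings_ge: "2 ^ (n * k) * fact (n * k) \<le> card labellings"
proof -
  define D' where "D' = {d \<in> D. \<kappa> d}"
  define H where "H = {x \<in> S. 2 * x < int v}"
  define I where "I = {g \<in> D' \<rightarrow>\<^sub>E H. inj_on g D'}"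
  define m where "m x = (- x) mod int v" for x
  define val where "val g A d = (if d \<in> A then g d else m (g d))" for g :: "'d \<Rightarrow> int" and A d
  define pos where "pos d = (if \<kappa> d then d else \<nu> d)" for d
  define lab where "lab = (\<lambda>(g, A). \<lambda>d \<in> D. if \<kappa> d then val g A d else m (val g A (\<nu> d)))"
  define h where "h x = (if 2 * x < int v then x else m x)" for x
  have fin: "finite D'" "finite H" using finite_D finite_S by (simp_all add: D'_def H_def)
  have pos: "pos d \<in> D'" if "d \<in> D" for d using that nu_in nu_colour by (simp add: pos_def D'_def)
  have mm: "m (m x) = x" if "x \<in> S" for x using that S_Zmod by (auto simp: m_def mod_simps)
  have mS: "m x \<in> S" if "x \<in> S" for x using S_neg[OF that] by (simp add: m_def)
  have h_val: "h (val g A d) = g d" "h (m (val g A d)) = g d" "val g A d \<in> S" "2 * val g A d < int v \<longleftrightarrow> d \<in> A"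
    if "g \<in> I" "d \<in> D'" for g A d
  proof -
    have g: "g d \<in> S" "2 * g d < int v" using that by (auto simp: I_def H_def)
    have "\<not> 2 * m (g d) < int v" using g S_bounds[OF g(1)] by (simp add: m_def)
    then show "h (val g A d) = g d" "h (m (val g A d)) = g d" "val g A d \<in> S"
      "2 * val g A d < int v \<longleftrightarrow> d \<in> A"
      using g mm[OF g(1)] mS[OF g(1)] by (simp_all add: val_def h_def)
  qed
  have lab_in: "lab (g, A) \<in> labellings" if g: "g \<in> I" for g A
  proof -
    have lab: "lab (g, A) d = (if \<kappa> d then val g A (pos d) else m (val g A (pos d)))" if "d \<in> D" for d
      using that by (simp add: lab_def pos_def)
    have S: "lab (g, A) d \<in> S" if "d \<in> D" for d
      using lab[OF that] h_val(3)[OF g pos[OF that]] mS by simp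
    have neg: "lab (g, A) (\<nu> d) = (- lab (g, A) d) mod int v" if "d \<in> D" for d
    proof -
      have "pos (\<nu> d) = pos d" using that nu_colour nu_nu by (simp add: pos_def)
      then show ?thesis
        using lab[OF that] lab[OF nu_in[OF that]] nu_colour[OF that] mm[OF h_val(3)[OF g pos[OF that]]]
        by (auto simp: m_def)
    qed
    have "inj_on (lab (g, A)) D"
    proof (rule inj_onI)
      fix d e assume de: "d \<in> D" "e \<in> D" "lab (g, A) d = lab (g, A) e"
      have "h (lab (g, A) x) = g (pos x)" if "x \<in> D" for x
        using lab[OF that] h_val(1,2)[OF g pos[OF that]] by simp
      then have "g (pos d) = g (pos e)" using de by metis
      then have "pos d = pos e" using g pos de by (auto simp: I_def inj_on_def)
      then have "d = e \<or> d = \<nu> e"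
        using de nu_nu inj_onD[OF nu_inj, of d e] by (auto simp: pos_def split: if_splits)
      moreover have "d \<noteq> \<nu> e" using neg[OF de(2)] S_neg_neq[OF S[OF de(2)]] de(3) by auto
      ultimately show "d = e" by blast
    qed
    then show ?thesis using S neg by (simp add: labellings_def lab_def)
  qed
  have inj: "inj_on lab (I \<times> Pow D')"
  proof (rule inj_onI)
    fix p q assume p: "p \<in> I \<times> Pow D'" and q: "q \<in> I \<times> Pow D'" and eq: "lab p = lab q"
    obtain g A g' A' where gA: "p = (g, A)" "q = (g', A')" by (cases p, cases q)
    have g: "g \<in> I" "A \<subseteq> D'" "g' \<in> I" "A' \<subseteq> D'" using p q by (simp_all add: gA)
    have v: "val g A d = val g' A' d" if "d \<in> D'" for d
      using fun_cong[OF eq, of d] that by (simp add: gA lab_def D'_def)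
    have "g d = g' d" if "d \<in> D'" for d
      using v[OF that] h_val(1)[OF g(1) that] h_val(1)[OF g(3) that] by metis
    then have "g = g'" using g by (intro extensionalityI[of _ D']) (auto simp: I_def PiE_def)
    moreover have "d \<in> A \<longleftrightarrow> d \<in> A'" if "d \<in> D'" for d
      using v[OF that] h_val(4)[OF g(1) that] h_val(4)[OF g(3) that] by metis
    ultimately show "p = q" using g gA by auto
  qed
  have "card I = (\<Prod>i = 0..<n * k. n * k - i)"
    using card_inj_on_subset_funcset[OF fin(1,2), of D'] card_positive_darts card_half
    by (simp add: I_def D'_def H_def)
  also have "\<dots> = fact (n * k)"
    by (simp add: fact_prod_rev)
  finally have cI: "card I = fact (n * k)" .
  have "card (I \<times> Pow D') \<le> card labellings"
    using lab_in by (intro card_inj_on_le[OF inj _ finite_labellings]) auto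
  then show ?thesis
    using cI card_positive_darts fin by (simp add: card_cartesian_product card_Pow D'_def mult.commute)
qed

lemma exists_family:
  assumes large: "300 \<le> n * k"
  shows "\<exists>F. finite F \<and>
    (\<forall>r \<in> F. biembedding cayley r \<and> Aut cayley r = translation v ` Zmod v \<and>
       (\<forall>f \<in> faces cayley r. k dvd face_length f \<and> k < face_length f) \<and>
       (prime v \<longrightarrow> gonal (k * v) cayley r)) \<and>
    (\<forall>r \<in> F. \<forall>q \<in> F. r \<noteq> q \<longrightarrow> \<not> isomorphic_embeddings cayley r cayley q) \<and>
    fact (n * k) \<le> card F"
proof -
  define N where "N = n * k"
  define good where "good = {s \<in> labellings. \<not> zero_sum s \<and> \<not> flexible s}"
  define R where "R s s' = isomorphic_embeddings cayley (rot s) cayley (rot s')" for s s'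
  let ?L = "card labellings"
  let ?Z = "card {s \<in> labellings. zero_sum s}"
  let ?X = "card {s \<in> labellings. flexible s}"
  \<comment> \<open>The proportion of zero-sum labellings is at most n / (nk - k + 1). For n \<ge> 5
    and k \<ge> 3 this is largest at n = 5, k = 3, where it equals 5/13.\<close>
  have "13 * n \<le> 5 * (n * k - (k - 1))"
  proof -
    have "(n - 1) * 3 \<le> (n - 1) * k" using k_ge by simp
    then have "3 * n - 2 \<le> n * k - (k - 1)" using n_ge k_ge by (simp add: diff_mult_distrib)
    then show ?thesis using n_ge by linarith
  qed
  then have "?Z * (13 * n) \<le> ?Z * (5 * (n * k - (k - 1)))" by (rule mult_le_mono2)
  moreover have "?Z * (2 * (n * k - (k - 1))) \<le> 2 * n * ?L"
    using card_zero_sum_le by (simp only: diff_mult_distrib2 mult.assoc)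
  moreover have "n * (13 * ?Z) = ?Z * (13 * n)" "?Z * (5 * W) = 5 * (?Z * W)"
    "?Z * (2 * W) = 2 * (?Z * W)" "2 * n * ?L = 2 * (n * ?L)" "n * (5 * ?L) = 5 * (n * ?L)" for W
    by simp_all
  ultimately have "n * (13 * ?Z) \<le> n * (5 * ?L)" by linarith
  then have Z: "13 * ?Z \<le> 5 * ?L" using n_ge by simp
  have N: "300 \<le> N" "card D = 2 * N" using large by (simp_all add: N_def card_D)
  \<comment> \<open>By \<open>card_flexible_le\<close> the flexible labellings have proportion at
    most 16 N / (N - 7)^2, and 208 = 13 * 16 brings this down to 1/13. With 5/13 for the zero sums,
    at least 7/13 of the labellings are good.\<close>
  have "208 * N \<le> (N - 7)^2"
  proof -
    obtain r where r: "N = r + 300" using N(1) by (metis add.commute le_Suc_ex)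
    show ?thesis by (simp add: r power2_eq_square algebra_simps)
  qed
  then have "?X * (208 * N) \<le> ?X * (N - 7)^2" by (rule mult_le_mono2)
  moreover have "4 * (?X * (N - 7)^2) \<le> 64 * N * ?L"
  proof -
    have "card D - 14 = 2 * (N - 7)" using N by simp
    then show ?thesis using card_flexible_le N(2) by (simp add: power_mult_distrib ac_simps)
  qed
  moreover have "(64 * N) * (13 * ?X) = 4 * (?X * (208 * N))" by simp
  ultimately have "(64 * N) * (13 * ?X) \<le> (64 * N) * ?L" by linarith
  then have X: "13 * ?X \<le> ?L" using N(1) by simp
  have "labellings = good \<union> {s \<in> labellings. zero_sum s} \<union> {s \<in> labellings. flexible s}"
    by (auto simp: good_def)
  then have "?L \<le> card good + ?Z + ?X"
    using card_Un_le[of good "{s \<in> labellings. zero_sum s}"]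
      card_Un_le[of "good \<union> {s \<in> labellings. zero_sum s}" "{s \<in> labellings. flexible s}"] by simp
  then have half: "?L \<le> 2 * card good" using Z X by linarith
  have goodL: "good \<subseteq> labellings" by (auto simp: good_def)
  have "\<exists>B \<subseteq> good. (\<forall>a \<in> B. \<forall>b \<in> B. a \<noteq> b \<longrightarrow> \<not> R a b) \<and> card good \<le> (2 * v * card D) * card B"
  proof (rule exists_independent_representatives)
    show "finite good" using goodL finite_labellings by (rule finite_subset)
    show "card {s' \<in> good. R s s'} \<le> 2 * v * card D" if "s \<in> good" for s
    proof -
      have "card {s' \<in> good. R s s'}
          \<le> card {s' \<in> labellings. \<not> flexible s' \<and> isomorphic_embeddings cayley (rot s) cayley (rot s')}"
        using finite_labellings by (intro card_mono) (auto simp: good_def R_def)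
      then show ?thesis using card_isomorphic_le[of s] that goodL by (meson le_trans subsetD)
    qed
    show "R s s" if "s \<in> good" for s unfolding R_def by (rule isomorphic_embeddings_refl)
    show "R s' s" if "s \<in> good" "s' \<in> good" "R s s'" for s s'
      using isomorphic_embeddings_sym[OF embedding_rot embedding_rot] that goodL unfolding R_def by blast
  qed
  then obtain B where B: "B \<subseteq> good" "\<And>a b. a \<in> B \<Longrightarrow> b \<in> B \<Longrightarrow> a \<noteq> b \<Longrightarrow> \<not> R a b"
    "card good \<le> (2 * v * card D) * card B" by blast
  have inj: "inj_on rot B"
  proof (rule inj_onI)
    fix s s' assume "s \<in> B" "s' \<in> B" "rot s = rot s'"
    then show "s = s'" using B(2)[of s s'] isomorphic_embeddings_refl[of cayley "rot s"] unfolding R_def by metis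
  qed
  have "2 ^ N * fact N \<le> ?L" using card_labellings_ge by (simp add: N_def)
  also have "\<dots> \<le> 2 * ((2 * v * card D) * card B)" using half B(3) by linarith
  also have "\<dots> \<le> 2 * ((2 * (2 * card D) * card D) * card B)"
    using v_le by (intro mult_le_mono) auto
  also have "\<dots> = (32 * N^2) * card B" by (simp add: N(2) power2_eq_square)
  also have "\<dots> \<le> 2 ^ N * card B" using thirty_two_square_le_power[of N] N(1) by simp
  finally have "fact N \<le> card B" by simp
  then have card: "fact (n * k) \<le> card (rot ` B)" using card_image[OF inj] by (simp add: N_def)
  have props: "biembedding cayley (rot s) \<and> Aut cayley (rot s) = translation v ` Zmod v \<and>
       (\<forall>f \<in> faces cayley (rot s). k dvd face_length f \<and> k < face_length f) \<and>
       (prime v \<longrightarrow> gonal (k * v) cayley (rot s))" if "s \<in> B" for s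
  proof -
    have s: "s \<in> labellings" "\<not> zero_sum s" "\<not> flexible s" using that B(1) by (auto simp: good_def)
    have face: "k dvd face_length f \<and> k < face_length f \<and> (prime v \<longrightarrow> face_length f = k * v)"
      if f: "f \<in> faces cayley (rot s)" for f
    proof -
      obtain x d where xd: "x \<in> Zmod v" "d \<in> D" "f = orbit (\<lambda>(x, y). rot s (y, x)) (arc_at s x d)"
        using f by (rule faces_cayley[OF s(1)])
      have "\<not> [face_sum s d = 0] (mod int v)" using s(2) xd(2) by (auto simp: zero_sum_def)
      then show ?thesis using face_length_properties[OF s(1) xd(1,2)] by (simp add: xd(3))
    qed
    show ?thesis
      using biembedding_rot[OF s(1)] Aut_rot[OF s(1,3)] face by (simp add: gonal_def)
  qed
  have fin: "finite (rot ` B)"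
    using B(1) goodL finite_labellings by (meson finite_imageI finite_subset)
  have noniso: "\<not> isomorphic_embeddings cayley r cayley q" if rq: "r \<in> rot ` B" "q \<in> rot ` B" "r \<noteq> q" for r q
  proof -
    obtain s s' where "s \<in> B" "s' \<in> B" "r = rot s" "q = rot s'" using rq(1,2) by blast
    then show ?thesis using B(2)[of s s'] rq(3) unfolding R_def by auto
  qed
  show ?thesis
    using props fin noniso card by (intro exI[of _ "rot ` B"]) blast
qed

end

section \<open>Two permutations of a grid whose product is a full cycle\<close>

context
  fixes n k :: nat
begin

text \<open>As n will be odd, \<open>(n + 1) div 2\<close> is the inverse of 2 modulo n, and the
  nontrivial maps are i - 1, 2 i and i / 2 + 1. Translations alone would not do: they commute,
  whereas one order of composition must give the identity, to make cycles of length k, and the other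
  a generator of the translations.\<close>

definition column_map :: "nat \<Rightarrow> int \<Rightarrow> int" where
  "column_map j i = (if j = 0 then (i - 1) mod int n else if j = 1 then (2 * i) mod int n
     else if j = 2 then (int ((n + 1) div 2) * i + 1) mod int n else i)"

definition row_step :: "int \<times> nat \<Rightarrow> int \<times> nat" where
  "row_step = (\<lambda>(i, j). (i, Suc j mod k))"

definition column_step :: "int \<times> nat \<Rightarrow> int \<times> nat" where
  "column_step = (\<lambda>(i, j). (column_map j i, Suc j mod k))"

definition grid :: "(int \<times> nat) set" where
  "grid = Zmod n \<times> {..<k}"

definition grid_darts :: "((int \<times> nat) \<times> bool) set" where
  "grid_darts = grid \<times> UNIV"

definition grid_nu :: "(int \<times> nat) \<times> bool \<Rightarrow> (int \<times> nat) \<times> bool" where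
  "grid_nu = (\<lambda>(c, b). (c, \<not> b))"

text \<open>The darts are two copies of the grid. \<open>grid_theta\<close> composed with
  \<open>grid_nu\<close> acts as \<open>row_step\<close> on the copy \<open>True\<close> and as
  \<open>column_step\<close> on the copy \<open>False\<close>, while \<open>grid_theta\<close>
  alternates between the copies; its square on the copy \<open>True\<close> is
  \<open>row_step\<close> after \<open>column_step\<close>, the product that has to be a full
  cycle.\<close>

definition grid_theta :: "(int \<times> nat) \<times> bool \<Rightarrow> (int \<times> nat) \<times> bool" where
  "grid_theta = (\<lambda>(c, b). if b then (column_step c, False) else (row_step c, True))"

context
  assumes odd_n: "odd n" and odd_k: "odd k" and n_ge: "5 \<le> n" and k_ge: "3 \<le> k"
begin

lemma half_twice: "2 * int ((n + 1) div 2) = int n + 1"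
  using odd_n by (auto elim!: oddE)

lemma column_map_in: "i \<in> Zmod n \<Longrightarrow> column_map j i \<in> Zmod n"
  using n_ge by (simp add: column_map_def)

lemma mod_n_eq:
  assumes "i \<in> Zmod n" "x = i + c * int n"
  shows "x mod int n = i"
  using assms by simp

lemma affine_mod: "(a * (x mod m) + b) mod m = (a * x + b) mod (m::int)"
  by (metis mod_add_left_eq mod_mult_right_eq)

lemma column_map_simps:
  "column_map 0 i = (i - 1) mod int n"
  "column_map 1 i = (2 * i) mod int n"
  "column_map 2 i = (int ((n + 1) div 2) * i + 1) mod int n"
  by (simp_all only: column_map_def if_True if_False refl one_neq_zero zero_neq_numeral
      numeral_eq_one_iff) simp_all

lemma column_map_cycle:
  assumes "i \<in> Zmod n"
  shows "column_map 2 (column_map 1 (column_map 0 i)) = i"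
    and "column_map 1 (column_map 2 (column_map 0 i)) = (i + 1) mod int n"
proof -
  define h where "h = int ((n + 1) div 2)"
  have h: "2 * h = int n + 1" unfolding h_def by (rule half_twice)
  have "column_map 2 (column_map 1 (column_map 0 i)) = (h * (2 * (i - 1)) + 1) mod int n"
    unfolding column_map_simps affine_mod mod_mult_right_eq h_def ..
  also have "h * (2 * (i - 1)) + 1 = (2 * h) * (i - 1) + 1" by simp
  also have "\<dots> = i + (i - 1) * int n" unfolding h by (simp add: algebra_simps)
  finally show "column_map 2 (column_map 1 (column_map 0 i)) = i" using mod_n_eq[OF assms] by simp
  have "column_map 1 (column_map 2 (column_map 0 i)) = (2 * ((h * (i - 1) + 1) mod int n)) mod int n"
    unfolding column_map_simps affine_mod h_def ..
  also have "\<dots> = (2 * (h * (i - 1) + 1)) mod int n" by (rule mod_mult_right_eq)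
  also have "2 * (h * (i - 1) + 1) = (2 * h) * (i - 1) + 2" by simp
  also have "\<dots> = i + 1 + (i - 1) * int n" unfolding h by (simp add: algebra_simps)
  finally show "column_map 1 (column_map 2 (column_map 0 i)) = (i + 1) mod int n" by simp
qed

lemma column_map_inj: "inj_on (column_map j) (Zmod n)"
proof -
  define h where "h = int ((n + 1) div 2)"
  have h: "2 * h = int n + 1" unfolding h_def by (rule half_twice)
  have eq: "x mod int n = i" if "i \<in> Zmod n" "x = (2 * h) * i" for i x
    using mod_n_eq[OF that(1), of x i] that(2) unfolding h by (simp add: algebra_simps)
  consider "j = 0" | "j = 1" | "j = 2" | "j \<notin> {0, 1, 2}" by blast
  then show ?thesis
  proof cases
    case 1
    have "(column_map j i + 1) mod int n = i" if "i \<in> Zmod n" for i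
      unfolding 1 column_map_simps using that by (simp add: mod_simps)
    then show ?thesis by (rule inj_on_inverseI)
  next
    case 2
    have "(h * column_map j i) mod int n = i" if "i \<in> Zmod n" for i
      unfolding 2 column_map_simps mod_mult_right_eq by (rule eq[OF that]) simp
    then show ?thesis by (rule inj_on_inverseI)
  next
    case 3
    have "(2 * column_map j i + (- 2)) mod int n = i" if "i \<in> Zmod n" for i
      unfolding 3 column_map_simps affine_mod h_def[symmetric] by (rule eq[OF that]) simp
    then show ?thesis by (rule inj_on_inverseI)
  next
    case 4
    then have "column_map j i = i" for i by (simp add: column_map_def)
    then show ?thesis by (simp add: inj_on_def)
  qed
qed

lemma Suc_mod_inj:
  assumes "i < k" "j < k" "Suc i mod k = Suc j mod k"
  shows "i = j"
  using assms by (simp add: mod_Suc split: if_splits)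

lemma row_step_in: "c \<in> grid \<Longrightarrow> row_step c \<in> grid"
  and column_step_in: "c \<in> grid \<Longrightarrow> column_step c \<in> grid"
  using column_map_in k_ge by (auto simp: row_step_def column_step_def grid_def)

lemma row_step_inj: "inj_on row_step grid"
proof (rule inj_onI)
  fix c d assume "c \<in> grid" "d \<in> grid" and eq: "row_step c = row_step d"
  obtain i j i' j' where cd: "c = (i, j)" "d = (i', j')" by (cases c, cases d)
  have "j < k" "j' < k" using \<open>c \<in> grid\<close> \<open>d \<in> grid\<close> by (simp_all add: grid_def cd)
  then show "c = d" using Suc_mod_inj[of j j'] eq by (simp add: row_step_def cd)
qed

lemma column_step_inj: "inj_on column_step grid"
proof (rule inj_onI)
  fix c d assume "c \<in> grid" "d \<in> grid" and eq: "column_step c = column_step d"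
  obtain i j i' j' where cd: "c = (i, j)" "d = (i', j')" by (cases c, cases d)
  have *: "i \<in> Zmod n" "j < k" "i' \<in> Zmod n" "j' < k"
    using \<open>c \<in> grid\<close> \<open>d \<in> grid\<close> by (simp_all add: grid_def cd)
  have "j = j'" using Suc_mod_inj[OF *(2,4)] eq by (simp add: column_step_def cd)
  moreover from this have "i = i'"
    using inj_onD[OF column_map_inj _ *(1,3), of j] eq by (simp add: column_step_def cd)
  ultimately show "c = d" by (simp add: cd)
qed

lemma snd_step: "snd (row_step c) = Suc (snd c) mod k" "snd (column_step c) = Suc (snd c) mod k"
  by (auto simp: row_step_def column_step_def split: prod.splits)

lemma snd_funpow:
  fixes f :: "int \<times> nat \<Rightarrow> int \<times> nat"
  assumes f: "\<And>c. snd (f c) = Suc (snd c) mod k" and "snd c < k"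
  shows "snd ((f ^^ m) c) = (snd c + m) mod k"
  using assms(2) by (induction m) (simp_all add: f mod_Suc_eq)

lemma row_step_period: "c \<in> grid \<Longrightarrow> (row_step ^^ k) c = c"
proof -
  have "(row_step ^^ m) (i, j) = (i, (j + m) mod k)" if "j < k" for i j m
    using that by (induction m) (simp_all add: row_step_def mod_Suc_eq)
  then show "c \<in> grid \<Longrightarrow> (row_step ^^ k) c = c" by (auto simp: grid_def)
qed

text \<open>The first three steps compose the maps of columns 0, 1, 2 to the identity; the remaining
  columns leave the row unchanged.\<close>

lemma column_step_funpow_zero:
  assumes i: "i \<in> Zmod n" and "3 \<le> a" "a \<le> k"
  shows "(column_step ^^ a) (i, 0) = (i, a mod k)"
  using assms(2,3)
proof (induction a rule: dec_induct)
  case base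
  have "(column_step ^^ 3) (i, 0) = (column_map 2 (column_map 1 (column_map 0 i)), 3 mod k)"
    using k_ge by (simp add: eval_nat_numeral column_step_def)
  then show ?case using column_map_cycle(1)[OF i] by simp
next
  case (step a)
  then show ?case by (simp add: column_step_def column_map_def)
qed

lemma funpow_in:
  assumes "\<And>c. c \<in> A \<Longrightarrow> f c \<in> A" "c \<in> A"
  shows "(f ^^ m) c \<in> A"
  by (induction m) (use assms in auto)

lemma funpow_inj_on:
  assumes "\<And>c. c \<in> A \<Longrightarrow> f c \<in> A" "inj_on f A"
  shows "inj_on (f ^^ m) A"
proof (induction m)
  case (Suc m)
  have "inj_on (f \<circ> f ^^ m) A"
    using assms funpow_in[of A f] by (intro comp_inj_on[OF Suc] inj_on_subset[OF assms(2)]) auto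
  then show ?case by (simp add: comp_def)
qed simp

text \<open>From an arbitrary column one first walks on to column 0, where the period is known; the
  walk commutes with the powers of \<open>column_step\<close> and is cancelled by
  injectivity.\<close>

lemma column_step_period:
  assumes c: "c \<in> grid"
  shows "(column_step ^^ k) c = c"
proof -
  obtain i j where ij: "c = (i, j)" "i \<in> Zmod n" "j < k" using c by (auto simp: grid_def)
  let ?g = "column_step ^^ (k - j)"
  have "?g c \<in> grid" by (rule funpow_in[of grid, OF column_step_in c])
  moreover have "snd (?g c) = 0" using snd_funpow[OF snd_step(2), of c "k - j"] ij by simp
  ultimately obtain i' where i': "?g c = (i', 0)" "i' \<in> Zmod n" by (auto simp: grid_def prod_eq_iff)
  have "?g ((column_step ^^ k) c) = (column_step ^^ k) (?g c)"
    by (metis add.commute comp_apply funpow_add)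
  also have "\<dots> = ?g c" using column_step_funpow_zero[OF i'(2) k_ge order.refl] i'(1) by simp
  finally show ?thesis
    using funpow_inj_on[OF column_step_in column_step_inj] c funpow_in[of grid, OF column_step_in c]
    by (auto simp: inj_on_def)
qed

section \<open>The dart system carried by the grid\<close>

lemma grid_face_map:
  "((grid_theta \<circ> grid_nu) ^^ m) (c, b) = (((if b then row_step else column_step) ^^ m) c, b)"
  by (induction m) (auto simp: grid_theta_def grid_nu_def)

lemma grid_face_period: "d \<in> grid_darts \<Longrightarrow> ((grid_theta \<circ> grid_nu) ^^ k) d = d"
  using row_step_period column_step_period by (cases d) (simp add: grid_face_map grid_darts_def)

lemma grid_face_minimal:
  assumes "d \<in> grid_darts" "0 < j" "j < k"
  shows "((grid_theta \<circ> grid_nu) ^^ j) d \<noteq> d"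
proof -
  obtain c b where d: "d = (c, b)" by (cases d)
  then have c: "snd c < k" using assms(1) by (auto simp: grid_darts_def grid_def)
  have "(snd c + j) mod k \<noteq> snd c"
  proof (cases "snd c + j < k")
    case False
    then have "(snd c + j) mod k = snd c + j - k" using c assms(3) by (simp add: le_mod_geq)
    then show ?thesis using False assms(3) by linarith
  qed (use assms(2) in simp)
  then have "snd (((if b then row_step else column_step) ^^ j) c) \<noteq> snd c"
    using snd_funpow[OF snd_step(1) c] snd_funpow[OF snd_step(2) c] by simp
  then show ?thesis by (auto simp: d grid_face_map)
qed

lemma grid_theta_in: "d \<in> grid_darts \<Longrightarrow> grid_theta d \<in> grid_darts"
  using row_step_in column_step_in by (auto simp: grid_theta_def grid_darts_def)

lemma grid_theta_inj: "inj_on grid_theta grid_darts"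
  using row_step_inj column_step_inj by (auto simp: inj_on_def grid_theta_def grid_darts_def)

lemma finite_grid_darts: "finite grid_darts" and card_grid_darts: "card grid_darts = 2 * n * k"
  by (simp_all add: grid_darts_def grid_def card_cartesian_product)

text \<open>Along an orbit of \<open>grid_theta\<close> the column index moves in steps of two, so a full turn through
  the columns composes the three nontrivial column maps in the order 0, 2, 1; this composition is a
  translation by \<open>1\<close>, although in the order 0, 1, 2 it is the identity.\<close>

lemma cyclic_grid_theta: "cyclic_on grid_theta grid_darts"
proof -
  define U where "U = orbit grid_theta ((0, 0), True)"
  have zero: "((0, 0), True) \<in> grid_darts" using n_ge k_ge by (simp add: grid_darts_def grid_def Zmod_def)
  have OD: "U \<subseteq> grid_darts"
  proof
    fix x assume "x \<in> U"
    then show "x \<in> grid_darts" unfolding U_def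
      by induction (use zero grid_theta_in in blast)+
  qed
  have closed: "grid_theta x \<in> U" if "x \<in> U" for x using that unfolding U_def by (rule orbit.step)
  have "grid_theta ` U = U"
    using closed finite_subset[OF OD finite_grid_darts] inj_on_subset[OF grid_theta_inj OD]
    by (intro endo_inj_surj) auto
  \<comment> \<open>\<open>grid_theta\<close> maps the finite set \<open>U\<close> injectively into
    itself, hence onto itself, so \<open>U\<close> also contains the preimages of its elements among
    the grid darts.\<close>
  then have pull: "x \<in> U" if x: "x \<in> grid_darts" "grid_theta x \<in> U" for x
  proof -
    obtain y where y: "y \<in> U" "grid_theta x = grid_theta y"
      using x(2) \<open>grid_theta ` U = U\<close> by (metis imageE)
    then have "x = y" using inj_onD[OF grid_theta_inj y(2) x(1)] OD by blast
    then show ?thesis using y(1) by simp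
  qed
  have two: "(grid_theta ^^ 2) ((i, j), True) = ((column_map j i, (j + 2) mod k), True)" for i j
    by (simp add: eval_nat_numeral grid_theta_def row_step_def column_step_def mod_Suc_eq)
  have fwd: "((column_map j i, j'), True) \<in> U" if "((i, j), True) \<in> U" "j' = (j + 2) mod k" for i j j'
    using funpow_in[of U grid_theta, OF closed that(1), of 2] unfolding two that(2) .
  have turn: "(((i + 1) mod int n, 0), True) \<in> U" if i: "i \<in> Zmod n" and iU: "((i, 0), True) \<in> U" for i
  proof -
    define i2 where "i2 = column_map 2 (column_map 0 i)"
    have "((column_map 0 i, 2), True) \<in> U" by (rule fwd[OF iU]) (use k_ge in simp)
    then have start: "((i2, 4 mod k), True) \<in> U" unfolding i2_def by (rule fwd) simp
    \<comment> \<open>The walk passes the even columns up to k - 1 and then, k being odd, wraps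
      around to column 1: this is m = (k + 1) / 2. For k = 3 the starting column
      \<open>4 mod k\<close> is already column 1.\<close>
    have "((i2, (2 * m) mod k), True) \<in> U" if "2 \<le> m" "2 * m \<le> k + 1" for m
      using that
    proof (induction m rule: dec_induct)
      case base
      then show ?case using start by simp
    next
      case (step m)
      then have "((i2, (2 * m) mod k), True) \<in> U" by simp
      moreover have "(2 * m) mod k = 2 * m" using step.prems by simp
      ultimately have "((i2, 2 * m), True) \<in> U" by (simp only:)
      then have "((column_map (2 * m) i2, (2 * Suc m) mod k), True) \<in> U" by (rule fwd) simp
      moreover have "column_map (2 * m) i2 = i2" using step.hyps by (simp add: column_map_def)
      ultimately show ?case by (simp only:)
    qed
    from this[of "(k + 1) div 2"] have "((i2, (2 * ((k + 1) div 2)) mod k), True) \<in> U"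
      using k_ge by simp
    moreover have "(2 * ((k + 1) div 2)) mod k = 1"
    proof -
      have "2 * ((k + 1) div 2) = k + 1" using odd_k by simp
      moreover have "(k + 1) mod k = 1" unfolding mod_add_self1 using k_ge by simp
      ultimately show ?thesis by (simp only:)
    qed
    ultimately have "((i2, 1), True) \<in> U" by (simp only:)
    then have "((column_map 1 i2, 3 mod k), True) \<in> U" by (rule fwd) (simp add: numeral_3_eq_3)
    then have next3: "(((i + 1) mod int n, 3 mod k), True) \<in> U"
      unfolding i2_def column_map_cycle(2)[OF i] .
    have "(((i + 1) mod int n, (3 + 2 * q) mod k), True) \<in> U" if "3 + 2 * q \<le> k" for q
      using that
    proof (induction q)
      case 0
      then show ?case using next3 by simp
    next
      case (Suc q)
      let ?i = "(i + 1) mod int n"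
      have "((?i, (3 + 2 * q) mod k), True) \<in> U" using Suc by simp
      moreover have "(3 + 2 * q) mod k = 3 + 2 * q" using Suc.prems by simp
      ultimately have "((?i, 3 + 2 * q), True) \<in> U" by (simp only:)
      then have "((column_map (3 + 2 * q) ?i, (3 + 2 * Suc q) mod k), True) \<in> U" by (rule fwd) simp
      moreover have "column_map (3 + 2 * q) ?i = ?i" by (simp add: column_map_def)
      ultimately show ?case by (simp only:)
    qed
    from this[of "(k - 3) div 2"] have "(((i + 1) mod int n, (3 + 2 * ((k - 3) div 2)) mod k), True) \<in> U"
      using k_ge by simp
    moreover have "(3 + 2 * ((k - 3) div 2)) mod k = 0"
    proof -
      have "3 + 2 * ((k - 3) div 2) = k" using odd_k k_ge by presburger
      then show ?thesis by (simp only: mod_self)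
    qed
    ultimately show ?thesis by (simp only:)
  qed
  \<comment> \<open>An \<open>orbit\<close> begins with the image of its base point, so the base
    point itself is obtained by pulling back.\<close>
  have "grid_theta ((0, 0), True) \<in> U" unfolding U_def by (rule orbit.base)
  then have zeroO: "((0, 0), True) \<in> U" using pull[OF zero] by blast
  have "((int m mod int n, 0), True) \<in> U" for m
  proof (induction m)
    case (Suc m)
    then show ?case using turn[OF _ Suc] n_ge by (simp add: mod_simps add.commute)
  qed (use zeroO in simp)
  then have column0: "((i, 0), True) \<in> U" if "i \<in> Zmod n" for i
    using that by (metis Zmod_mod atLeastLessThan_iff Zmod_def int_nat_eq)
  have pull_funpow: "y \<in> U" if "y \<in> grid_darts" "(grid_theta ^^ m) y \<in> U" for y m
    using that(2)
  proof (induction m)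
    case (Suc m)
    then show ?case using pull funpow_in[of grid_darts, OF grid_theta_in that(1)] by simp
  qed simp
  have true: "((i, j), True) \<in> U" if ij: "i \<in> Zmod n" "j < k" for i j
  proof -
    have walk: "\<exists>i' \<in> Zmod n. (grid_theta ^^ (2 * a)) ((i, j), True) = ((i', (j + 2 * a) mod k), True)" for a
    proof (induction a)
      case 0
      then show ?case using ij by simp
    next
      case (Suc a)
      then obtain i' where i': "i' \<in> Zmod n"
        "(grid_theta ^^ (2 * a)) ((i, j), True) = ((i', (j + 2 * a) mod k), True)" by blast
      have "(grid_theta ^^ (2 * Suc a)) ((i, j), True) = (grid_theta ^^ 2) ((grid_theta ^^ (2 * a)) ((i, j), True))"
        using funpow_add[of 2 "2 * a" grid_theta] by simp
      also have "\<dots> = ((column_map ((j + 2 * a) mod k) i', ((j + 2 * a) mod k + 2) mod k), True)"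
        unfolding i'(2) two ..
      also have "((j + 2 * a) mod k + 2) mod k = (j + 2 * Suc a) mod k"
      proof -
        have "j + 2 * a + 2 = j + 2 * Suc a" by simp
        then show ?thesis unfolding mod_add_left_eq by (simp only:)
      qed
      finally show ?case using column_map_in[OF i'(1)] by blast
    qed
    \<comment> \<open>Modulo k the number (k + 1) / 2 is the inverse of 2, so 2 * a cancels j and
      the walk ends in column 0, which is already known to lie in \<open>U\<close>.\<close>
    define a where "a = (k - j) * ((k + 1) div 2)"
    obtain r where r: "k = j + r" using ij(2) by (metis le_Suc_ex less_imp_le)
    have "2 * a = (k - j) * (2 * ((k + 1) div 2))" by (simp add: a_def)
    also have "2 * ((k + 1) div 2) = k + 1" using odd_k by simp
    finally have "2 * a = r * (k + 1)" using r by simp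
    then have "j + 2 * a = k * (r + 1)" using r by (simp add: algebra_simps)
    then have "(j + 2 * a) mod k = 0" by simp
    then obtain i' where "i' \<in> Zmod n" "(grid_theta ^^ (2 * a)) ((i, j), True) = ((i', 0), True)"
      using walk[of a] by auto
    then show ?thesis
      using pull_funpow[of "((i, j), True)" "2 * a"] column0 ij by (simp add: grid_darts_def grid_def)
  qed
  have "grid_darts \<subseteq> U"
  proof
    fix x assume x: "x \<in> grid_darts"
    then obtain c b where cb: "x = (c, b)" "c \<in> grid" by (auto simp: grid_darts_def)
    have trueO: "(c, True) \<in> U" if "c \<in> grid" for c using true that by (auto simp: grid_def)
    show "x \<in> U"
    proof (cases b)
      case False
      then have "grid_theta x \<in> U" using trueO[OF row_step_in[OF cb(2)]] cb by (simp add: grid_theta_def)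
      then show ?thesis using pull[OF x] by blast
    qed (use cb trueO in simp)
  qed
  then show ?thesis using OD zero unfolding U_def by (intro cyclic_on_singleI) auto
qed

end

end

section \<open>The complete multipartite graph\<close>

lemma subgroup_J_iff:
  assumes "0 < t" "t dvd v" "0 < v" "x \<in> Zmod v"
  shows "x \<in> subgroup_J v t \<longleftrightarrow> int (v div t) dvd x"
proof
  assume "x \<in> subgroup_J v t"
  then obtain a where x: "x = (int (v div t) * a) mod int v" by (auto simp: subgroup_J_def)
  have "v div t dvd v" using assms(2) by (metis dvd_div_mult_self dvd_triv_left)
  then have "int (v div t) dvd int v" by simp
  then show "int (v div t) dvd x" unfolding x by (simp add: dvd_mod)
next
  assume "int (v div t) dvd x"
  then obtain c where c: "x = int (v div t) * c" by blast
  have w: "1 \<le> int (v div t)" using assms dvd_imp_le[OF assms(2,3)] by (simp add: div_greater_zero_iff Suc_le_eq)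
  have x: "0 \<le> x" "x < int v" using assms(4) by (auto simp: Zmod_def)
  have "0 \<le> c" using x(1) w unfolding c by (simp add: zero_le_mult_iff)
  moreover have "c \<le> x" using mult_right_mono[OF w \<open>0 \<le> c\<close>] c by simp
  ultimately have "c \<in> Zmod v" using x by (simp add: Zmod_def)
  moreover have "x = (int (v div t) * c) mod int v" using x c by simp
  ultimately show "x \<in> subgroup_J v t" unfolding subgroup_J_def by blast
qed

lemma card_subgroup_J:
  assumes "0 < t" "t dvd v" "0 < v"
  shows "subgroup_J v t \<subseteq> Zmod v" "card (subgroup_J v t) = t"
proof -
  let ?w = "int (v div t)"
  have v: "int v = ?w * int t" using assms(2) by (metis dvd_div_mult_self of_nat_mult)
  have w: "0 < ?w" using assms v by (metis of_nat_0_less_iff zero_less_mult_pos2)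
  show sub: "subgroup_J v t \<subseteq> Zmod v" using assms(3) by (auto simp: subgroup_J_def)
  have "subgroup_J v t = (\<lambda>c. ?w * c) ` {0..<int t}"
  proof (intro set_eqI iffI)
    fix x assume x: "x \<in> subgroup_J v t"
    then have xZ: "x \<in> Zmod v" using sub by blast
    then obtain c where c: "x = ?w * c" using x subgroup_J_iff[OF assms] by blast
    have "0 \<le> ?w * c" "?w * c < ?w * int t" using xZ c v by (auto simp: Zmod_def)
    then have "0 \<le> c" "c < int t" using w by (auto simp: zero_le_mult_iff)
    then show "x \<in> (\<lambda>c. ?w * c) ` {0..<int t}" using c by auto
  next
    fix x assume "x \<in> (\<lambda>c. ?w * c) ` {0..<int t}"
    then obtain c where c: "c \<in> {0..<int t}" "x = ?w * c" by blast
    then have "0 \<le> x" "x < ?w * int t" using w by simp_all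
    then have "x \<in> Zmod v" unfolding v[symmetric] by (simp add: Zmod_def)
    then show "x \<in> subgroup_J v t" using subgroup_J_iff[OF assms] c by simp
  qed
  moreover have "inj_on (\<lambda>c. ?w * c) {0..<int t}" using w by (auto simp: inj_on_def)
  ultimately show "card (subgroup_J v t) = t" by (simp add: card_image)
qed

lemma multipartite_family:
  assumes n: "5 \<le> n" "odd n" and k: "3 \<le> k" "odd k" and t: "0 < t" "t dvd 2 * n * k"
    and large: "300 \<le> n * k"
  defines "v \<equiv> 2 * n * k + t"
  shows "\<exists>F. finite F \<and>
    (\<forall>r \<in> F. biembedding (multipartite v t) r \<and> Aut (multipartite v t) r = translation v ` Zmod v \<and>
       (\<forall>f \<in> faces (multipartite v t) r. k dvd face_length f \<and> k < face_length f) \<and>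
       (prime v \<longrightarrow> gonal (k * v) (multipartite v t) r)) \<and>
    (\<forall>r \<in> F. \<forall>q \<in> F. r \<noteq> q \<longrightarrow> \<not> isomorphic_embeddings (multipartite v t) r (multipartite v t) q) \<and>
    fact (n * k) \<le> card F"
proof -
  note grid = n(2) k(2) n(1) k(1)
  define S where "S = Zmod v - subgroup_J v t"
  define w where "w = int (v div t)"
  have v0: "0 < v" using t by (simp add: v_def)
  have tv: "t dvd v" using t by (simp add: v_def)
  have vw: "int v = w * int t" using tv unfolding w_def by (metis dvd_div_mult_self of_nat_mult)
  have nk: "0 < n * k" using large by linarith
  have tle: "t \<le> 2 * n * k" using t nk by (intro dvd_imp_le) auto
  have w2: "2 \<le> w"
  proof (rule ccontr)
    assume "\<not> 2 \<le> w"
    then have "w * int t \<le> 1 * int t" by (intro mult_right_mono) auto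
    then have "v \<le> t" unfolding vw[symmetric] by simp
    then show False using nk by (simp add: v_def)
  qed
  have S: "x \<in> S \<longleftrightarrow> x \<in> Zmod v \<and> \<not> w dvd x" for x
    using subgroup_J_iff[OF t(1) tv v0] by (auto simp: S_def w_def)
  have dvd_mod_v: "w dvd x mod int v \<longleftrightarrow> w dvd x" for x
    using vw by (simp add: dvd_mod_iff)
  have "face_darts (grid_darts n k) (grid_theta n k) grid_nu v S snd n k"
  proof
    show "finite (grid_darts n k)" by (rule finite_grid_darts[OF grid])
    show "cyclic_on (grid_theta n k) (grid_darts n k)" by (rule cyclic_grid_theta[OF grid])
    show "card S = card (grid_darts n k)"
      using card_subgroup_J[OF t(1) tv v0] card_grid_darts[OF grid]
      unfolding S_def by (simp add: card_Diff_subset finite_subset[OF _ finite_Zmod] v_def)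
    show "card (grid_darts n k) = 2 * n * k" by (rule card_grid_darts[OF grid])
    show "v \<le> 2 * card (grid_darts n k)" unfolding card_grid_darts[OF grid] v_def using tle by linarith
    show "(- x) mod int v \<in> S" if "x \<in> S" for x
      using that v0 by (simp add: S dvd_mod_v)
    show "(- x) mod int v \<noteq> x" if x: "x \<in> S" for x
    proof
      assume fixed: "(- x) mod int v = x"
      have "x \<noteq> 0" using x by (auto simp: S)
      then have x0: "0 < x" "x < int v" using x by (auto simp: S Zmod_def)
      have "[- x = x] (mod int v)" using fixed x by (simp add: cong_def S)
      then have "int v dvd - x - x" by (simp only: cong_iff_dvd_diff)
      moreover have "- x - x = - (2 * x)" by simp
      ultimately have "int v dvd 2 * x" by (simp only: dvd_minus_iff)
      then obtain c where c: "2 * x = int v * c" by blast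
      have "0 < int v * c" "int v * c < int v * 2" using x0 unfolding c[symmetric] by simp_all
      then have "c = 1" using v0 by (simp add: zero_less_mult_iff)
      \<comment> \<open>The only candidate is v / 2. Since v - t is even, t is even as well, and v /
        2 = w * (t / 2) lies in the subgroup that was removed.\<close>
      then have x2: "2 * x = int v" using c by simp
      then have "even v" by presburger
      then have "even t" by (simp add: v_def)
      then obtain t' where t': "t = 2 * t'" by blast
      have "2 * x = 2 * (w * int t')" using x2 vw t' by simp
      then show False using x by (simp add: S)
    qed
    show "((grid_theta n k \<circ> grid_nu) ^^ k) d = d" if "d \<in> grid_darts n k" for d
      by (rule grid_face_period[OF grid that])
    show "((grid_theta n k \<circ> grid_nu) ^^ j) d \<noteq> d" if "d \<in> grid_darts n k" "0 < j" "j < k" for d j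
      by (rule grid_face_minimal[OF grid that])
    show "x \<in> S \<or> (\<exists>a \<in> S. \<exists>b \<in> S. x = (a + b) mod int v)" if x: "x \<in> Zmod v" for x
    proof (cases "w dvd x")
      case True
      \<comment> \<open>A multiple x of w is split as 1 + (x - 1); since w \<ge> 2, neither summand
        is a multiple of w.\<close>
      have "\<not> w dvd 1" using w2 by auto
      then have "\<not> w dvd x - 1" using True by (metis dvd_diff_right_iff)
      moreover have "1 < v" unfolding v_def using tle t(1) by linarith
      then have "1 \<in> Zmod v" by (simp add: Zmod_def)
      ultimately have "1 \<in> S" "(x - 1) mod int v \<in> S"
        using \<open>\<not> w dvd 1\<close> v0 by (simp_all add: S dvd_mod_v)
      moreover have "x = (1 + (x - 1) mod int v) mod int v" using x by (simp add: mod_simps)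
      ultimately show ?thesis by blast
    qed (use x S in simp)
    show "S \<subseteq> Zmod v" by (simp add: S_def)
    show "grid_nu d \<in> grid_darts n k" if "d \<in> grid_darts n k" for d
      using that by (cases d) (simp add: grid_nu_def grid_darts_def)
    show "grid_nu (grid_nu d) = d" "grid_nu d \<noteq> d" "snd (grid_nu d) \<longleftrightarrow> \<not> snd d"
      "snd (grid_theta n k d) \<longleftrightarrow> \<not> snd d" for d :: "(int \<times> nat) \<times> bool"
      by (cases d, simp add: grid_nu_def grid_theta_def)+
  qed (use n k v0 in simp_all)
  then interpret F: face_darts "grid_darts n k" "grid_theta n k" grid_nu v S snd n k .
  have "multipartite v t = F.cayley"
    unfolding multipartite_def F.cayley_def using v0 by (simp add: S_def)
  then show ?thesis using F.exists_family[OF large] by simp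
qed

text \<open>The filter \<open>principal\<close> asks for one constant valid for all admissible
  pairs, which is the meaning of O for fixed t; \<open>filtercomap\<close> expresses that nk tends
  to infinity within these pairs.\<close>

theorem theorem5p8:
  fixes t :: nat
  assumes "0 < t" and "\<not> [t = 0] (mod 4)"
  shows "\<exists>(\<epsilon> :: nat \<times> nat \<Rightarrow> real) (\<eta> :: nat \<times> nat \<Rightarrow> real).
    \<epsilon> \<in> O[principal (admissible_pairs t)](\<lambda>(n, k). 1 / real (n * k)) \<and>
    (\<eta> \<longlongrightarrow> 0) (inf (filtercomap (\<lambda>(n, k). n * k) at_top) (principal (admissible_pairs t))) \<and>
    (\<lambda>(n, k). 1 - main_factor n k) \<in> O[principal {(n, k). 3 \<le> k \<and> k < n}](\<lambda>(n, k). 1 / real k) \<and>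
    (\<forall>n k. 3 \<le> k \<and> k < n \<longrightarrow> 0 < main_factor n k) \<and>
    (\<forall>n k v. admissible t n k \<and> v = 2 * n * k + t \<longrightarrow>
       main_factor n k * (1 - \<epsilon> (n, k)) * (fact (n * k) / (2 * real (totient (2 * n * k + t))))
         = main_factor n k * (1 - \<eta> (n, k)) * (fact ((v - t) div 2) / (2 * real (totient v))) \<and>
       (prime v \<longrightarrow> t = 1) \<and>
       (\<exists>F :: int rotation set.
          finite F \<and>
          (\<forall>r \<in> F. biembedding (multipartite v t) r \<and>
             Aut (multipartite v t) r = translation v ` Zmod v \<and>
             (\<forall>f \<in> faces (multipartite v t) r. k dvd face_length f \<and> k < face_length f) \<and>
             (prime v \<longrightarrow> gonal (k * v) (multipartite v t) r)) \<and>
          (\<forall>r \<in> F. \<forall>q \<in> F. r \<noteq> q \<longrightarrow>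
             \<not> isomorphic_embeddings (multipartite v t) r (multipartite v t) q) \<and>
          main_factor n k * (1 - \<epsilon> (n, k)) * (fact (n * k) / (2 * real (totient (2 * n * k + t))))
            \<le> real (card F)))"
proof -
  \<comment> \<open>This function serves as both error terms, so the two forms of the bound agree
    once v - t = 2nk is inserted. In the range nk < 300 it satisfies 1 \<le> 300 / (nk), and the
    required number of embeddings is 0.\<close>
  define \<epsilon> :: "nat \<times> nat \<Rightarrow> real" where "\<epsilon> = (\<lambda>(n, k). if n * k < 300 then 1 else 0)"
  have denominator: "real n * real k / 2 \<le> real n * real k - (real k - 1)"
    "2 * real n < real n * real k - (real k - 1)" if "3 \<le> k" "k < n" for n k
  proof -
    have "0 \<le> (real n - 1) * (real k - 3)" "0 \<le> (real n - 2) * real k"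
      using that by (auto intro!: mult_nonneg_nonneg)
    then show "real n * real k / 2 \<le> real n * real k - (real k - 1)"
      "2 * real n < real n * real k - (real k - 1)"
      using that by (simp_all add: algebra_simps)
  qed
  have adm: "0 < n * k" "5 \<le> n" "odd n" "3 \<le> k" "odd k" "k < n" "t dvd 2 * n * k"
    if "admissible t n k" for n k
  proof -
    show "0 < n * k" "k < n" "t dvd 2 * n * k" "odd n" "odd k" and k3: "3 \<le> k"
      using that by (auto simp: admissible_def)
    then have "n \<noteq> 4" "4 \<le> n" by auto
    then show "5 \<le> n" by linarith
  qed
  have eps: "\<epsilon> \<in> O[principal (admissible_pairs t)](\<lambda>(n, k). 1 / real (n * k))"
  proof (rule bigoI[of _ 300])
    have "\<bar>\<epsilon> (n, k)\<bar> \<le> 300 * \<bar>1 / real (n * k)\<bar>" if "admissible t n k" for n k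
    proof (cases "n * k < 300")
      case True
      then have "real (n * k) \<le> 300" "0 < real (n * k)" using adm(1)[OF that] by linarith+
      then have "1 \<le> 300 * (1 / real (n * k))" by (simp only: le_divide_eq times_divide_eq_right) simp
      then show ?thesis using True by (simp add: \<epsilon>_def)
    qed (simp add: \<epsilon>_def)
    then show "\<forall>\<^sub>F x in principal (admissible_pairs t). norm (\<epsilon> x) \<le> 300 * norm (case x of (n, k) \<Rightarrow> 1 / real (n * k))"
      by (auto simp: eventually_principal admissible_pairs_def)
  qed
  have eta: "(\<epsilon> \<longlongrightarrow> 0) (inf (filtercomap (\<lambda>(n, k). n * k) at_top) (principal (admissible_pairs t)))"
  proof (rule tendsto_eventually)
    have "\<forall>\<^sub>F x in filtercomap (\<lambda>(n, k). n * k) at_top. \<epsilon> x = 0"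
      unfolding eventually_filtercomap
      by (intro exI[of _ "\<lambda>m. 300 \<le> m"]) (auto simp: eventually_ge_at_top \<epsilon>_def)
    then show "\<forall>\<^sub>F x in inf (filtercomap (\<lambda>(n, k). n * k) at_top) (principal (admissible_pairs t)). \<epsilon> x = 0"
      by (rule filter_leD[OF inf_le1])
  qed
  have factor: "(\<lambda>(n, k). 1 - main_factor n k) \<in> O[principal {(n, k). 3 \<le> k \<and> k < n}](\<lambda>(n, k). 1 / real k)"
  proof (rule bigoI[of _ 4])
    have "\<bar>1 - main_factor n k\<bar> \<le> 4 * \<bar>1 / real k\<bar>" if "3 \<le> k" "k < n" for n k
    proof -
      have "2 * real n / (real n * real k - (real k - 1)) \<le> 2 * real n / (real n * real k / 2)"
        using denominator[OF that] that by (intro divide_left_mono) auto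
      also have "\<dots> = 4 * (1 / real k)" using that by simp
      finally show ?thesis using denominator(2)[OF that] by (simp add: main_factor_def)
    qed
    then show "\<forall>\<^sub>F x in principal {(n, k). 3 \<le> k \<and> k < n}.
        norm (case x of (n, k) \<Rightarrow> 1 - main_factor n k) \<le> 4 * norm (case x of (n, k) \<Rightarrow> 1 / real k)"
      by (auto simp: eventually_principal)
  qed
  have pos: "0 < main_factor n k" "main_factor n k \<le> 1" if "3 \<le> k" "k < n" for n k
  proof -
    have "0 \<le> 2 * real n" by simp
    then have "0 < real n * real k - (real k - 1)" using denominator(2)[OF that] by linarith
    then show "0 < main_factor n k" "main_factor n k \<le> 1"
      using denominator(2)[OF that] by (simp_all add: main_factor_def)
  qed
  have family: "\<exists>F :: int rotation set.
          finite F \<and>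
          (\<forall>r \<in> F. biembedding (multipartite v t) r \<and>
             Aut (multipartite v t) r = translation v ` Zmod v \<and>
             (\<forall>f \<in> faces (multipartite v t) r. k dvd face_length f \<and> k < face_length f) \<and>
             (prime v \<longrightarrow> gonal (k * v) (multipartite v t) r)) \<and>
          (\<forall>r \<in> F. \<forall>q \<in> F. r \<noteq> q \<longrightarrow>
             \<not> isomorphic_embeddings (multipartite v t) r (multipartite v t) q) \<and>
          main_factor n k * (1 - \<epsilon> (n, k)) * (fact (n * k) / (2 * real (totient (2 * n * k + t))))
            \<le> real (card F)"
    if a: "admissible t n k" and v: "v = 2 * n * k + t" for n k v
  proof (cases "n * k < 300")
    case True
    then show ?thesis by (intro exI[of _ "{}"]) (simp add: \<epsilon>_def)
  next
    case False
    then have large: "300 \<le> n * k" by simp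
    obtain F where F: "finite F"
      "\<forall>r \<in> F. biembedding (multipartite v t) r \<and> Aut (multipartite v t) r = translation v ` Zmod v \<and>
       (\<forall>f \<in> faces (multipartite v t) r. k dvd face_length f \<and> k < face_length f) \<and>
       (prime v \<longrightarrow> gonal (k * v) (multipartite v t) r)"
      "\<forall>r \<in> F. \<forall>q \<in> F. r \<noteq> q \<longrightarrow> \<not> isomorphic_embeddings (multipartite v t) r (multipartite v t) q"
      "fact (n * k) \<le> card F"
      using multipartite_family[OF adm(2,3,4,5)[OF a] assms(1) adm(7)[OF a] large]
      unfolding v[symmetric] by (elim exE conjE) (rule that)
    \<comment> \<open>N! embeddings are enough: \<open>T\<close> is at least 1 and
      \<open>main_factor\<close> is at most 1, so the required number does not exceed N!.\<close>
    define T where "T = 2 * real (totient (2 * n * k + t))"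
    have "totient (2 * n * k + t) > 0" using assms(1) by simp
    then have T: "1 \<le> T" unfolding T_def by linarith
    then have "fact (n * k) / T \<le> (fact (n * k) / 1 :: real)" by (intro divide_left_mono) auto
    then have "main_factor n k * (fact (n * k) / T) \<le> 1 * fact (n * k)"
      using pos[OF adm(4,6)[OF a]] T by (intro mult_mono) auto
    also have "\<dots> \<le> real (card F)"
      using of_nat_mono[OF F(4), where 'a = real] by simp
    finally have "main_factor n k * (1 - \<epsilon> (n, k)) * (fact (n * k) / (2 * real (totient (2 * n * k + t))))
        \<le> real (card F)"
      using False by (simp add: \<epsilon>_def T_def)
    then show ?thesis using F(1,2,3) by (intro exI[of _ F] conjI)
  qed
  have t1: "t = 1" if a: "admissible t n k" and v: "v = 2 * n * k + t" "prime v" for n k v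
  proof -
    have "t dvd v" using adm(7)[OF a] by (simp add: v(1))
    then have "t = 1 \<or> t = v" using v(2) by (simp add: prime_nat_iff)
    then show ?thesis using adm(1)[OF a] v(1) by simp
  qed
  show ?thesis
  proof (rule exI[of _ \<epsilon>], rule exI[of _ \<epsilon>], intro conjI allI impI)
    show "0 < main_factor n k" if "3 \<le> k \<and> k < n" for n k using that pos(1) by blast
    fix n k v assume a: "admissible t n k \<and> v = 2 * n * k + t"
    then have "(v - t) div 2 = n * k" by simp
    then show "main_factor n k * (1 - \<epsilon> (n, k)) * (fact (n * k) / (2 * real (totient (2 * n * k + t))))
         = main_factor n k * (1 - \<epsilon> (n, k)) * (fact ((v - t) div 2) / (2 * real (totient v)))"
      using a by simp
    show "t = 1" if "prime v" using t1 a that by blast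
  qed (fact eps eta factor, fact eps eta factor, fact eps eta factor, rule family, auto)
qed

end
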